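(* Let $m\ge 2$. With all algebras realized as subspaces of $L_{\widehat{\mathfrak{so}}_{(2m+1)n}}(1,0)$ as in the context and $G=\langle\sigma_1,\dots,\sigma_n\rangle$, one has, for $n=3$, $$C_{L_{\widehat{\mathfrak{so}}_{2m+1}}(1,0)^{\otimes 3}}\bigl(L_{\widehat{\mathfrak{so}}_{2m+1}}(3,0)\bigr)=L_{\widehat{\mathfrak{sl}}_2}(4m+2,0)^{G},$$ and, for every $n\ge 4$, $$C_{L_{\widehat{\mathfrak{so}}_{2m+1}}(1,0)^{\otimes n}}\bigl(L_{\widehat{\mathfrak{so}}_{2m+1}}(n,0)\bigr)=L_{\widehat{\mathfrak{so}}_{n}}(2m+1,0)^{G}.$$
   Context: Commutant: for a vertex operator algebra $V$ and a vertex subalgebra $U$, $C_V(U)=\{v\in V: u_k v=0 \text{ for all } u\in U,\ k\ge 0\}$. Affine notation: $L_{\widehat{\mathfrak{so}}_r}(k,0)$ is the simple affine vertex operator algebra of level $k$ attached to $\mathfrak{so}_r(\mathbb C)$ (for $r=4$, $\mathfrak{so}_4\cong\mathfrak{sl}_2\oplus\mathfrak{sl}_2$ and $L_{\widehat{\mathfrak{so}}_4}(k,0)=L_{\widehat{\mathfrak{sl}}_2}(k,0)\otimes L_{\widehat{\mathfrak{sl}}_2}(k,0)$). $L_{\widehat{\mathfrak{sl}}_2}(k,0)$ is the simple affine vertex operator algebra of level $k$ attached to $\mathfrak{sl}_2(\mathbb C)$. Fermionic realization: let $\mathcal F_{(2m+1)n}$ be the irreducible module, generated by a vector $\mathbf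 1$ with $\psi_{ki}(r)\mathbf 1=0$ for $r>0$, over the Clifford algebra with generators $\psi_{ki}(r)$ ($1\le k\le 2m+1$, $1\le i\le n$, $r\in\mathbb Z+\frac12$) and relations $\psi_{ki}(r)\psi_{lj}(s)+\psi_{lj}(s)\psi_{ki}(r)=\delta_{kl}\delta_{ij}\delta_{r+s,0}$. It is a simple vertex superalgebra generated by the fields $\psi_{ki}(z)=\sum_{r\in\mathbb Z}\psi_{ki}(r+\frac12)z^{-r-1}$, and its even part is identified with $L_{\widehat{\mathfrak{so}}_{(2m+1)n}}(1,0)$. Inside it: - For $1\le j\le n$, the vertex subalgebra $L^{(j)}_{\widehat{\mathfrak{so}}_{2m+1}}(1,0)\cong L_{\widehat{\mathfrak{so}}_{2m+1}}(1,0)$ is generated by $\psi_{kj}(-\frac12)\psi_{lj}(-\frac12)\mathbf 1$, $1\le k,l\le 2m+1$, and $L_{\widehat{\mathfrak{so}}_{2m+1}}(1,0)^{\otimes n}$ is identified with $L^{(1)}_{\widehat{\mathfrak{so}}_{2m+1}}(1,0)\otimes\cdots\otimes L^{(n)}_{\widehat{\mathfrak{so}}_{2m+1}}(1,0)$. - $L_{\widehat{\mathfrak{so}}_{2m+1}}(n,0)$ denotes the (diagonal) vertex subalgebra generated by $\sum_{j=1}^n\psi_{kj}(-\frac12)\psi_{lj}(-\frac12)\mathbf 1$, $1\le k,l\le 2m+1$. - $L_{\widehat{\mathfrak{so}}_{n}}(2m+1,0)$ denotes the vertex subalgebra generated by $\sum_{k=1}^{2m+1}\psi_{ki}(-\frac12)\psi_{kj}(-\frac12)\mathbf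 1$, $1\le i,j\le n$. For $n=3$ it is isomorphic to, and denoted, $L_{\widehat{\mathfrak{sl}}_2}(4m+2,0)$. For $1\le i\le n$, $\sigma_i$ is the automorphism of $L_{\widehat{\mathfrak{so}}_{(2m+1)n}}(1,0)$ of order at most two determined by $\sigma_i(\psi_{kj}(-\frac12)\psi_{rs}(-\frac12)\mathbf 1)=(-1)^{\delta_{ij}+\delta_{is}}\psi_{kj}(-\frac12)\psi_{rs}(-\frac12)\mathbf 1$. The group $G$ acts on the subspaces above, and $(\cdot)^G$ denotes $G$-fixed points. *)

theory Defs
  imports
    Complex_Main
    "HOL-Library.Groups_Big_Fun"
    "HOL-Algebra.Bij"
    "HOL-Algebra.Generated_Groups"
begin

text \<open>
  A vertex superalgebra has the whole type \<open>'a\<close> as underlying space, with complex scalar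
  multiplication \<open>sc\<close>, even part \<open>V0\<close> and odd part \<open>V1\<close>. The vector \<open>Y a n b\<close> is the
  \<open>n\<close>-th product \<open>a\<^sub>n b\<close>, that is \<open>Y(a,z) = (\<Sum>n\<in>\<int>. a\<^sub>n z^(-n-1))\<close>. The Jacobi identity is
  stated in components. By \<open>truncation\<close> all three sums in it have only finitely many nonzero
  terms, so that \<open>Sum_any\<close> never takes its default value.
\<close>

locale vertex_superalgebra = vector_space sc
  for sc :: "complex \<Rightarrow> 'a::ab_group_add \<Rightarrow> 'a" +
  fixes V0 V1 :: "'a set" and vac :: 'a and Y :: "'a \<Rightarrow> int \<Rightarrow> 'a \<Rightarrow> 'a"
  assumes subspace_V0: "subspace V0"
    and subspace_V1: "subspace V1"
    and V0_Int_V1: "V0 \<inter> V1 = {0}"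
    and V0_plus_V1: "\<exists>x\<in>V0. \<exists>y\<in>V1. a = x + y"
    and linear_left: "Vector_Spaces.linear sc sc (\<lambda>a. Y a n b)"
    and linear_right: "Vector_Spaces.linear sc sc (\<lambda>b. Y a n b)"
    and even_even: "a \<in> V0 \<Longrightarrow> b \<in> V0 \<Longrightarrow> Y a n b \<in> V0"
    and even_odd: "a \<in> V0 \<Longrightarrow> b \<in> V1 \<Longrightarrow> Y a n b \<in> V1"
    and odd_even: "a \<in> V1 \<Longrightarrow> b \<in> V0 \<Longrightarrow> Y a n b \<in> V1"
    and odd_odd: "a \<in> V1 \<Longrightarrow> b \<in> V1 \<Longrightarrow> Y a n b \<in> V0"
    and truncation: "\<exists>N. \<forall>n\<ge>N. Y a n b = 0"
    and vac_even: "vac \<in> V0"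
    and vacuum: "Y vac n a = (if n = -1 then a else 0)"
    and creation: "n \<ge> 0 \<Longrightarrow> Y a n vac = 0" "Y a (-1) vac = a"
    and jacobi: "a \<in> V0 \<union> V1 \<Longrightarrow> b \<in> V0 \<union> V1 \<Longrightarrow>
      Sum_any (\<lambda>j::nat. sc (of_int p gchoose j) (Y (Y a (q + int j) b) (p + r - int j) c)) =
      Sum_any (\<lambda>j::nat. sc ((-1) ^ j * (of_int q gchoose j))
        (Y a (p + q - int j) (Y b (r + int j) c)
          - sc ((if a \<in> V1 \<and> b \<in> V1 then -1 else 1) * (-1) powi q)
              (Y b (q + r - int j) (Y a (p + int j) c))))"

text \<open>
  Irreducible vacuum module over the Clifford algebra. To avoid half-integer indices,
  \<open>psi k i p\<close> stands for \<open>\<psi>\<^sub>k\<^sub>i(p + 1/2)\<close>, the coefficient of \<open>z^(-p-1)\<close> in \<open>\<psi>\<^sub>k\<^sub>i(z)\<close>.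
  So \<open>\<psi>\<^sub>k\<^sub>i(-1/2)\<close> is \<open>psi k i (-1)\<close>, the condition \<open>r > 0\<close> on \<open>\<psi>\<^sub>k\<^sub>i(r)\<close> reads \<open>p \<ge> 0\<close>, and
  \<open>r + s = 0\<close> reads \<open>p + q = -1\<close>. Indices outside \<open>1 \<le> k \<le> K\<close>, \<open>1 \<le> i \<le> n\<close> are junk.
  Since \<open>vac \<noteq> 0\<close>, irreducibility makes \<open>vac\<close> a generator.
\<close>

locale clifford_vacuum_module = vector_space sc
  for sc :: "complex \<Rightarrow> 'a::ab_group_add \<Rightarrow> 'a" +
  fixes vac :: 'a and psi :: "nat \<Rightarrow> nat \<Rightarrow> int \<Rightarrow> 'a \<Rightarrow> 'a" and K n :: nat
  assumes linear_psi: "k \<in> {1..K} \<Longrightarrow> i \<in> {1..n} \<Longrightarrow> Vector_Spaces.linear sc sc (psi k i p)"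
    and clifford: "k \<in> {1..K} \<Longrightarrow> i \<in> {1..n} \<Longrightarrow> l \<in> {1..K} \<Longrightarrow> j \<in> {1..n} \<Longrightarrow>
      psi k i p (psi l j q v) + psi l j q (psi k i p v)
        = (if k = l \<and> i = j \<and> p + q = -1 then v else 0)"
    and irreducible: "subspace W \<Longrightarrow>
      (\<And>k i p w. k \<in> {1..K} \<Longrightarrow> i \<in> {1..n} \<Longrightarrow> w \<in> W \<Longrightarrow> psi k i p w \<in> W) \<Longrightarrow>
      W = {0} \<or> W = UNIV"
    and vac_nonzero: "vac \<noteq> 0"
    and psi_vac: "k \<in> {1..K} \<Longrightarrow> i \<in> {1..n} \<Longrightarrow> p \<ge> 0 \<Longrightarrow> psi k i p vac = 0"

text \<open>
  The vertex superalgebra \<open>\<F>\<close> on \<open>K n\<close> free fermions. All data are determined up to isomorphism: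
  the module by irreducibility, \<open>Y\<close> by the fields of the generators, and the parity by the
  generators being odd. The vertex operator algebra \<open>L\<^sub>s\<^sub>o\<^sub>(\<^sub>K\<^sub>n\<^sub>)(1,0)\<close> is the even part \<open>V0\<close>.
\<close>

locale fermion_vertex_superalgebra =
  vertex_superalgebra sc V0 V1 vac Y + clifford_vacuum_module sc vac psi K n
  for sc :: "complex \<Rightarrow> 'a::ab_group_add \<Rightarrow> 'a" and V0 V1 vac Y psi K n +
  assumes generator_odd: "k \<in> {1..K} \<Longrightarrow> i \<in> {1..n} \<Longrightarrow> psi k i (-1) vac \<in> V1"
    and generator_field: "k \<in> {1..K} \<Longrightarrow> i \<in> {1..n} \<Longrightarrow> Y (psi k i (-1) vac) p v = psi k i p v"

definition vertex_subalgebra ::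
  "(complex \<Rightarrow> 'a::ab_group_add \<Rightarrow> 'a) \<Rightarrow> 'a \<Rightarrow> ('a \<Rightarrow> int \<Rightarrow> 'a \<Rightarrow> 'a) \<Rightarrow> 'a set \<Rightarrow> bool" where
  "vertex_subalgebra sc vac Y U \<longleftrightarrow>
     module.subspace sc U \<and> vac \<in> U \<and> (\<forall>u\<in>U. \<forall>v\<in>U. \<forall>p. Y u p v \<in> U)"

definition generated_subalgebra ::
  "(complex \<Rightarrow> 'a::ab_group_add \<Rightarrow> 'a) \<Rightarrow> 'a \<Rightarrow> ('a \<Rightarrow> int \<Rightarrow> 'a \<Rightarrow> 'a) \<Rightarrow> 'a set \<Rightarrow> 'a set" where
  "generated_subalgebra sc vac Y S = \<Inter>{U. vertex_subalgebra sc vac Y U \<and> S \<subseteq> U}"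

definition commutant ::
  "('a::ab_group_add \<Rightarrow> int \<Rightarrow> 'a \<Rightarrow> 'a) \<Rightarrow> 'a set \<Rightarrow> 'a set \<Rightarrow> 'a set" where
  "commutant Y V U = {v \<in> V. \<forall>u\<in>U. \<forall>p\<ge>0. Y u p v = 0}"

text \<open>\<open>\<psi>\<^sub>k\<^sub>i(-1/2) \<psi>\<^sub>l\<^sub>j(-1/2) \<one>\<close>\<close>
definition bilin ::
  "'a \<Rightarrow> (nat \<Rightarrow> nat \<Rightarrow> int \<Rightarrow> 'a \<Rightarrow> 'a) \<Rightarrow> nat \<Rightarrow> nat \<Rightarrow> nat \<Rightarrow> nat \<Rightarrow> 'a" where
  "bilin vac psi k i l j = psi k i (-1) (psi l j (-1) vac)"

text \<open>\<open>L\<^sup>(\<^sup>j\<^sup>)(1,0)\<close> for \<open>so\<^sub>K\<close>\<close>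
definition L_so_factor ::
  "(complex \<Rightarrow> 'a::ab_group_add \<Rightarrow> 'a) \<Rightarrow> 'a \<Rightarrow> ('a \<Rightarrow> int \<Rightarrow> 'a \<Rightarrow> 'a) \<Rightarrow>
   (nat \<Rightarrow> nat \<Rightarrow> int \<Rightarrow> 'a \<Rightarrow> 'a) \<Rightarrow> nat \<Rightarrow> nat \<Rightarrow> 'a set" where
  "L_so_factor sc vac Y psi K j = generated_subalgebra sc vac Y
     {bilin vac psi k j l j | k l. k \<in> {1..K} \<and> l \<in> {1..K}}"

text \<open>
  \<open>L(1,0)\<^sup>\<otimes>\<^sup>n\<close> for \<open>so\<^sub>K\<close>: mutually commuting vertex subalgebras are multiplied by
  \<open>a\<^sub>1 \<otimes> \<dots> \<otimes> a\<^sub>n \<mapsto> (a\<^sub>1)\<^sub>-\<^sub>1 \<dots> (a\<^sub>n)\<^sub>-\<^sub>1 \<one>\<close>.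
\<close>
definition L_so_tensor ::
  "(complex \<Rightarrow> 'a::ab_group_add \<Rightarrow> 'a) \<Rightarrow> 'a \<Rightarrow> ('a \<Rightarrow> int \<Rightarrow> 'a \<Rightarrow> 'a) \<Rightarrow>
   (nat \<Rightarrow> nat \<Rightarrow> int \<Rightarrow> 'a \<Rightarrow> 'a) \<Rightarrow> nat \<Rightarrow> nat \<Rightarrow> 'a set" where
  "L_so_tensor sc vac Y psi K n = module.span sc
     {foldr (\<lambda>j v. Y (a j) (-1) v) [1..<Suc n] vac | a.
        \<forall>j\<in>{1..n}. a j \<in> L_so_factor sc vac Y psi K j}"

text \<open>The diagonal \<open>L(n,0)\<close> for \<open>so\<^sub>K\<close>\<close>
definition L_so_diag ::
  "(complex \<Rightarrow> 'a::ab_group_add \<Rightarrow> 'a) \<Rightarrow> 'a \<Rightarrow> ('a \<Rightarrow> int \<Rightarrow> 'a \<Rightarrow> 'a) \<Rightarrow>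
   (nat \<Rightarrow> nat \<Rightarrow> int \<Rightarrow> 'a \<Rightarrow> 'a) \<Rightarrow> nat \<Rightarrow> nat \<Rightarrow> 'a set" where
  "L_so_diag sc vac Y psi K n = generated_subalgebra sc vac Y
     {\<Sum>j=1..n. bilin vac psi k j l j | k l. k \<in> {1..K} \<and> l \<in> {1..K}}"

text \<open>\<open>L(K,0)\<close> for \<open>so\<^sub>n\<close>\<close>
definition L_so_dual ::
  "(complex \<Rightarrow> 'a::ab_group_add \<Rightarrow> 'a) \<Rightarrow> 'a \<Rightarrow> ('a \<Rightarrow> int \<Rightarrow> 'a \<Rightarrow> 'a) \<Rightarrow>
   (nat \<Rightarrow> nat \<Rightarrow> int \<Rightarrow> 'a \<Rightarrow> 'a) \<Rightarrow> nat \<Rightarrow> nat \<Rightarrow> 'a set" where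
  "L_so_dual sc vac Y psi K n = generated_subalgebra sc vac Y
     {\<Sum>k=1..K. bilin vac psi k i k j | i j. i \<in> {1..n} \<and> j \<in> {1..n}}"

text \<open>\<open>L(2 K, 0)\<close> for \<open>sl\<^sub>2\<close>, which is \<open>L(K, 0)\<close> for \<open>so\<^sub>3\<close>\<close>
definition L_sl2 ::
  "(complex \<Rightarrow> 'a::ab_group_add \<Rightarrow> 'a) \<Rightarrow> 'a \<Rightarrow> ('a \<Rightarrow> int \<Rightarrow> 'a \<Rightarrow> 'a) \<Rightarrow>
   (nat \<Rightarrow> nat \<Rightarrow> int \<Rightarrow> 'a \<Rightarrow> 'a) \<Rightarrow> nat \<Rightarrow> 'a set" where
  "L_sl2 sc vac Y psi K = L_so_dual sc vac Y psi K 3"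

text \<open>
  Automorphisms of a vertex subalgebra \<open>V\<close>. Being elements of \<open>Bij V\<close>, they are
  \<open>undefined\<close> outside \<open>V\<close>, so that they are determined by their values on \<open>V\<close>.
\<close>
definition vertex_automorphisms ::
  "(complex \<Rightarrow> 'a::ab_group_add \<Rightarrow> 'a) \<Rightarrow> 'a \<Rightarrow> ('a \<Rightarrow> int \<Rightarrow> 'a \<Rightarrow> 'a) \<Rightarrow> 'a set \<Rightarrow> ('a \<Rightarrow> 'a) set"
  where
  "vertex_automorphisms sc vac Y V = {g \<in> Bij V.
     (\<forall>u\<in>V. \<forall>v\<in>V. g (u + v) = g u + g v) \<and> (\<forall>c. \<forall>v\<in>V. g (sc c v) = sc c (g v)) \<and>
     g vac = vac \<and> (\<forall>u\<in>V. \<forall>v\<in>V. \<forall>p. g (Y u p v) = Y (g u) p (g v))}"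

definition is_sigma ::
  "(complex \<Rightarrow> 'a::ab_group_add \<Rightarrow> 'a) \<Rightarrow> 'a set \<Rightarrow> 'a \<Rightarrow> ('a \<Rightarrow> int \<Rightarrow> 'a \<Rightarrow> 'a) \<Rightarrow>
   (nat \<Rightarrow> nat \<Rightarrow> int \<Rightarrow> 'a \<Rightarrow> 'a) \<Rightarrow> nat \<Rightarrow> nat \<Rightarrow> nat \<Rightarrow> ('a \<Rightarrow> 'a) \<Rightarrow> bool" where
  "is_sigma sc V0 vac Y psi K n i g \<longleftrightarrow>
     g \<in> vertex_automorphisms sc vac Y V0 \<and>
     (\<forall>k\<in>{1..K}. \<forall>j\<in>{1..n}. \<forall>r\<in>{1..K}. \<forall>s\<in>{1..n}.
        g (bilin vac psi k j r s) =
          sc ((-1) ^ (of_bool (i = j) + of_bool (i = s))) (bilin vac psi k j r s))"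

definition fixed_points :: "('a \<Rightarrow> 'a) set \<Rightarrow> 'a set \<Rightarrow> 'a set" where
  "fixed_points G U = {v \<in> U. \<forall>g\<in>G. g v = v}"

end

theory Submission
  imports Defs
begin

text \<open>
  Put \<open>K = 2 m + 1\<close>. The currents \<open>x\<^sub>i\<^sub>j = \<Sum>\<^sub>k \<psi>\<^sub>k\<^sub>i \<psi>\<^sub>k\<^sub>j\<close> generate the algebra for \<open>so\<^sub>n\<close> of level
  \<open>K\<close>, and the currents \<open>y\<^sub>k\<^sub>l = \<Sum>\<^sub>i \<psi>\<^sub>k\<^sub>i \<psi>\<^sub>l\<^sub>i\<close> generate the diagonal algebra for \<open>so\<^sub>K\<close> of level \<open>n\<close>.
  For every \<open>n \<ge> 3\<close> the theorem is the intersection of two statements about the even part \<open>V0\<close>: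
  the tensor product is the set of vectors of \<open>V0\<close> fixed by all \<open>\<sigma>\<^sub>i\<close> (\<open>tensor_eq_sigma_fixed\<close>), and
  the commutant of the \<open>y\<^sub>k\<^sub>l\<close> in \<open>V0\<close> is generated by the \<open>x\<^sub>i\<^sub>j\<close> (\<open>diag_commutant_eq_dual\<close>).

  The first statement is about words in the creation operators. The involution \<open>\<sigma>\<^sub>i\<close> fixes or
  negates an even word according to the parity of its number of letters from column \<open>i\<close>. A word in which every column
  occurs an even number of times is a product of pairs of letters from the same column, and the
  tensor product is closed under such pairs. Both facts rest on \<open>graded_pair_closure\<close>: in the
  presence of three labels, the states \<open>\<psi>\<^sub>a(-1/2) \<psi>\<^sub>b(-1/2) \<one>\<close> generate all even words.

  For the second statement, let \<open>v\<close> be an even vector of conformal weight \<open>h > 0\<close> that commutes with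
  the \<open>y\<^sub>k\<^sub>l\<close>. By the Sugawara identity (\<open>sugawara_state\<close>) the sum of all \<open>x\<^sub>i\<^sub>j(-1) x\<^sub>i\<^sub>j\<close> and all
  \<open>y\<^sub>k\<^sub>l(-1) y\<^sub>k\<^sub>l\<close> is a multiple of the conformal vector. The \<open>y\<close>-part of its mode kills \<open>v\<close>. In the \<open>x\<close>-part,
  the terms \<open>x\<^sub>i\<^sub>j(-s) x\<^sub>i\<^sub>j(s) v\<close> with \<open>s > 0\<close> lie in the subalgebra generated by the currents, by induction
  on \<open>h\<close>. Hence that subalgebra contains \<open>T v\<close>, where \<open>T\<close> is, up to a factor, the Casimir operator of \<open>so\<^sub>n\<close>
  minus the scalar \<open>(n + K - 2) 2 h\<close>. Weight spaces are finite-dimensional and \<open>T\<close> preserves the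
  subalgebra, so it remains to see that \<open>T\<close> is injective on the even vectors of weight \<open>h\<close>
  (\<open>casimir_extremal_zero\<close>).

  The kernel of \<open>T\<close> is stable under \<open>so\<^sub>n\<close>. If it is not zero, it contains a highest weight vector, of
  weight \<open>\<mu>\<close> say, on which the Casimir operator acts by \<open>\<Sum>\<^sub>b \<mu>\<^sub>b (\<mu>\<^sub>b + n - 2 b)\<close>. Counting fermions gives
  \<open>\<Sum>\<^sub>b \<bar>\<mu>\<^sub>b\<bar> \<le> 2 h\<close>, and the exclusion principle gives \<open>\<Sum>\<^sub>b \<mu>\<^sub>b\<^sup>2 \<le> K 2 h\<close>. So this value equals
  \<open>(n + K - 2) 2 h\<close> only for \<open>\<mu> = (K, 0, \<dots>, 0)\<close> and \<open>2 h = K\<close>. But \<open>K\<close> is odd and even vectors have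
  integral weight. (With \<open>\<psi>\<^sub>k\<^sup>+ = \<psi>\<^sub>k\<^sub>1 + \<i> \<psi>\<^sub>k\<^sub>2\<close>, the odd vector \<open>\<psi>\<^sub>1\<^sup>+(-1/2) \<dots> \<psi>\<^sub>K\<^sup>+(-1/2) \<one>\<close> does attain
  the bound.)
\<close>

section \<open>Eigenvectors and finite-dimensional subspaces\<close>

locale complex_vector_space = vector_space sc
  for sc :: "complex \<Rightarrow> 'a::ab_group_add \<Rightarrow> 'a"
begin

abbreviation lin :: "('a \<Rightarrow> 'a) \<Rightarrow> bool"
  where "lin f \<equiv> Vector_Spaces.linear sc sc f"

lemma
  fixes f :: "'a \<Rightarrow> 'a"
  assumes "lin f"
  shows lin_add: "f (x + y) = f x + f y"
    and lin_scale: "f (sc c x) = sc c (f x)"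
    and lin_zero: "f 0 = 0"
    and lin_neg: "f (- x) = - f x"
    and lin_diff: "f (x - y) = f x - f y"
    and lin_sum: "f (sum g S) = (\<Sum>a\<in>S. f (g a))"
proof -
  interpret module_hom sc sc f
    using assms by (simp add: linear_iff_module_hom)
  show "f (x + y) = f x + f y" "f (sc c x) = sc c (f x)" "f 0 = 0" "f (- x) = - f x"
    "f (x - y) = f x - f y" "f (sum g S) = (\<Sum>a\<in>S. f (g a))"
    by (simp_all add: add scale neg diff sum)
qed

lemma linI: "(\<And>x y. f (x + y) = f x + f y) \<Longrightarrow> (\<And>c x. f (sc c x) = sc c (f x)) \<Longrightarrow> lin f"
  using vector_space_axioms module_axioms
  by (simp add: Vector_Spaces.linear_def module_hom_def module_hom_axioms_def)

lemma lin_span_into: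
  assumes "lin f" "subspace U" "\<And>s. s \<in> S \<Longrightarrow> f s \<in> U" "v \<in> span S"
  shows "f v \<in> U"
  using assms(4)
  by (induction rule: span_induct_alt)
    (auto simp: lin_zero[OF assms(1)] lin_add[OF assms(1)] lin_scale[OF assms(1)]
      assms(2,3) subspace_0 subspace_add subspace_scale)

text \<open>Applying \<open>f - l a\<close> removes from an eigenvector the component along an eigenvector of a
  different eigenvalue \<open>l a\<close> and only rescales the eigenvector itself.\<close>

lemma eigenvector_in_span:
  assumes f: "lin f" and ev: "\<And>a. a \<in> A \<Longrightarrow> f (w a) = sc (l a) (w a)"
    and v: "v \<in> span (w ` A)" and eig: "f v = sc \<mu> v"
  shows "v \<in> span (w ` {a \<in> A. l a = \<mu>})"
proof -
  obtain T r where T: "finite T" "T \<subseteq> w ` A" and vT: "v = (\<Sum>x\<in>T. sc (r x) x)"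
    using v unfolding span_explicit by auto
  obtain B where B: "finite B" "B \<subseteq> A" "T = w ` B"
    using finite_subset_image[OF T] by auto
  have vB: "v \<in> span (w ` B)"
    unfolding vT B(3)[symmetric] by (intro span_sum span_scale span_base)
  have "v \<in> span (w ` {a \<in> B. l a = \<mu>})"
    using B(1,2) vB eig
  proof (induction B arbitrary: v rule: finite_induct)
    case empty
    then show ?case by simp
  next
    case (insert a B)
    obtain c where c: "v - sc c (w a) \<in> span (w ` B)"
      using insert.prems by (auto simp: span_breakdown_eq)
    define u where "u = v - sc c (w a)"
    have v: "v = u + sc c (w a)" by (simp add: u_def)
    have fa: "f (w a) = sc (l a) (w a)" using ev insert.prems by auto
    show ?case
    proof (cases "l a = \<mu>")
      case True
      have "f u = sc \<mu> u"
        using insert.prems fa True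
        by (simp add: u_def lin_diff[OF f] lin_scale[OF f] scale_right_diff_distrib mult.commute)
      then have "u \<in> span (w ` {a \<in> B. l a = \<mu>})"
        using insert c by (simp add: u_def)
      then have "u \<in> span (w ` {b \<in> insert a B. l b = \<mu>})"
        using span_mono[of "w ` {a \<in> B. l a = \<mu>}" "w ` {b \<in> insert a B. l b = \<mu>}"] by blast
      moreover have "w a \<in> span (w ` {b \<in> insert a B. l b = \<mu>})"
        using True by (intro span_base) auto
      ultimately show ?thesis unfolding v by (intro span_add span_scale)
    next
      case False
      have "f u \<in> span (w ` B)"
      proof (rule lin_span_into[OF f subspace_span _ c[folded u_def]])
        fix s assume "s \<in> w ` B"
        then obtain b where "b \<in> B" "s = w b" by auto
        then have "f s = sc (l b) s" "s \<in> span (w ` B)"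
          using ev[of b] insert.prems by (auto intro: span_base)
        then show "f s \<in> span (w ` B)" by (simp add: span_scale)
      qed
      then have "f u - sc (l a) u \<in> span (w ` B)"
        using c by (auto simp: u_def intro: span_diff span_scale)
      moreover have "f u - sc (l a) u = sc (\<mu> - l a) v"
        using insert.prems(3) fa
        by (simp add: u_def lin_diff[OF f] lin_scale[OF f] scale_right_diff_distrib
            scale_left_diff_distrib algebra_simps)
      ultimately have "sc (inverse (\<mu> - l a)) (sc (\<mu> - l a) v) \<in> span (w ` B)"
        by (metis span_scale)
      then have "v \<in> span (w ` B)" using False by simp
      then have "v \<in> span (w ` {a \<in> B. l a = \<mu>})" using insert by auto
      moreover have "{b \<in> insert a B. l b = \<mu>} = {a \<in> B. l a = \<mu>}" using False by auto
      ultimately show ?thesis by simp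
    qed
  qed
  then show ?thesis
    using span_mono[of "w ` {a \<in> B. l a = \<mu>}" "w ` {a \<in> A. l a = \<mu>}"] B(2) by blast
qed

definition eigenvectors :: "('a \<Rightarrow> 'a) \<Rightarrow> complex set \<Rightarrow> 'a set"
  where "eigenvectors f \<Lambda> = {u. \<exists>\<mu>\<in>\<Lambda>. f u = sc \<mu> u}"

lemma eigenvalue_in_spectrum:
  assumes f: "lin f" and u: "u \<in> span (eigenvectors f \<Lambda>)" "f u = sc \<nu> u" "u \<noteq> 0"
  shows "\<nu> \<in> \<Lambda>"
proof (rule ccontr)
  assume n: "\<nu> \<notin> \<Lambda>"
  define l where "l u = (SOME \<mu>. \<mu> \<in> \<Lambda> \<and> f u = sc \<mu> u)" for u
  have l: "l s \<in> \<Lambda> \<and> f s = sc (l s) s" if "s \<in> eigenvectors f \<Lambda>" for s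
    using that someI_ex[of "\<lambda>\<mu>. \<mu> \<in> \<Lambda> \<and> f s = sc \<mu> s"] by (auto simp: eigenvectors_def l_def)
  have "u \<in> span ((\<lambda>x. x) ` {a \<in> eigenvectors f \<Lambda>. l a = \<nu>})"
    by (rule eigenvector_in_span[OF f _ _ u(2)]) (use l u in auto)
  moreover have "{a \<in> eigenvectors f \<Lambda>. l a = \<nu>} = {}"
    using l n by auto
  ultimately show False using u(3) by simp
qed

text \<open>A subspace that is invariant under a diagonalizable operator contains the eigencomponents
  of each of its vectors.\<close>

lemma invariant_subspace_eigenvectors:
  assumes f: "lin f" and W: "subspace W" "\<And>v. v \<in> W \<Longrightarrow> f v \<in> W"
    and fin: "finite \<Lambda>" and v: "v \<in> W" "v \<in> span (eigenvectors f \<Lambda>)"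
  shows "v \<in> span (W \<inter> eigenvectors f \<Lambda>)"
  using fin v
proof (induction \<Lambda> arbitrary: v rule: finite_induct)
  case empty
  then show ?case by (simp add: eigenvectors_def)
next
  case (insert \<mu> \<Lambda>)
  let ?g = "\<lambda>x. f x - sc \<mu> x"
  have g: "lin ?g"
    by (rule linI) (simp_all add: lin_add[OF f] lin_scale[OF f] algebra_simps)
  have mono: "span (W \<inter> eigenvectors f \<Lambda>) \<subseteq> span (W \<inter> eigenvectors f (insert \<mu> \<Lambda>))"
    by (rule span_mono) (auto simp: eigenvectors_def)
  have "?g v \<in> span (eigenvectors f \<Lambda>)"
  proof (rule lin_span_into[OF g subspace_span _ insert.prems(2)])
    fix s assume "s \<in> eigenvectors f (insert \<mu> \<Lambda>)"
    then obtain \<nu> where \<nu>: "\<nu> = \<mu> \<or> \<nu> \<in> \<Lambda>" "f s = sc \<nu> s" by (auto simp: eigenvectors_def)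
    then have "\<nu> = \<mu> \<or> s \<in> span (eigenvectors f \<Lambda>)"
      by (auto simp: eigenvectors_def intro!: span_base)
    then show "?g s \<in> span (eigenvectors f \<Lambda>)"
      using \<nu>(2) by (auto intro: span_scale span_diff span_zero)
  qed
  moreover have "?g v \<in> W" using W insert.prems by (intro subspace_diff subspace_scale) auto
  ultimately have "?g v \<in> span (W \<inter> eigenvectors f \<Lambda>)" using insert.IH by auto
  then have "\<exists>u'\<in>span (W \<inter> eigenvectors f \<Lambda>). ?g u' = ?g v"
  proof (induction rule: span_induct_alt)
    case base
    then show ?case using lin_zero[OF g] by (intro bexI[of _ 0] span_zero) simp
  next
    case (step c x y)
    then obtain y' where y': "y' \<in> span (W \<inter> eigenvectors f \<Lambda>)" "?g y' = y" by auto
    from step obtain \<nu> where \<nu>: "\<nu> \<in> \<Lambda>" "f x = sc \<nu> x" by (auto simp: eigenvectors_def)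
    define x' where "x' = sc (c / (\<nu> - \<mu>)) x"
    have "\<nu> \<noteq> \<mu>" using \<nu> insert.hyps by auto
    then have c: "\<nu> * (c / (\<nu> - \<mu>)) - \<mu> * (c / (\<nu> - \<mu>)) = c"
      by (metis eq_iff_diff_eq_0 left_diff_distrib nonzero_mult_div_cancel_left times_divide_eq_right)
    have "?g x' = sc (\<nu> * (c / (\<nu> - \<mu>)) - \<mu> * (c / (\<nu> - \<mu>))) x"
      using \<nu> by (simp add: x'_def lin_scale[OF f] scale_left_diff_distrib mult.commute)
    then have "?g x' = sc c x" by (simp only: c)
    moreover have "x' \<in> span (W \<inter> eigenvectors f \<Lambda>)"
      unfolding x'_def using step by (intro span_scale span_base) auto
    ultimately show ?case
      using y' lin_add[OF g, of x' y'] span_add by (intro bexI[of _ "x' + y'"]) auto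
  qed
  then obtain u' where u': "u' \<in> span (W \<inter> eigenvectors f \<Lambda>)" "?g u' = ?g v" by auto
  have "u' \<in> W" using u'(1) W(1) by (metis Int_lower1 span_minimal subsetD)
  then have "v - u' \<in> W" using W(1) insert.prems by (simp add: subspace_diff)
  moreover have "f (v - u') = sc \<mu> (v - u')"
    using u'(2) by (simp add: lin_diff[OF f] algebra_simps)
  ultimately have "v - u' \<in> span (W \<inter> eigenvectors f (insert \<mu> \<Lambda>))"
    by (intro span_base) (auto simp: eigenvectors_def)
  moreover have "u' \<in> span (W \<inter> eigenvectors f (insert \<mu> \<Lambda>))" using u' mono by auto
  ultimately show ?case using span_add by fastforce
qed

lemma injective_imp_onto_finite_dimensional:
  assumes T: "lin T" and U: "subspace U" "U \<subseteq> span S" "finite S"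
    and TU: "\<And>u. u \<in> U \<Longrightarrow> T u \<in> U" and inj: "\<And>u. u \<in> U \<Longrightarrow> T u = 0 \<Longrightarrow> u = 0"
  shows "T ` U = U"
proof -
  obtain B where B: "B \<subseteq> U" "independent B" "U \<subseteq> span B"
    using maximal_independent_subset[of U] by auto
  have sB: "span B = U" using B U span_minimal by blast
  have fB: "finite B" using independent_span_bound[OF U(3) B(2)] B U by auto
  have injU: "inj_on T U"
    by (rule inj_onI) (metis T U(1) inj lin_diff right_minus_eq subspace_diff)
  interpret h: module_hom sc sc T
    using T by (simp add: linear_iff_module_hom)
  have ind: "independent (T ` B)"
    by (rule h.independent_injective_image[OF B(2)]) (simp add: sB injU)
  have card: "card (T ` B) = card B"
    using injU B(1) by (meson card_image inj_on_subset)
  have "u \<in> span (T ` B)" if u: "u \<in> U" for u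
  proof (rule ccontr)
    assume n: "u \<notin> span (T ` B)"
    then have "independent (insert u (T ` B))" using ind by (rule independent_insertI)
    moreover have "insert u (T ` B) \<subseteq> span B" using u B TU sB by auto
    ultimately have "card (insert u (T ` B)) \<le> card B"
      using independent_span_bound[OF fB] by blast
    moreover have "u \<notin> T ` B" using n span_base by blast
    ultimately show False using card fB by simp
  qed
  then have "U \<subseteq> T ` U" using h.span_image[of B] sB by auto
  then show ?thesis using TU by auto
qed

lemma eq_uminus_imp_zero: "x = - x \<Longrightarrow> x = 0" for x :: 'a
proof -
  assume "x = - x"
  then have "x + x = 0" by (metis add.right_inverse)
  then have "sc 2 x = 0" by (metis one_add_one scale_left_distrib scale_one)
  then show "x = 0" by simp
qed

end

section \<open>The quadratic Casimir operator of the orthogonal Lie algebra\<close>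

text \<open>The operator \<open>X i j\<close> stands for the skew-symmetric matrix \<open>E\<^sub>i\<^sub>j - E\<^sub>j\<^sub>i\<close>.\<close>

locale so_action = complex_vector_space sc
  for sc :: "complex \<Rightarrow> 'a::ab_group_add \<Rightarrow> 'a" +
  fixes X :: "nat \<Rightarrow> nat \<Rightarrow> 'a \<Rightarrow> 'a" and n :: nat
  assumes lin_X: "i \<in> {1..n} \<Longrightarrow> j \<in> {1..n} \<Longrightarrow> lin (X i j)"
    and X_skew: "i \<in> {1..n} \<Longrightarrow> j \<in> {1..n} \<Longrightarrow> X i j v = - X j i v"
    and X_commutator: "i \<in> {1..n} \<Longrightarrow> j \<in> {1..n} \<Longrightarrow> l \<in> {1..n} \<Longrightarrow> r \<in> {1..n} \<Longrightarrow>
      X i j (X l r v) - X l r (X i j v) =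
        (if j = l then X i r v else 0) - (if i = l then X j r v else 0)
        + (if j = r then X l i v else 0) - (if i = r then X l j v else 0)"
begin

text \<open>Each unordered pair is counted twice, and the \<open>X i j\<close> are skew: this is \<open>-2\<close> times the
  operator that acts on a module of highest weight \<open>\<mu>\<close> by \<open>(\<mu>, \<mu> + 2 \<rho>)\<close>.\<close>
definition casimir :: "'a \<Rightarrow> 'a"
  where "casimir v = (\<Sum>i\<in>{1..n}. \<Sum>j\<in>{1..n}. X i j (X i j v))"

lemma lin_casimir: "lin casimir"
proof (rule linI)
  show "casimir (x + y) = casimir x + casimir y" for x y
    unfolding casimir_def sum.distrib[symmetric]
    by (intro sum.cong refl) (simp add: lin_add[OF lin_X])
  show "casimir (sc c x) = sc c (casimir x)" for c x
    unfolding casimir_def scale_sum_right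
    by (intro sum.cong refl) (simp add: lin_scale[OF lin_X])
qed

text \<open>In the commutator with \<open>X i j\<close>, the terms from \<open>\<delta>\<^sub>j\<^sub>l\<close> cancel those from \<open>\<delta>\<^sub>i\<^sub>l\<close>, and the terms from
  \<open>\<delta>\<^sub>j\<^sub>r\<close> cancel those from \<open>\<delta>\<^sub>i\<^sub>r\<close>, after summation over the other index.\<close>

lemma casimir_commute:
  assumes ij: "i \<in> {1..n}" "j \<in> {1..n}"
  shows "casimir (X i j v) = X i j (casimir v)"
proof -
  define C where "C l r v = (if j = l then X i r v else 0) - (if i = l then X j r v else 0)
        + (if j = r then X l i v else 0) - (if i = r then X l j v else 0)" for l r v
  have C: "X i j (X l r v) = X l r (X i j v) + C l r v" if "l \<in> {1..n}" "r \<in> {1..n}" for l r v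
    using X_commutator[OF ij that, of v] by (simp add: C_def algebra_simps)
  have "X i j (casimir v) = (\<Sum>l\<in>{1..n}. \<Sum>r\<in>{1..n}. X i j (X l r (X l r v)))"
    unfolding casimir_def by (simp add: lin_sum[OF lin_X[OF ij]])
  also have "\<dots> = (\<Sum>l\<in>{1..n}. \<Sum>r\<in>{1..n}.
      X l r (X l r (X i j v)) + (X l r (C l r v) + C l r (X l r v)))"
    by (intro sum.cong refl) (simp add: C lin_add[OF lin_X])
  also have "\<dots> = casimir (X i j v) + (\<Sum>l\<in>{1..n}. \<Sum>r\<in>{1..n}. X l r (C l r v) + C l r (X l r v))"
    unfolding casimir_def by (simp add: sum.distrib)
  also have "(\<Sum>l\<in>{1..n}. \<Sum>r\<in>{1..n}. X l r (C l r v) + C l r (X l r v)) =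
     (\<Sum>l\<in>{1..n}. \<Sum>r\<in>{1..n}.
        ((if j = l then X j r (X i r v) + X i r (X j r v) else 0)
        - (if i = l then X i r (X j r v) + X j r (X i r v) else 0))
        + ((if j = r then X l j (X l i v) + X l i (X l j v) else 0)
        - (if i = r then X l i (X l j v) + X l j (X l i v) else 0)))"
    unfolding C_def
    by (intro sum.cong refl) (simp add: lin_add[OF lin_X] lin_diff[OF lin_X] lin_zero[OF lin_X] lin_neg[OF lin_X])
  also have "\<dots> = 0"
  proof -
    have "(\<Sum>l\<in>{1..n}. \<Sum>r\<in>{1..n}.
        (if j = l then X j r (X i r v) + X i r (X j r v) else 0)
        - (if i = l then X i r (X j r v) + X j r (X i r v) else 0)) =
        (\<Sum>r\<in>{1..n}. \<Sum>l\<in>{1..n}.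
        (if j = l then X j r (X i r v) + X i r (X j r v) else 0)
        - (if i = l then X i r (X j r v) + X j r (X i r v) else 0))"
      by (rule sum.swap)
    also have "\<dots> = 0"
      using ij by (simp add: sum_subtractf sum.delta add.commute)
    finally have 1: "(\<Sum>l\<in>{1..n}. \<Sum>r\<in>{1..n}.
        (if j = l then X j r (X i r v) + X i r (X j r v) else 0)
        - (if i = l then X i r (X j r v) + X j r (X i r v) else 0)) = 0" .
    have 2: "(\<Sum>l\<in>{1..n}. \<Sum>r\<in>{1..n}. (if j = r then X l j (X l i v) + X l i (X l j v) else 0)
        - (if i = r then X l i (X l j v) + X l j (X l i v) else 0)) = 0"
      using ij by (simp add: sum_subtractf sum.delta add.commute)
    show ?thesis using 1 2 by (simp only: sum.distrib add_0)
  qed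
  finally show ?thesis by simp
qed

text \<open>
  The induction peels off one pair of indices \<open>p, q = p + 1\<close> at a time. Among the eigenvectors of
  \<open>J = X p q\<close> take those of the largest eigenvalue \<open>\<i> \<mu>\<close>. They form a module for the rotations of the
  remaining indices \<open>l\<close>, and \<open>E\<^sub>l = X p l + \<i> X q l\<close>, which raises \<open>\<mu>\<close> by one, annihilates them. From
  \<open>(X p l - \<i> X q l) E\<^sub>l = 0\<close> one reads off \<open>(X p l)\<^sup>2 + (X q l)\<^sup>2 = - \<mu>\<close>, so that the pair contributes
  \<open>- 2 \<mu>\<^sup>2 - 2 (n - q) \<mu>\<close> to the Casimir operator, with \<open>q = 2 b\<close>.
\<close>

lemma highest_weight_vector:
  assumes "subspace Z" "Z \<noteq> {0}"
    and "\<And>i j v. i \<in> {c<..n} \<Longrightarrow> j \<in> {c<..n} \<Longrightarrow> v \<in> Z \<Longrightarrow> X i j v \<in> Z"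
    and "finite (\<Lambda> :: int set)"
    and "\<And>b. c < 2 * b \<Longrightarrow> 2 * b \<le> n \<Longrightarrow>
      Z \<subseteq> span (eigenvectors (X (2 * b - 1) (2 * b)) ((\<lambda>k. \<i> * of_int k) ` \<Lambda>))"
    and "even c"
  shows "\<exists>v \<mu>. v \<in> Z \<and> v \<noteq> 0 \<and>
      (\<forall>b. c < 2 * b \<and> 2 * b \<le> n \<longrightarrow> X (2 * b - 1) (2 * b) v = sc (\<i> * of_int (\<mu> b)) v) \<and>
      (\<Sum>i\<in>{c<..n}. \<Sum>j\<in>{c<..n}. X i j (X i j v)) =
        sc (of_int (- 2 * (\<Sum>b | c < 2 * b \<and> 2 * b \<le> n. \<mu> b * (\<mu> b + int n - 2 * int b)))) v"
  using assms
proof (induction "n - c" arbitrary: c Z rule: less_induct)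
  case less
  note Z = less.prems
  obtain z where z: "z \<in> Z" "z \<noteq> 0" using Z(1,2) subspace_0 by auto
  consider "n \<le> c + 1" | "c + 2 \<le> n" by linarith
  then show ?case
  proof cases
    case 1
    have no: "{b. c < 2 * b \<and> 2 * b \<le> n} = {}"
      using 1 Z(6) by (auto elim!: evenE)
    have "X i j v = 0" if "i \<in> {c<..n}" "j \<in> {c<..n}" for i j v
    proof -
      have "i = n" "j = n" "1 \<le> n" using that 1 by auto
      then show ?thesis using X_skew[of n n v] eq_uminus_imp_zero by simp
    qed
    then have "(\<Sum>i\<in>{c<..n}. \<Sum>j\<in>{c<..n}. X i j (X i j z)) = 0"
      by (intro sum.neutral) auto
    then show ?thesis using z no
      by (intro exI[of _ z] exI[of _ "\<lambda>_. 0"]) auto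
  next
    case 2
    obtain a where a: "c = 2 * a" using Z(6) by auto
    define p q where "p = c + 1" and "q = c + 2"
    have pq: "p \<in> {1..n}" "q \<in> {1..n}" "p \<in> {c<..n}" "q \<in> {c<..n}" "p \<noteq> q" "{c<..n} = insert p (insert q {q<..n})"
      "p \<notin> insert q {q<..n}" "q \<notin> {q<..n}"
      using 2 by (auto simp: p_def q_def)
    let ?b = "a + 1"
    have b: "c < 2 * ?b" "2 * ?b \<le> n" "2 * ?b - 1 = p" "2 * ?b = q" using a 2 by (auto simp: p_def q_def)
    define J where "J = X p q"
    have J: "lin J" using lin_X pq by (simp add: J_def)
    have span: "Z \<subseteq> span (eigenvectors J ((\<lambda>k. \<i> * of_int k) ` \<Lambda>))"
      using Z(5)[OF b(1,2)] b by (simp add: J_def)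
    define M where "M = {k\<in>\<Lambda>. \<exists>v\<in>Z. v \<noteq> 0 \<and> J v = sc (\<i> * of_int k) v}"
    have inM: "k \<in> M" if v: "v \<in> Z" "v \<noteq> 0" "J v = sc (\<i> * of_int k) v" for v k
    proof -
      have "\<i> * of_int k \<in> (\<lambda>k. \<i> * of_int k) ` \<Lambda>"
        using eigenvalue_in_spectrum[OF J _ v(3,2)] span v(1) by auto
      then show ?thesis using v by (auto simp: M_def)
    qed
    have "M \<noteq> {}"
    proof
      assume "M = {}"
      have "z \<in> span (Z \<inter> eigenvectors J ((\<lambda>k. \<i> * of_int k) ` \<Lambda>))"
        by (rule invariant_subspace_eigenvectors[OF J])
          (use Z pq z span in \<open>auto simp: J_def\<close>)
      moreover have "Z \<inter> eigenvectors J ((\<lambda>k. \<i> * of_int k) ` \<Lambda>) \<subseteq> {0}"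
        using inM \<open>M = {}\<close> by (auto simp: eigenvectors_def)
      ultimately have "z \<in> span {0}" using span_mono by blast
      then show False using z by simp
    qed
    define \<mu> where "\<mu> = Max M"
    have fM: "finite M" using Z(4) by (simp add: M_def)
    have \<mu>: "\<mu> \<in> M" using Max_in[OF fM \<open>M \<noteq> {}\<close>] by (simp add: \<mu>_def)
    have \<mu>1: "\<mu> + 1 \<notin> M" using Max_ge[OF fM, of "\<mu> + 1"] by (auto simp: \<mu>_def)
    define Z' where "Z' = {v\<in>Z. J v = sc (\<i> * of_int \<mu>) v}"
    have Z'sub: "subspace Z'"
      using Z(1) by (auto simp: Z'_def subspace_def lin_zero[OF J] lin_add[OF J] lin_scale[OF J] scale_right_distrib mult.commute)
    have Z'nz: "Z' \<noteq> {0}" using \<mu> by (auto simp: M_def Z'_def)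
    have Z'inv: "X i j v \<in> Z'" if "i \<in> {q<..n}" "j \<in> {q<..n}" "v \<in> Z'" for i j v
    proof -
      have ij: "i \<in> {1..n}" "j \<in> {1..n}" "i \<in> {c<..n}" "j \<in> {c<..n}"
        "i \<noteq> p" "i \<noteq> q" "j \<noteq> p" "j \<noteq> q" using that by (auto simp: p_def q_def)
      have "J (X i j v) = X i j (J v)"
        using X_commutator[OF pq(1,2) ij(1,2), of v] ij by (simp add: J_def)
      then show ?thesis using that Z(3)[OF ij(3,4)] by (auto simp: Z'_def lin_scale[OF lin_X[OF ij(1,2)]])
    qed
    have sub: "Z' \<subseteq> span (eigenvectors (X (2 * b - 1) (2 * b)) ((\<lambda>k. \<i> * of_int k) ` \<Lambda>))"
      if "q < 2 * b" "2 * b \<le> n" for b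
      using Z(5)[of b] that by (auto simp: Z'_def q_def)
    have nq: "n - q < n - c" "even q" using 2 Z(6) by (auto simp: q_def)
    obtain v \<nu> where v: "v \<in> Z'" "v \<noteq> 0"
      and \<nu>: "\<And>b. q < 2 * b \<Longrightarrow> 2 * b \<le> n \<Longrightarrow> X (2 * b - 1) (2 * b) v = sc (\<i> * of_int (\<nu> b)) v"
      and cas: "(\<Sum>i\<in>{q<..n}. \<Sum>j\<in>{q<..n}. X i j (X i j v)) =
        sc (of_int (- 2 * (\<Sum>b | q < 2 * b \<and> 2 * b \<le> n. \<nu> b * (\<nu> b + int n - 2 * int b)))) v"
      using less.hyps[OF nq(1) Z'sub Z'nz Z'inv Z(4) sub nq(2)] by blast
    define \<mu>' where "\<mu>' = \<nu>(?b := \<mu>)"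
    have Jv: "J v = sc (\<i> * of_int \<mu>) v" "v \<in> Z" using v by (auto simp: Z'_def)
    have wt: "X (2 * b - 1) (2 * b) v = sc (\<i> * of_int (\<mu>' b)) v" if "c < 2 * b" "2 * b \<le> n" for b
    proof (cases "b = ?b")
      case True
      then have "X (2 * b - 1) (2 * b) = J" using b by (simp only: J_def)
      then show ?thesis using Jv True by (simp add: \<mu>'_def)
    next
      case False
      then have "q < 2 * b" using that a by (simp add: q_def)
      then show ?thesis using \<nu> that False by (simp add: \<mu>'_def)
    qed
    \<comment> \<open>The raising operators for the weight of \<open>J\<close> annihilate \<open>v\<close>, because \<open>\<mu>\<close> is maximal.\<close>
    have pair: "X p l (X p l v) + X q l (X q l v) = sc (- of_int \<mu>) v" if l: "l \<in> {q<..n}" for l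
    proof -
      have l': "l \<in> {1..n}" "l \<in> {c<..n}" "l \<noteq> p" "l \<noteq> q" using l by (auto simp: p_def q_def)
      note lX = lin_X[OF pq(1) l'(1)] lin_X[OF pq(2) l'(1)]
      define E where "E = X p l v + sc \<i> (X q l v)"
      have 1: "J (X p l v) = X p l (J v) - X q l v"
        using X_commutator[OF pq(1,2) pq(1) l'(1), of v] pq(5) l' by (simp add: J_def algebra_simps)
      have 2: "J (X q l v) = X q l (J v) + X p l v"
        using X_commutator[OF pq(1,2) pq(2) l'(1), of v] pq(5) l' by (simp add: J_def algebra_simps)
      have "J E = sc (\<i> * of_int (\<mu> + 1)) E"
        by (simp add: E_def lin_add[OF J] lin_scale[OF J] 1 2 Jv lin_scale[OF lX(1)] lin_scale[OF lX(2)]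
             scale_right_distrib algebra_simps scale_left_distrib)
      moreover have "E \<in> Z" unfolding E_def
        using Z(1,3) pq l' Jv by (intro subspace_add subspace_scale) auto
      ultimately have E0: "E = 0" using inM \<mu>1 by blast
      have 3: "X p l (X q l v) - X q l (X p l v) = - J v"
        using X_commutator[OF pq(1) l'(1) pq(2) l'(1), of v] pq(5) l' X_skew[OF pq(2,1), of v]
        by (simp add: J_def)
      have "0 = X p l E - sc \<i> (X q l E)"
        using E0 by (simp add: lin_zero[OF lX(1)] lin_zero[OF lX(2)])
      also have "\<dots> = X p l (X p l v) + X q l (X q l v) + sc \<i> (X p l (X q l v) - X q l (X p l v))"
        by (simp add: E_def lin_add[OF lX(1)] lin_add[OF lX(2)] lin_scale[OF lX(1)] lin_scale[OF lX(2)]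
            algebra_simps)
      finally have "X p l (X p l v) + X q l (X q l v) = sc \<i> (J v)"
        unfolding 3 by (simp add: algebra_simps)
      then show ?thesis by (simp add: Jv)
    qed
    have lp: "X l p (X l p v) = X p l (X p l v)" "X l q (X l q v) = X q l (X q l v)" if l: "l \<in> {c<..n}" for l
    proof -
      have l': "l \<in> {1..n}" using l by auto
      show "X l p (X l p v) = X p l (X p l v)" "X l q (X l q v) = X q l (X q l v)"
        using X_skew[OF l' pq(1)] X_skew[OF l' pq(2)] lin_neg[OF lin_X[OF pq(1) l']] lin_neg[OF lin_X[OF pq(2) l']]
        by simp_all
    qed
    have X0: "X p p w = 0" "X q q w = 0" for w
      using X_skew[OF pq(1,1), of w] X_skew[OF pq(2,2), of w] eq_uminus_imp_zero by blast+
    have "(\<Sum>i\<in>{c<..n}. \<Sum>j\<in>{c<..n}. X i j (X i j v)) =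
        J (J v) + J (J v) + (\<Sum>l\<in>{q<..n}. X p l (X p l v) + X q l (X q l v))
        + (\<Sum>l\<in>{q<..n}. X l p (X l p v) + X l q (X l q v))
        + (\<Sum>i\<in>{q<..n}. \<Sum>j\<in>{q<..n}. X i j (X i j v))"
      unfolding pq(6) using pq(7,8) lp(1)[of q] pq(4)
      by (simp add: sum.distrib X0 J_def algebra_simps)
    also have "(\<Sum>l\<in>{q<..n}. X l p (X l p v) + X l q (X l q v)) =
        (\<Sum>l\<in>{q<..n}. X p l (X p l v) + X q l (X q l v))"
    proof (intro sum.cong refl)
      fix l assume "l \<in> {q<..n}"
      then have "l \<in> {c<..n}" by (auto simp: q_def)
      then show "X l p (X l p v) + X l q (X l q v) = X p l (X p l v) + X q l (X q l v)"
        by (simp only: lp)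
    qed
    also have "(\<Sum>l\<in>{q<..n}. X p l (X p l v) + X q l (X q l v)) = (\<Sum>l\<in>{q<..n}. sc (- of_int \<mu>) v)"
      by (intro sum.cong refl pair)
    also have "\<dots> = sc (of_int (- (int n - int q) * \<mu>)) v"
    proof -
      have "(of_nat (n - q) :: complex) * (- of_int \<mu>) = of_int (- (int n - int q) * \<mu>)"
        using 2 by (simp add: q_def of_nat_diff algebra_simps)
      then show ?thesis by (simp only: sum_constant_scale card_greaterThanAtMost scale_scale)
    qed
    also have "J (J v) = sc (of_int (- \<mu> * \<mu>)) v"
    proof -
      have "\<i> * of_int \<mu> * (\<i> * of_int \<mu>) = of_int (- \<mu> * \<mu>)"
        by (simp add: algebra_simps)
      then show ?thesis by (simp only: Jv lin_scale[OF J] scale_scale)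
    qed
    also note cas
    finally have sum: "(\<Sum>i\<in>{c<..n}. \<Sum>j\<in>{c<..n}. X i j (X i j v)) =
       sc (of_int ((- \<mu> * \<mu>) + (- \<mu> * \<mu>) + (- (int n - int q) * \<mu>) + (- (int n - int q) * \<mu>) +
         (- 2 * (\<Sum>b | q < 2 * b \<and> 2 * b \<le> n. \<nu> b * (\<nu> b + int n - 2 * int b))))) v"
      by (simp only: scale_left_distrib of_int_add)
    have set: "{b. c < 2 * b \<and> 2 * b \<le> n} = insert ?b {b. q < 2 * b \<and> 2 * b \<le> n}"
      using b a by (auto simp: q_def)
    have fin: "finite {b. q < 2 * b \<and> 2 * b \<le> n}"
      by (rule finite_subset[of _ "{..n}"]) auto
    have q': "int q = 2 * int ?b" using b by simp
    have "(\<Sum>b | c < 2 * b \<and> 2 * b \<le> n. \<mu>' b * (\<mu>' b + int n - 2 * int b)) =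
      \<mu> * (\<mu> + int n - int q) + (\<Sum>b | q < 2 * b \<and> 2 * b \<le> n. \<mu>' b * (\<mu>' b + int n - 2 * int b))"
      unfolding set using fin b q' by (subst sum.insert) (auto simp: \<mu>'_def)
    also have "(\<Sum>b | q < 2 * b \<and> 2 * b \<le> n. \<mu>' b * (\<mu>' b + int n - 2 * int b)) =
       (\<Sum>b | q < 2 * b \<and> 2 * b \<le> n. \<nu> b * (\<nu> b + int n - 2 * int b))"
      using b by (intro sum.cong refl) (auto simp: \<mu>'_def)
    finally have "- 2 * (\<Sum>b | c < 2 * b \<and> 2 * b \<le> n. \<mu>' b * (\<mu>' b + int n - 2 * int b)) =
      (- \<mu> * \<mu>) + (- \<mu> * \<mu>) + (- (int n - int q) * \<mu>) + (- (int n - int q) * \<mu>) +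
         (- 2 * (\<Sum>b | q < 2 * b \<and> 2 * b \<le> n. \<nu> b * (\<nu> b + int n - 2 * int b)))"
      by (simp add: algebra_simps)
    then have "(\<Sum>i\<in>{c<..n}. \<Sum>j\<in>{c<..n}. X i j (X i j v)) =
       sc (of_int (- 2 * (\<Sum>b | c < 2 * b \<and> 2 * b \<le> n. \<mu>' b * (\<mu>' b + int n - 2 * int b)))) v"
      unfolding sum by (simp only:)
    then show ?thesis using wt v Jv(2) by (intro exI[of _ v] exI[of _ \<mu>']) auto
  qed
qed

end

section \<open>Consequences of the Jacobi identity\<close>

lemma Sum_any_only_zero: "(\<And>j. j \<noteq> 0 \<Longrightarrow> f j = 0) \<Longrightarrow> Sum_any f = f (0::nat)"
  by (subst Sum_any.expand_superset[of "{0}"]) auto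

context vertex_superalgebra
begin

sublocale complex_vector_space sc
  by unfold_locales

lemma lin_Y_left: "lin (\<lambda>a. Y a p b)" and lin_Y: "lin (Y a p)"
  using linear_left linear_right by auto

lemmas Y_left_simps = lin_add[OF lin_Y_left] lin_scale[OF lin_Y_left] lin_zero[OF lin_Y_left]
  lin_neg[OF lin_Y_left] lin_diff[OF lin_Y_left] lin_sum[OF lin_Y_left]

lemmas Y_simps = lin_add[OF lin_Y] lin_scale[OF lin_Y] lin_zero[OF lin_Y]
  lin_neg[OF lin_Y] lin_diff[OF lin_Y] lin_sum[OF lin_Y]

lemma Sum_any_in_subspace:
  assumes "subspace U" "\<And>j. f j \<in> U"
  shows "Sum_any f \<in> U"
  unfolding Sum_any.expand_set using assms by (intro subspace_sum)

lemma Sum_any_diff_first_in_subspace: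
  assumes U: "subspace U" "\<And>j. j \<noteq> 0 \<Longrightarrow> f j \<in> U" and f: "finite {j::nat. f j \<noteq> 0}"
  shows "Sum_any f - f 0 \<in> U"
proof -
  have fin: "finite (insert 0 {j. f j \<noteq> 0})" using f by simp
  have "Sum_any f = sum f (insert 0 {j. f j \<noteq> 0})"
    by (rule Sum_any.expand_superset[OF fin]) auto
  also have "\<dots> = f 0 + sum f (insert 0 {j. f j \<noteq> 0} - {0})"
    by (rule sum.remove[OF fin]) simp
  finally have "Sum_any f - f 0 = sum f (insert 0 {j. f j \<noteq> 0} - {0})" by simp
  then show ?thesis using U by (auto intro: subspace_sum)
qed

text \<open>The sign for exchanging \<open>a\<close> and \<open>b\<close>.\<close>
definition koszul :: "'a \<Rightarrow> 'a \<Rightarrow> complex"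
  where "koszul a b = (if a \<in> V1 \<and> b \<in> V1 then -1 else 1)"

lemma commutator_formula:
  assumes "a \<in> V0 \<union> V1" "b \<in> V0 \<union> V1"
  shows "Y a p (Y b r c) - sc (koszul a b) (Y b r (Y a p c)) =
    Sum_any (\<lambda>j. sc (of_int p gchoose j) (Y (Y a (int j) b) (p + r - int j) c))"
proof -
  have "Sum_any (\<lambda>j::nat. sc (of_int p gchoose j) (Y (Y a (int j) b) (p + r - int j) c)) =
     Sum_any (\<lambda>j::nat. sc ((-1) ^ j * (0 gchoose j))
        (Y a (p - int j) (Y b (r + int j) c) - sc (koszul a b) (Y b (r - int j) (Y a (p + int j) c))))"
    using jacobi[OF assms, of p 0 r c] by (simp add: koszul_def)
  also have "\<dots> = sc ((-1) ^ 0 * (0 gchoose 0))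
        (Y a (p - int 0) (Y b (r + int 0) c) - sc (koszul a b) (Y b (r - int 0) (Y a (p + int 0) c)))"
    by (rule Sum_any_only_zero) (simp add: gbinomial_0_left)
  finally show ?thesis by simp
qed

lemma commutator_two_terms:
  assumes "a \<in> V0 \<union> V1" "b \<in> V0 \<union> V1" and z: "\<And>s. s \<ge> 2 \<Longrightarrow> Y a s b = 0"
  shows "Y a p (Y b r c) - sc (koszul a b) (Y b r (Y a p c)) =
    Y (Y a 0 b) (p + r) c + sc (of_int p) (Y (Y a 1 b) (p + r - 1) c)"
proof -
  have "Sum_any (\<lambda>j. sc (of_int p gchoose j) (Y (Y a (int j) b) (p + r - int j) c)) =
    (\<Sum>j\<in>{0,1}. sc (of_int p gchoose j) (Y (Y a (int j) b) (p + r - int j) c))"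
  proof (rule Sum_any.expand_superset)
    show "{j. sc (of_int p gchoose j) (Y (Y a (int j) b) (p + r - int j) c) \<noteq> 0} \<subseteq> {0, 1}"
    proof (intro subsetI)
      fix j assume j: "j \<in> {j. sc (of_int p gchoose j) (Y (Y a (int j) b) (p + r - int j) c) \<noteq> 0}"
      show "j \<in> {0, 1}"
      proof (rule ccontr)
        assume "j \<notin> {0, 1}"
        then have "Y a (int j) b = 0" by (intro z) auto
        then show False using j by (simp add: Y_left_simps)
      qed
    qed
  qed simp
  then show ?thesis by (simp add: commutator_formula[OF assms(1,2)])
qed

lemma commute_if_products_vanish:
  assumes "a \<in> V0 \<union> V1" "b \<in> V0 \<union> V1" "\<And>s. s \<ge> 0 \<Longrightarrow> Y a s b = 0"
  shows "Y a p (Y b r c) = sc (koszul a b) (Y b r (Y a p c))"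
  using commutator_two_terms[of a b p r c] assms by (simp add: Y_left_simps)

lemma zero_mode_commutator:
  assumes "a \<in> V0 \<union> V1" "b \<in> V0 \<union> V1"
  shows "Y a 0 (Y b r c) - sc (koszul a b) (Y b r (Y a 0 c)) = Y (Y a 0 b) r c"
proof -
  have "Sum_any (\<lambda>j. sc (of_int 0 gchoose j) (Y (Y a (int j) b) (0 + r - int j) c)) =
     sc (of_int 0 gchoose 0) (Y (Y a (int 0) b) (0 + r - int 0) c)"
    by (rule Sum_any_only_zero) (simp add: gbinomial_0_left)
  then show ?thesis using commutator_formula[OF assms, of 0 r c] by simp
qed

lemma associator_formula:
  assumes "a \<in> V0 \<union> V1" "b \<in> V0 \<union> V1"
  shows "Y (Y a q b) r c = Sum_any (\<lambda>j::nat. sc ((-1) ^ j * (of_int q gchoose j))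
        (Y a (q - int j) (Y b (r + int j) c)
          - sc (koszul a b * (-1) powi q) (Y b (q + r - int j) (Y a (int j) c))))"
proof -
  have "Sum_any (\<lambda>j. sc (of_int 0 gchoose j) (Y (Y a (q + int j) b) (0 + r - int j) c)) =
     sc (of_int 0 gchoose 0) (Y (Y a (q + int 0) b) (0 + r - int 0) c)"
    by (rule Sum_any_only_zero) (simp add: gbinomial_0_left)
  then show ?thesis using jacobi[OF assms, of 0 q r c] by (simp add: koszul_def)
qed

lemma gchoose_minus_one: "(- 1 :: complex) gchoose j = (- 1) ^ j"
proof -
  have "(- 1 :: complex) gchoose j = (-1) ^ j * (of_nat j gchoose j)"
    using gbinomial_minus[of "1::complex" j] by simp
  also have "(of_nat j :: complex) gchoose j = 1"
    by (metis binomial_gbinomial binomial_n_n of_nat_1)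
  finally show ?thesis by simp
qed

lemma normal_ordered_product:
  assumes "a \<in> V0 \<union> V1" "b \<in> V0 \<union> V1"
  shows "Y (Y a (-1) b) r c = Sum_any (\<lambda>j::nat.
        Y a (- 1 - int j) (Y b (r + int j) c) + sc (koszul a b) (Y b (r - 1 - int j) (Y a (int j) c)))"
proof -
  have "(- 1 :: complex) ^ j * (- 1) ^ j = 1" for j :: nat
    by (simp flip: power_mult_distrib)
  then show ?thesis unfolding associator_formula[OF assms]
    by (intro Sum_any.cong) (simp add: gchoose_minus_one algebra_simps)
qed

lemma finite_product_support: "finite {j::nat. Y a (p - int j) (Y b (r + int j) c) \<noteq> 0}"
proof -
  obtain N where N: "\<And>n. n \<ge> N \<Longrightarrow> Y b n c = 0" using truncation[of b c] by auto
  have "{j. Y a (p - int j) (Y b (r + int j) c) \<noteq> 0} \<subseteq> {..nat (N - r)}"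
  proof
    fix j assume "j \<in> {j. Y a (p - int j) (Y b (r + int j) c) \<noteq> 0}"
    then have "Y b (r + int j) c \<noteq> 0" by (auto simp: Y_simps)
    then have "\<not> r + int j \<ge> N" using N by blast
    then show "j \<in> {..nat (N - r)}" by auto
  qed
  then show ?thesis by (rule finite_subset) simp
qed

text \<open>For large \<open>P\<close> the terms of the Jacobi identity at \<open>(P, s - P, t)\<close> in which \<open>a\<close> acts first
  disappear. What remains expresses \<open>a\<^sub>s b\<^sub>t c\<close> through the products \<open>(a\<^sub>i b)\<^sub>j c\<close> and through
  \<open>a\<^sub>s\<^sub>' b\<^sub>t\<^sub>' c\<close> with \<open>t' > t\<close>, which vanish for large \<open>t'\<close>.\<close>

lemma iterated_product_in_subspace:
  assumes ab: "a \<in> V0 \<union> V1" "b \<in> V0 \<union> V1" and U: "subspace U"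
    and mem: "\<And>i j. Y (Y a i b) j c \<in> U"
  shows "Y a s (Y b t c) \<in> U"
proof -
  obtain P where P: "\<And>n. n \<ge> P \<Longrightarrow> Y a n c = 0" using truncation[of a c] by auto
  obtain M where M: "\<And>n. n \<ge> M \<Longrightarrow> Y b n c = 0" using truncation[of b c] by auto
  show ?thesis
  proof (induction "nat (M - t)" arbitrary: s t rule: less_induct)
    case less
    show ?case
    proof (cases "t \<ge> M")
      case True
      then show ?thesis using M U by (simp add: Y_simps subspace_0)
    next
      case False
      define f where "f j = sc ((-1) ^ j * (of_int (s - P) gchoose j)) (Y a (s - int j) (Y b (t + int j) c))"
        for j :: nat
      have "Sum_any (\<lambda>j::nat. sc (of_int P gchoose j) (Y (Y a ((s - P) + int j) b) (P + t - int j) c)) =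
        Sum_any (\<lambda>j. sc ((-1) ^ j * (of_int (s - P) gchoose j))
          (Y a (P + (s - P) - int j) (Y b (t + int j) c)
          - sc ((if a \<in> V1 \<and> b \<in> V1 then -1 else 1) * (-1) powi (s - P))
              (Y b ((s - P) + t - int j) (Y a (P + int j) c))))"
        by (rule jacobi[OF ab])
      also have "\<dots> = Sum_any f"
        by (intro Sum_any.cong) (simp add: P f_def Y_simps)
      finally have "Sum_any f \<in> U"
        using Sum_any_in_subspace[OF U] mem U by (metis (no_types, lifting) subspace_scale)
      moreover have "Sum_any f - f 0 \<in> U"
      proof (rule Sum_any_diff_first_in_subspace[OF U])
        show "f j \<in> U" if "j \<noteq> 0" for j
          unfolding f_def using False that
          by (intro subspace_scale[OF U] less) auto
        show "finite {j. f j \<noteq> 0}"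
          by (rule finite_subset[OF _ finite_product_support[of a s b t c]]) (auto simp: f_def)
      qed
      ultimately have "f 0 \<in> U" using subspace_diff[OF U] by fastforce
      then show ?thesis by (simp add: f_def)
    qed
  qed
qed

text \<open>The state \<open>a\<^sub>-\<^sub>2 \<one>\<close> is the translate of \<open>a\<close>, so its field is the derivative of that of \<open>a\<close>.\<close>

lemma translated_state:
  assumes "a \<in> V0 \<union> V1"
  shows "Y (Y a (-2) vac) r c = sc (- of_int r) (Y a (r - 1) c)"
proof -
  have "(- 1 :: complex) ^ j * (- 2 gchoose j) = of_nat (j + 1)" for j :: nat
  proof -
    have "(- 2 :: complex) gchoose j = (-1) ^ j * (of_nat (Suc j) gchoose j)"
      using gbinomial_minus[of "2::complex" j] by (simp add: algebra_simps)
    also have "(of_nat (Suc j) :: complex) gchoose j = of_nat (Suc j)"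
      by (metis binomial_gbinomial binomial_Suc_n)
    finally show ?thesis by (simp flip: power_mult_distrib mult.assoc)
  qed
  note coeff = this
  define f where "f j = sc (of_nat (j + 1)) (Y a (- 2 - int j) (Y vac (r + int j) c)
          - Y vac (r - 2 - int j) (Y a (int j) c))" for j :: nat
  show ?thesis
  proof (cases "vac = 0")
    case True
    \<comment> \<open>The zero algebra is the only case in which the vacuum is odd.\<close>
    have "x = 0" for x :: 'a
      using vacuum[of "-1" x] True by (simp add: Y_left_simps)
    then show ?thesis by metis
  next
    case False
    then have "koszul a vac = 1" using vac_even V0_Int_V1 by (auto simp: koszul_def)
    then have eq: "Y (Y a (-2) vac) r c = Sum_any f"
      using associator_formula[OF assms, of vac "-2" r c] vac_even
      by (simp add: f_def coeff power_int_def)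
    show ?thesis
    proof (cases "r = 0")
      case True
      then have "f = (\<lambda>_. 0)" by (auto simp: f_def vacuum Y_simps)
      then show ?thesis using eq True by simp
    next
      case False
      define j0 where "j0 = nat (if r < 0 then - 1 - r else r - 1)"
      have "Sum_any f = sum f {j0}"
        using False by (intro Sum_any.expand_superset)
          (auto simp: f_def j0_def vacuum Y_simps split: if_splits)
      also have "\<dots> = sc (- of_int r) (Y a (r - 1) c)"
        using False by (auto simp: f_def j0_def vacuum Y_simps algebra_simps)
      finally show ?thesis using eq by simp
    qed
  qed
qed

text \<open>If \<open>v\<close> commutes with \<open>a\<close> and \<open>b\<close>, the associator formula for \<open>(a\<^sub>q b)\<^sub>r v\<close>
  with \<open>r \<ge> 0\<close> has no nonzero term.\<close>

lemma product_annihilates: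
  assumes "a \<in> V0 \<union> V1" "b \<in> V0 \<union> V1" "r \<ge> 0"
    "\<And>p. p \<ge> 0 \<Longrightarrow> Y a p v = 0" "\<And>p. p \<ge> 0 \<Longrightarrow> Y b p v = 0"
  shows "Y (Y a q b) r v = 0"
  using associator_formula[OF assms(1,2), of q r v] assms(3-5) by (simp add: Y_simps)

lemma annihilates_product:
  assumes "a \<in> V0 \<union> V1" "b \<in> V0 \<union> V1" "p \<ge> 0"
    "\<And>p. p \<ge> 0 \<Longrightarrow> Y a p b = 0" "\<And>p. p \<ge> 0 \<Longrightarrow> Y a p v = 0"
  shows "Y a p (Y b q v) = 0"
  using commute_if_products_vanish[OF assms(1,2), of p q v] assms(3-5) by (simp add: Y_simps)

lemma vertex_subalgebra_left_annihilators:
  "vertex_subalgebra sc vac Y {u \<in> V0. \<forall>p\<ge>0. Y u p v = 0}"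
proof -
  have "subspace {u \<in> V0. \<forall>p\<ge>0. Y u p v = 0}"
    using subspace_V0 by (auto simp: subspace_def Y_left_simps)
  then show ?thesis
    by (auto simp: vertex_subalgebra_def vac_even vacuum even_even intro!: product_annihilates)
qed

lemma vertex_subalgebra_right_annihilators:
  assumes "A \<subseteq> V0 \<union> V1"
  shows "vertex_subalgebra sc vac Y {v \<in> V0. \<forall>u\<in>A. \<forall>p\<ge>0. Y u p v = 0}"
proof -
  have "subspace {v \<in> V0. \<forall>u\<in>A. \<forall>p\<ge>0. Y u p v = 0}"
    using subspace_V0 by (auto simp: subspace_def Y_simps)
  moreover have "Y u p (Y a q b) = 0" if "u \<in> A" "a \<in> V0" "p \<ge> 0"
    "\<And>u p. u \<in> A \<Longrightarrow> p \<ge> 0 \<Longrightarrow> Y u p a = 0" "\<And>u p. u \<in> A \<Longrightarrow> p \<ge> 0 \<Longrightarrow> Y u p b = 0" for u p a q b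
    using that assms by (intro annihilates_product) auto
  ultimately show ?thesis
    by (auto simp: vertex_subalgebra_def vac_even creation even_even)
qed

lemma vertex_subalgebra_V0: "vertex_subalgebra sc vac Y V0"
  by (simp add: vertex_subalgebra_def subspace_V0 vac_even even_even)

lemma
  shows vertex_subalgebra_generated: "vertex_subalgebra sc vac Y (generated_subalgebra sc vac Y S)"
    and generators_in_generated: "S \<subseteq> generated_subalgebra sc vac Y S"
  by (auto simp: generated_subalgebra_def vertex_subalgebra_def intro!: subspace_Inter)

lemma generated_subalgebra_least:
  "vertex_subalgebra sc vac Y U \<Longrightarrow> S \<subseteq> U \<Longrightarrow> generated_subalgebra sc vac Y S \<subseteq> U"
  by (auto simp: generated_subalgebra_def)

lemma vertex_subalgebraD:
  assumes "vertex_subalgebra sc vac Y U"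
  shows "subspace U" "vac \<in> U" "u \<in> U \<Longrightarrow> v \<in> U \<Longrightarrow> Y u p v \<in> U"
  using assms by (auto simp: vertex_subalgebra_def)

end

section \<open>Free fermions and their quadratic states\<close>

context vertex_superalgebra
begin

text \<open>A vector that is both even and odd is zero, so that the value of the sign does not matter.\<close>

lemma koszul_even_right: "b \<in> V0 \<Longrightarrow> sc (koszul a b) (Y b r x) = Y b r x"
  using V0_Int_V1 by (cases "b = 0") (auto simp: koszul_def Y_left_simps)

lemma koszul_even_left: "a \<in> V0 \<Longrightarrow> sc (koszul a b) (Y b r (Y a p x)) = Y b r (Y a p x)"
  using V0_Int_V1 by (cases "a = 0") (auto simp: koszul_def Y_left_simps Y_simps)

end

context fermion_vertex_superalgebra
begin

definition fer :: "nat \<times> nat \<Rightarrow> int \<Rightarrow> 'a \<Rightarrow> 'a"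
  where "fer a = psi (fst a) (snd a)"

definition Lab :: "(nat \<times> nat) set"
  where "Lab = {1..K} \<times> {1..n}"

abbreviation fermion :: "nat \<times> nat \<Rightarrow> 'a"
  where "fermion a \<equiv> fer a (-1) vac"

abbreviation pair :: "nat \<times> nat \<Rightarrow> nat \<times> nat \<Rightarrow> 'a"
  where "pair a b \<equiv> fer a (-1) (fermion b)"

text \<open>Twice the conformal vector of the fermion \<open>a\<close>.\<close>
abbreviation conf :: "nat \<times> nat \<Rightarrow> 'a"
  where "conf a \<equiv> fer a (-2) (fermion a)"

lemma finite_Lab [simp]: "finite Lab"
  by (simp add: Lab_def)

lemma lin_fer: "a \<in> Lab \<Longrightarrow> lin (fer a p)"
  by (auto simp: fer_def Lab_def intro!: linear_psi)

lemmas fer_simps = lin_add[OF lin_fer] lin_scale[OF lin_fer] lin_zero[OF lin_fer]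
  lin_neg[OF lin_fer] lin_diff[OF lin_fer] lin_sum[OF lin_fer]

lemma fer_anticommute:
  assumes "a \<in> Lab" "b \<in> Lab"
  shows "fer a p (fer b q v) = (if a = b \<and> p + q = -1 then v else 0) - fer b q (fer a p v)"
  using clifford[of "fst a" "snd a" "fst b" "snd b" p q v] assms
  by (auto simp: fer_def Lab_def prod_eq_iff algebra_simps)

lemma fer_square: "a \<in> Lab \<Longrightarrow> p \<noteq> -1 - p \<Longrightarrow> fer a p (fer a p v) = 0"
  using fer_anticommute[of a a p p v] eq_uminus_imp_zero by auto

lemma fer_creation_anticommute:
  "a \<in> Lab \<Longrightarrow> b \<in> Lab \<Longrightarrow> p < 0 \<Longrightarrow> q < 0 \<Longrightarrow> fer a p (fer b q v) = - fer b q (fer a p v)"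
  by (subst fer_anticommute) auto

lemma fer_vac: "a \<in> Lab \<Longrightarrow> p \<ge> 0 \<Longrightarrow> fer a p vac = 0"
  by (auto simp: fer_def Lab_def psi_vac)

lemma Y_fermion: "a \<in> Lab \<Longrightarrow> Y (fermion a) p v = fer a p v"
  by (auto simp: fer_def Lab_def generator_field)

lemma fermion_odd: "a \<in> Lab \<Longrightarrow> fermion a \<in> V1"
  by (auto simp: fer_def Lab_def generator_odd)

lemma fer_V0: "a \<in> Lab \<Longrightarrow> v \<in> V0 \<Longrightarrow> fer a p v \<in> V1"
  and fer_V1: "a \<in> Lab \<Longrightarrow> v \<in> V1 \<Longrightarrow> fer a p v \<in> V0"
  using odd_even[OF fermion_odd, of a v p] odd_odd[OF fermion_odd, of a v p] by (auto simp: Y_fermion)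

lemma pair_even: "a \<in> Lab \<Longrightarrow> b \<in> Lab \<Longrightarrow> fer a p (fer b q vac) \<in> V0"
  by (intro fer_V1 fer_V0 vac_even)

lemma pair_swap: "a \<in> Lab \<Longrightarrow> b \<in> Lab \<Longrightarrow> pair a b = - pair b a"
  by (rule fer_creation_anticommute) simp_all

lemma fer_fermion: "a \<in> Lab \<Longrightarrow> b \<in> Lab \<Longrightarrow> p \<ge> 0 \<Longrightarrow>
    fer a p (fermion b) = (if a = b \<and> p = 0 then vac else 0)"
  by (subst fer_anticommute) (auto simp: fer_vac fer_simps)

lemma fer_pair_nonneg:
  assumes "d \<in> Lab" "a \<in> Lab" "b \<in> Lab" "s \<ge> 0"
  shows "fer d s (pair a b) = (if s = 0 then (if d = a then fermion b else 0)
    - (if d = b then fermion a else 0) else 0)"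
  using assms by (subst fer_anticommute) (auto simp: fer_fermion fer_simps)

lemma fer_conf_nonneg:
  assumes "d \<in> Lab" "a \<in> Lab" "s \<ge> 0"
  shows "fer d s (conf a) = (if d = a then (if s = 0 then - fer a (-2) vac
    else if s = 1 then fermion a else 0) else 0)"
  using assms by (subst fer_anticommute) (auto simp: fer_fermion fer_simps)

text \<open>A fermion contracts with the states \<open>pair a b\<close> and \<open>conf a\<close> only in its modes \<open>0\<close> and \<open>1\<close>, which
  leaves two terms of the commutator formula.\<close>

lemma fer_commute_pair:
  assumes "d \<in> Lab" "a \<in> Lab" "b \<in> Lab"
  shows "fer d p (Y (pair a b) r c) = Y (pair a b) r (fer d p c)
    + (if d = a then fer b (p + r) c else 0) - (if d = b then fer a (p + r) c else 0)"
proof -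
  have "Y (fermion d) p (Y (pair a b) r c) - sc (koszul (fermion d) (pair a b)) (Y (pair a b) r (Y (fermion d) p c)) =
    Y (Y (fermion d) 0 (pair a b)) (p + r) c + sc (of_int p) (Y (Y (fermion d) 1 (pair a b)) (p + r - 1) c)"
    by (rule commutator_two_terms)
      (use assms fermion_odd pair_even in \<open>auto simp: Y_fermion fer_pair_nonneg\<close>)
  then show ?thesis using assms
    by (cases "d = a"; cases "d = b")
      (simp_all add: Y_fermion koszul_even_right pair_even fer_pair_nonneg Y_left_simps algebra_simps)
qed

lemma fer_commute_conf:
  assumes "d \<in> Lab" "a \<in> Lab"
  shows "fer d p (Y (conf a) r c) = Y (conf a) r (fer d p c)
    + (if d = a then sc (of_int (2 * p + r)) (fer a (p + r - 1) c) else 0)"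
proof -
  have "Y (fermion d) p (Y (conf a) r c) - sc (koszul (fermion d) (conf a)) (Y (conf a) r (Y (fermion d) p c)) =
    Y (Y (fermion d) 0 (conf a)) (p + r) c + sc (of_int p) (Y (Y (fermion d) 1 (conf a)) (p + r - 1) c)"
    by (rule commutator_two_terms)
      (use assms fermion_odd pair_even in \<open>auto simp: Y_fermion fer_conf_nonneg\<close>)
  moreover have "Y (fer a (-2) vac) (p + r) c = sc (- of_int (p + r)) (fer a (p + r - 1) c)"
    using translated_state[of "fermion a" "p + r" c] assms(2) fermion_odd by (simp add: Y_fermion)
  moreover have "sc (of_int (p + r)) x + sc (of_int p) x = sc (of_int (2 * p + r)) x" for x :: 'a
    by (simp flip: scale_left_distrib)
  ultimately show ?thesis using assms
    by (simp add: Y_fermion koszul_even_right pair_even fer_conf_nonneg Y_left_simps algebra_simps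
        del: of_int_add of_int_mult)
qed

lemma pair_mode_fer:
  assumes "d \<in> Lab" "a \<in> Lab" "b \<in> Lab"
  shows "Y (pair a b) r (fer d p c) = fer d p (Y (pair a b) r c)
    - (if d = a then fer b (p + r) c else 0) + (if d = b then fer a (p + r) c else 0)"
  using fer_commute_pair[OF assms, of p r c] by (auto split: if_splits)

lemma conf_mode_fer:
  assumes "d \<in> Lab" "a \<in> Lab"
  shows "Y (conf a) r (fer d p c) = fer d p (Y (conf a) r c)
    - (if d = a then sc (of_int (2 * p + r)) (fer a (p + r - 1) c) else 0)"
  using fer_commute_conf[OF assms, of p r c] by (auto split: if_splits)

lemma conf_flip: "a \<in> Lab \<Longrightarrow> fer a (-1) (fer a (-2) vac) = - conf a"
  by (subst fer_anticommute) simp_all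

subsection \<open>Words in the creation operators\<close>

text \<open>The letter \<open>(a, s)\<close> is the creation operator of mode \<open>- s - 1/2\<close>. The family \<open>f\<close> is either \<open>fer\<close>
  or a basis of fermions adapted to the Cartan subalgebra of \<open>so\<^sub>n\<close>.\<close>
definition word :: "(nat \<times> nat \<Rightarrow> int \<Rightarrow> 'a \<Rightarrow> 'a) \<Rightarrow> ((nat \<times> nat) \<times> nat) list \<Rightarrow> 'a"
  where "word f xs = foldr (\<lambda>(a, s). f a (- 1 - int s)) xs vac"

definition letters :: "((nat \<times> nat) \<times> nat) list set"
  where "letters = lists (Lab \<times> UNIV)"

lemma word_simps [simp]:
  "word f [] = vac" "word f ((a, s) # xs) = f a (- 1 - int s) (word f xs)"
  by (simp_all add: word_def)

lemma letters_simps [simp]: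
  "[] \<in> letters" "(a, s) # xs \<in> letters \<longleftrightarrow> a \<in> Lab \<and> xs \<in> letters"
  "xs @ ys \<in> letters \<longleftrightarrow> xs \<in> letters \<and> ys \<in> letters"
  by (auto simp: letters_def)

text \<open>The span of the words is invariant under the Clifford algebra: creation operators extend a
  word, annihilation operators are moved to the right by the canonical relations. By irreducibility
  the span is the whole module.\<close>

lemma words_span:
  assumes f: "\<And>a p. a \<in> Lab \<Longrightarrow> lin (f a p)"
    and expr: "\<And>a p v. a \<in> Lab \<Longrightarrow> fer a p v \<in> span {f b p v |b. b \<in> Lab}"
    and rel: "\<And>a b p q v. a \<in> Lab \<Longrightarrow> b \<in> Lab \<Longrightarrow>
      \<exists>c. fer a p (f b q v) + f b q (fer a p v) = sc c v"
  shows "v \<in> span (word f ` letters)"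
proof -
  define S where "S = span (word f ` letters)"
  have S: "subspace S" by (simp add: S_def)
  have ext: "f b (- 1 - int s) w \<in> S" if "b \<in> Lab" "w \<in> S" for b s w
  proof (rule lin_span_into[OF f[OF that(1)] S _ that(2)[unfolded S_def]])
    fix x assume "x \<in> word f ` letters"
    then obtain xs where "xs \<in> letters" "x = word f xs" by auto
    then have "f b (- 1 - int s) x = word f ((b, s) # xs)" "(b, s) # xs \<in> letters"
      using that by auto
    then show "f b (- 1 - int s) x \<in> S" unfolding S_def by (metis image_eqI span_base)
  qed
  have ext': "f b p w \<in> S" if "b \<in> Lab" "w \<in> S" "p < 0" for b p w
    using ext[of b w "nat (- 1 - p)"] that by simp
  have "fer a p w \<in> S" if a: "a \<in> Lab" and w: "w \<in> S" for a p w
  proof (cases "p < 0")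
    case True
    have "span {f b p w |b. b \<in> Lab} \<subseteq> S"
      by (rule span_minimal[OF _ S]) (use ext' w True in auto)
    then show ?thesis using expr[OF a] by auto
  next
    case False
    show ?thesis
    proof (rule lin_span_into[OF lin_fer[OF a] S _ w[unfolded S_def]])
      fix x assume "x \<in> word f ` letters"
      then obtain xs where "xs \<in> letters" "x = word f xs" by auto
      then show "fer a p x \<in> S"
      proof (induction xs arbitrary: x)
        case Nil
        then show ?case using a False fer_vac S subspace_0 by simp
      next
        case (Cons bs xs)
        obtain b s where bs: "bs = (b, s)" by (cases bs)
        have b: "b \<in> Lab" "xs \<in> letters" using Cons.prems bs by auto
        obtain c where c: "fer a p (f b (- 1 - int s) (word f xs))
            + f b (- 1 - int s) (fer a p (word f xs)) = sc c (word f xs)"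
          using rel[OF a b(1)] by blast
        have "f b (- 1 - int s) (fer a p (word f xs)) \<in> S"
          using ext b Cons.IH by auto
        moreover have "sc c (word f xs) \<in> S"
          unfolding S_def using b by (intro span_scale span_base) auto
        moreover have "fer a p x = sc c (word f xs) - f b (- 1 - int s) (fer a p (word f xs))"
          using c bs Cons.prems by (simp add: algebra_simps)
        ultimately show ?case using subspace_diff[OF S] by simp
      qed
    qed
  qed
  then have "S = {0} \<or> S = UNIV"
    by (intro irreducible[OF S]) (auto simp: fer_def Lab_def)
  moreover have "vac \<in> S" unfolding S_def by (rule span_base) (force intro: image_eqI[of _ _ "[]"])
  ultimately show ?thesis using vac_nonzero by (auto simp: S_def)
qed

text \<open>Even words lie in \<open>V0\<close> and odd words in \<open>V1\<close>. The odd part of an even vector is both even and odd,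
  hence zero.\<close>

lemma even_words_span:
  assumes span: "\<And>v. v \<in> span (word f ` letters)"
    and f: "\<And>a p v. a \<in> Lab \<Longrightarrow> v \<in> V0 \<Longrightarrow> f a p v \<in> V1"
      "\<And>a p v. a \<in> Lab \<Longrightarrow> v \<in> V1 \<Longrightarrow> f a p v \<in> V0"
    and v: "v \<in> V0"
  shows "v \<in> span (word f ` {xs \<in> letters. even (length xs)})"
proof -
  have par: "if even (length xs) then word f xs \<in> V0 else word f xs \<in> V1" if "xs \<in> letters" for xs
    using that by (induction xs) (use f vac_even in \<open>auto split: if_splits\<close>)
  let ?E = "word f ` {xs \<in> letters. even (length xs)}" and ?O = "word f ` {xs \<in> letters. odd (length xs)}"
  have "letters = {xs \<in> letters. even (length xs)} \<union> {xs \<in> letters. odd (length xs)}" by auto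
  then have "v \<in> span (?E \<union> ?O)" using span[of v] by (metis image_Un)
  then obtain x y where xy: "v = x + y" "x \<in> span ?E" "y \<in> span ?O" by (auto simp: span_Un)
  have "?E \<subseteq> V0" "?O \<subseteq> V1" using par by force+
  then have "span ?E \<subseteq> V0" "span ?O \<subseteq> V1"
    using span_minimal[OF _ subspace_V0] span_minimal[OF _ subspace_V1] by auto
  then have "x \<in> V0" "y \<in> V1" using xy by auto
  moreover have "y = v - x" using xy by simp
  ultimately have "y \<in> V0 \<inter> V1" using v subspace_V0 by (auto simp: subspace_diff)
  then show ?thesis using V0_Int_V1 xy by auto
qed

text \<open>Two equal letters can be brought together, and creation operators square to zero.\<close>

lemma nonzero_word_distinct:
  assumes f: "\<And>a p. a \<in> Lab \<Longrightarrow> lin (f a p)"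
    and anti: "\<And>a b p q v. a \<in> Lab \<Longrightarrow> b \<in> Lab \<Longrightarrow> p < 0 \<Longrightarrow> q < 0 \<Longrightarrow> f a p (f b q v) = - f b q (f a p v)"
    and xs: "xs \<in> letters" "word f xs \<noteq> 0"
  shows "distinct xs"
  using xs
proof (induction xs)
  case Nil
  then show ?case by simp
next
  case (Cons bs xs)
  obtain b s where bs: "bs = (b, s)" by (cases bs)
  have b: "b \<in> Lab" "xs \<in> letters" using Cons.prems bs by auto
  have "word f xs \<noteq> 0" using Cons.prems bs lin_zero[OF f[OF b(1)]] by auto
  moreover have "f b (- 1 - int s) (word f ys) = 0" if "(b, s) \<in> set ys" "ys \<in> letters" for ys
    using that
  proof (induction ys)
    case Nil
    then show ?case by simp
  next
    case (Cons ct ys)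
    obtain c t where ct: "ct = (c, t)" by (cases ct)
    have c: "c \<in> Lab" using Cons.prems ct by auto
    have eq: "f b (- 1 - int s) (word f (ct # ys)) = - f c (- 1 - int t) (f b (- 1 - int s) (word f ys))"
      using anti[OF b(1) c] ct by simp
    show ?case
    proof (cases "(b, s) = (c, t)")
      case True
      then show ?thesis using anti[OF b(1) b(1), of "- 1 - int s" "- 1 - int s" "word f ys"] ct eq_uminus_imp_zero by auto
    next
      case False
      then show ?thesis using eq Cons ct lin_zero[OF f[OF c]] by auto
    qed
  qed
  ultimately show ?case using Cons bs b by auto
qed

subsection \<open>The energy operator\<close>

text \<open>Twice the operator \<open>L\<^sub>0\<close>, so that its eigenvalues are integers.\<close>
definition energy_op :: "'a \<Rightarrow> 'a"
  where "energy_op v = (\<Sum>a\<in>Lab. Y (conf a) 1 v)"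

text \<open>Twice the conformal weight of a word, since a letter \<open>(a, s)\<close> has weight \<open>s + 1/2\<close>.\<close>
definition energy :: "((nat \<times> nat) \<times> nat) list \<Rightarrow> nat"
  where "energy xs = (\<Sum>(a, s)\<leftarrow>xs. 2 * s + 1)"

lemma energy_simps [simp]: "energy [] = 0" "energy ((a, s) # xs) = 2 * s + 1 + energy xs"
  by (simp_all add: energy_def)

lemma lin_energy_op: "lin energy_op"
  by (rule linI) (simp_all add: energy_op_def Y_simps sum.distrib scale_sum_right)

lemma energy_op_fer:
  assumes "d \<in> Lab"
  shows "energy_op (fer d p v) = fer d p (energy_op v) - sc (of_int (2 * p + 1)) (fer d p v)"
proof -
  have "fer d p (energy_op v) = (\<Sum>a\<in>Lab. fer d p (Y (conf a) 1 v))"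
    unfolding energy_op_def using assms by (simp add: fer_simps)
  also have "\<dots> = (\<Sum>a\<in>Lab. Y (conf a) 1 (fer d p v) + (if d = a then sc (of_int (2 * p + 1)) (fer a p v) else 0))"
    using assms by (intro sum.cong refl) (simp add: fer_commute_conf)
  also have "\<dots> = energy_op (fer d p v) + sc (of_int (2 * p + 1)) (fer d p v)"
    unfolding sum.distrib energy_op_def using assms by (simp add: sum.delta)
  finally show ?thesis by (simp add: algebra_simps)
qed

lemma energy_op_V0: "v \<in> V0 \<Longrightarrow> energy_op v \<in> V0"
  unfolding energy_op_def by (intro subspace_sum[OF subspace_V0] even_even pair_even)

lemma energy_op_vac: "energy_op vac = 0"
  by (simp add: energy_op_def creation)

lemma energy_op_word:
  assumes f: "\<And>a p. a \<in> Lab \<Longrightarrow> lin (f a p)"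
    and rel: "\<And>a p v. a \<in> Lab \<Longrightarrow> energy_op (f a p v) = f a p (energy_op v) - sc (of_int (2 * p + 1)) (f a p v)"
    and "xs \<in> letters"
  shows "energy_op (word f xs) = sc (of_nat (energy xs)) (word f xs)"
  using assms(3)
proof (induction xs)
  case Nil
  then show ?case by (simp add: energy_op_vac)
next
  case (Cons bs xs)
  obtain b s where bs: "bs = (b, s)" by (cases bs)
  have "energy_op (word f (bs # xs)) =
      sc (of_nat (energy xs)) (word f (bs # xs)) - sc (of_int (2 * (- 1 - int s) + 1)) (word f (bs # xs))"
    using Cons bs lin_scale[OF f, of b] by (simp add: rel)
  also have "\<dots> = sc (of_nat (energy xs) - of_int (2 * (- 1 - int s) + 1)) (word f (bs # xs))"
    by (simp only: scale_left_diff_distrib)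
  also have "(of_nat (energy xs) - of_int (2 * (- 1 - int s) + 1) :: complex) = of_nat (energy (bs # xs))"
    using bs by simp
  finally show ?case .
qed

lemma word_energy_finite: "finite {xs \<in> letters. energy xs = e}"
proof -
  have "set xs \<subseteq> Lab \<times> {..energy xs} \<and> length xs \<le> energy xs" if "xs \<in> letters" for xs
    using that
  proof (induction xs)
    case (Cons bs xs)
    obtain b s where bs: "bs = (b, s)" by (cases bs)
    then have "set xs \<subseteq> Lab \<times> {..energy xs}" "length xs \<le> energy xs" "b \<in> Lab" using Cons by auto
    moreover have "Lab \<times> {..energy xs} \<subseteq> Lab \<times> {..energy (bs # xs)}" by (auto simp: bs)
    ultimately have "set (bs # xs) \<subseteq> Lab \<times> {..energy (bs # xs)}" "length (bs # xs) \<le> energy (bs # xs)"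
      by (auto simp: bs)
    then show ?case by blast
  qed simp
  then have "{xs \<in> letters. energy xs = e} \<subseteq> {xs. set xs \<subseteq> Lab \<times> {..e} \<and> length xs \<le> e}"
    by auto
  then show ?thesis by (rule finite_subset) (simp add: finite_lists_length_le)
qed

section \<open>Generation of even words by quadratic states\<close>

text \<open>The term of degree four contains the square of a creation operator. Only the single
  contractions are left.\<close>

lemma pair_product:
  assumes "a \<in> Lab" "c \<in> Lab" "a \<noteq> c"
  shows "Y (pair a c) (-1) (pair c a) = conf a + conf c"
proof -
  have "fer c (-1) (fer a (-1) (pair a c)) = 0"
    using assms by (simp add: fer_square fer_simps)
  then show ?thesis
    using assms by (simp add: pair_mode_fer creation fer_simps conf_flip)
qed

text \<open>With three labels, the sums \<open>conf a + conf c\<close> yield each \<open>conf a\<close>, whose zero mode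
  differentiates the fermion \<open>a\<close> alone. This gives the states \<open>\<psi>\<^sub>a(s) \<psi>\<^sub>c\<close> with
  \<open>a \<noteq> c\<close>, and the pair \<open>\<psi>\<^sub>a \<psi>\<^sub>a\<close> is obtained by inserting
  \<open>1 = \<psi>\<^sub>c \<psi>\<^sub>c\<^sup>* + \<psi>\<^sub>c\<^sup>* \<psi>\<^sub>c\<close>. The grading by \<open>bool\<close> keeps track of the eigenvalue of an
  involution. For a constant family \<open>E\<close> the lemma is about a single subalgebra.\<close>

lemma graded_pair_closure:
  fixes E :: "bool \<Rightarrow> 'a set" and e :: "nat \<times> nat \<Rightarrow> bool"
  assumes I: "I \<subseteq> Lab" "card I \<ge> 3"
    and E: "\<And>x. subspace (E x)" "vac \<in> E False"
    and Y: "\<And>u v x y p. u \<in> E x \<Longrightarrow> v \<in> E y \<Longrightarrow> Y u p v \<in> E (x \<noteq> y)"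
    and pair: "\<And>a b. a \<in> I \<Longrightarrow> b \<in> I \<Longrightarrow> pair a b \<in> E (e a \<noteq> e b)"
    and ab: "a \<in> I" "b \<in> I" and w: "w \<in> E x"
  shows "fer a p (fer b q w) \<in> E (x \<noteq> (e a \<noteq> e b))"
proof -
  have third: "\<exists>d\<in>I. d \<noteq> a \<and> d \<noteq> c" for a c
  proof (rule ccontr)
    assume "\<not> ?thesis"
    then have "I \<subseteq> {a, c}" by auto
    then have "card I \<le> card {a, c}" by (intro card_mono) auto
    also have "\<dots> \<le> 2" by (simp add: card_insert_if)
    finally show False using I by simp
  qed
  have sums: "conf a + conf c \<in> E False" if "a \<in> I" "c \<in> I" "a \<noteq> c" for a c
  proof -
    have "((e a \<noteq> e c) \<noteq> (e c \<noteq> e a)) = False" by auto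
    moreover have "Y (pair a c) (-1) (pair c a) = conf a + conf c"
      using that I(1) by (intro pair_product) auto
    ultimately show ?thesis
      using Y[OF pair[OF that(1,2)] pair[OF that(2,1)], of "-1"] by simp
  qed
  have two: "sc 2 z = z + z" for z :: 'a
    by (metis one_add_one scale_left_distrib scale_one)
  have conf: "conf a \<in> E False" if a: "a \<in> I" for a
  proof -
    obtain c where c: "c \<in> I" "c \<noteq> a" using third by blast
    obtain d where d: "d \<in> I" "d \<noteq> a" "d \<noteq> c" using third by blast
    have "(conf a + conf c) + (conf a + conf d) - (conf c + conf d) \<in> E False"
      using sums[OF a c(1) c(2)[symmetric]] sums[OF a d(1) d(2)[symmetric]] sums[OF c(1) d(1) d(3)[symmetric]]
      by (metis subspace_add[OF E(1)] subspace_diff[OF E(1)])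
    then have "sc 2 (conf a) \<in> E False" by (simp add: two algebra_simps)
    then have "sc (1 / 2) (sc 2 (conf a)) \<in> E False" by (rule subspace_scale[OF E(1)])
    then show ?thesis by simp
  qed
  \<comment> \<open>The zero mode of \<open>conf a\<close> lowers the mode of \<open>\<psi>\<^sub>a\<close> and does not see \<open>\<psi>\<^sub>c\<close>.\<close>
  have quad: "fer a i (fermion c) \<in> E (e a \<noteq> e c)" if ac: "a \<in> I" "c \<in> I" "a \<noteq> c" for a c i
  proof (cases "i < 0")
    case False
    then have "fer a i (fermion c) = 0" using ac I fer_fermion[of a c i] by auto
    then show ?thesis by (simp add: subspace_0[OF E(1)])
  next
    case True
    have L: "a \<in> Lab" "c \<in> Lab" using ac I by auto
    have "fer a (- 1 - int s) (fermion c) \<in> E (e a \<noteq> e c)" for s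
    proof (induction s)
      case 0
      then show ?case using pair ac by simp
    next
      case (Suc s)
      define k where "k = - (2 * (- 1 - int s))"
      have "k \<noteq> 0" by (simp add: k_def)
      have "Y (conf a) 0 (fer a (- 1 - int s) (fermion c)) =
          sc (of_int k) (fer a (- 1 - int (Suc s)) (fermion c))"
        using L ac(3) by (simp add: conf_mode_fer creation fer_simps k_def algebra_simps)
      moreover have "Y (conf a) 0 (fer a (- 1 - int s) (fermion c)) \<in> E (e a \<noteq> e c)"
        using Y[OF conf[OF ac(1)] Suc] by simp
      ultimately have "sc (1 / of_int k) (sc (of_int k) (fer a (- 1 - int (Suc s)) (fermion c))) \<in> E (e a \<noteq> e c)"
        by (metis subspace_scale[OF E(1)])
      then show ?case using \<open>k \<noteq> 0\<close> by simp
    qed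
    from this[of "nat (- 1 - i)"] True show ?thesis by simp
  qed
  have neq: "fer a p (fer c q w) \<in> E (x \<noteq> (e a \<noteq> e c))"
    if ac: "a \<in> I" "c \<in> I" "a \<noteq> c" and w: "w \<in> E x" for a c p q w x
  proof -
    have L: "a \<in> Lab" "c \<in> Lab" using ac I by auto
    have "Y (Y (fermion a) i (fermion c)) j w \<in> E (x \<noteq> (e a \<noteq> e c))" for i j
    proof -
      have "((e a \<noteq> e c) \<noteq> x) = (x \<noteq> (e a \<noteq> e c))" by auto
      then show ?thesis using Y[OF quad[OF ac, of i] w, of j] L by (simp add: Y_fermion)
    qed
    then have "Y (fermion a) p (Y (fermion c) q w) \<in> E (x \<noteq> (e a \<noteq> e c))"
      using L fermion_odd E(1) by (intro iterated_product_in_subspace) auto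
    then show ?thesis using L by (simp add: Y_fermion)
  qed
  show ?thesis
  proof (cases "a = b")
    case False
    then show ?thesis using neq ab w by blast
  next
    case True
    obtain c where c: "c \<in> I" "c \<noteq> a" using third by blast
    have L: "a \<in> Lab" "c \<in> Lab" using ab c I by auto
    have "fer a p (fer c r (fer c s (fer a q w))) \<in> E x" for r s
    proof -
      have "fer c s (fer a q w) \<in> E (x \<noteq> (e c \<noteq> e a))" using neq[OF c(1) ab(1) c(2) w] .
      from neq[OF ab(1) c(1) _ this] c(2)
      have "fer a p (fer c r (fer c s (fer a q w))) \<in> E ((x \<noteq> (e c \<noteq> e a)) \<noteq> (e a \<noteq> e c))" by auto
      moreover have "((x \<noteq> (e c \<noteq> e a)) \<noteq> (e a \<noteq> e c)) = x" by auto
      ultimately show ?thesis by simp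
    qed
    then have "fer a p (fer c 0 (fer c (-1) (fer a q w))) + fer a p (fer c (-1) (fer c 0 (fer a q w))) \<in> E x"
      by (intro subspace_add[OF E(1)])
    also have "fer a p (fer c 0 (fer c (-1) (fer a q w))) + fer a p (fer c (-1) (fer c 0 (fer a q w))) =
        fer a p (fer c 0 (fer c (-1) (fer a q w)) + fer c (-1) (fer c 0 (fer a q w)))"
      using L by (simp add: fer_simps)
    also have "fer c 0 (fer c (-1) (fer a q w)) + fer c (-1) (fer c 0 (fer a q w)) = fer a q w"
      using fer_anticommute[OF L(2) L(2), of 0 "-1" "fer a q w"] by simp
    finally show ?thesis using True by simp
  qed
qed

section \<open>The tensor product as a fixed point algebra\<close>

abbreviation "factor \<equiv> L_so_factor sc vac Y psi K"

abbreviation column :: "nat \<Rightarrow> (nat \<times> nat) set"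
  where "column j \<equiv> {1..K} \<times> {j}"

lemma bilin_pair: "bilin vac psi k i l j = pair (k, i) (l, j)"
  by (simp add: bilin_def fer_def)

lemma column_Lab: "j \<in> {1..n} \<Longrightarrow> a \<in> column j \<Longrightarrow> a \<in> Lab"
  by (auto simp: Lab_def)

lemma factor_generated: "factor j = generated_subalgebra sc vac Y {pair a b |a b. a \<in> column j \<and> b \<in> column j}"
proof -
  have "{bilin vac psi k j l j | k l. k \<in> {1..K} \<and> l \<in> {1..K}} = {pair a b |a b. a \<in> column j \<and> b \<in> column j}"
    by (fastforce simp: bilin_pair)
  then show ?thesis by (simp add: L_so_factor_def)
qed

lemma factor_subalgebra: "vertex_subalgebra sc vac Y (factor j)"
  by (simp add: factor_generated vertex_subalgebra_generated)

lemma factor_least: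
  assumes "vertex_subalgebra sc vac Y U" "\<And>a b. a \<in> column j \<Longrightarrow> b \<in> column j \<Longrightarrow> pair a b \<in> U"
  shows "factor j \<subseteq> U"
  unfolding factor_generated by (rule generated_subalgebra_least[OF assms(1)]) (use assms(2) in blast)

lemma factor_V0: "j \<in> {1..n} \<Longrightarrow> factor j \<subseteq> V0"
  by (intro factor_least[OF vertex_subalgebra_V0] pair_even column_Lab)

lemma pair_in_factor: "a \<in> column j \<Longrightarrow> b \<in> column j \<Longrightarrow> pair a b \<in> factor j"
  unfolding factor_generated by (rule subsetD[OF generators_in_generated]) blast

lemma factor_pair_closure:
  assumes "K \<ge> 3" "j \<in> {1..n}" "a \<in> column j" "b \<in> column j" "w \<in> factor j"
  shows "fer a p (fer b q w) \<in> factor j"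
proof (rule graded_pair_closure[where E = "\<lambda>_. factor j" and I = "column j" and e = "\<lambda>_. False" and x = False])
  show "column j \<subseteq> Lab" using assms column_Lab by auto
  show "card (column j) \<ge> 3" using assms by simp
  show "Y u p v \<in> factor j" if "u \<in> factor j" "v \<in> factor j" for u v p
    using that by (rule vertex_subalgebraD(3)[OF factor_subalgebra])
qed (use assms pair_in_factor vertex_subalgebraD(1,2)[OF factor_subalgebra] in simp_all)

lemma fer_factor_zero:
  assumes j: "j \<in> {1..n}" "i \<in> {1..n}" "i \<noteq> j" and "a \<in> column j" "u \<in> factor i" "p \<ge> 0"
  shows "fer a p u = 0"
proof -
  have L: "a \<in> Lab" using assms column_Lab by blast
  have "factor i \<subseteq> {v \<in> V0. \<forall>u\<in>{fermion a}. \<forall>p\<ge>0. Y u p v = 0}"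
  proof (rule factor_least[OF vertex_subalgebra_right_annihilators])
    fix b c assume bc: "b \<in> column i" "c \<in> column i"
    then have "b \<in> Lab" "c \<in> Lab" "a \<noteq> b" "a \<noteq> c" using assms column_Lab by auto
    then show "pair b c \<in> {v \<in> V0. \<forall>u\<in>{fermion a}. \<forall>p\<ge>0. Y u p v = 0}"
      using L by (auto simp: pair_even Y_fermion fer_pair_nonneg)
  qed (use fermion_odd L in auto)
  then show ?thesis using assms L by (auto simp: Y_fermion)
qed

lemma factor_annihilates:
  assumes j: "j \<in> {1..n}" and v: "\<And>a p. a \<in> column j \<Longrightarrow> p \<ge> 0 \<Longrightarrow> fer a p v = 0"
    and u: "u \<in> factor j" "p \<ge> 0"
  shows "Y u p v = 0"
proof -
  have "factor j \<subseteq> {u \<in> V0. \<forall>p\<ge>0. Y u p v = 0}"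
  proof (rule factor_least[OF vertex_subalgebra_left_annihilators])
    fix a b assume ab: "a \<in> column j" "b \<in> column j"
    then have L: "a \<in> Lab" "b \<in> Lab" using column_Lab j by auto
    have "Y (Y (fermion a) (-1) (fermion b)) p v = 0" if "p \<ge> 0" for p
      using that v ab L fermion_odd by (intro product_annihilates) (auto simp: Y_fermion)
    then show "pair a b \<in> {u \<in> V0. \<forall>p\<ge>0. Y u p v = 0}"
      using L by (auto simp: pair_even Y_fermion)
  qed
  then show ?thesis using u by auto
qed

text \<open>If nonnegative modes of both \<open>a\<close> and \<open>b\<close> kill \<open>u\<close>, the associator formula for \<open>(a\<^sub>q b)\<^sub>-\<^sub>1 u\<close> keeps only
  its leading term. A fermion of one column thus acts on a product of factors through its own
  factor.\<close>

lemma fer_product: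
  assumes a: "a \<in> Lab" and b: "b \<in> V0 \<union> V1"
    and u: "\<And>t. t \<ge> 0 \<Longrightarrow> Y b t u = 0" "\<And>t. t \<ge> 0 \<Longrightarrow> fer a t u = 0"
  shows "fer a q (Y b (-1) u) = Y (fer a q b) (-1) u"
    and "t \<ge> 0 \<Longrightarrow> Y (fer a q b) t u = 0"
proof -
  have F: "fermion a \<in> V0 \<union> V1" using fermion_odd a by auto
  have "Y (Y (fermion a) q b) (-1) u = Sum_any (\<lambda>j::nat. sc ((-1) ^ j * (of_int q gchoose j))
        (Y (fermion a) (q - int j) (Y b (-1 + int j) u)
          - sc (koszul (fermion a) b * (-1) powi q) (Y b (q + -1 - int j) (Y (fermion a) (int j) u))))"
    by (rule associator_formula[OF F b])
  also have "\<dots> = sc ((-1) ^ 0 * (of_int q gchoose 0))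
        (Y (fermion a) (q - int 0) (Y b (-1 + int 0) u)
          - sc (koszul (fermion a) b * (-1) powi q) (Y b (q + -1 - int 0) (Y (fermion a) (int 0) u)))"
    using u a by (intro Sum_any_only_zero) (simp add: Y_fermion Y_simps fer_simps)
  finally show "fer a q (Y b (-1) u) = Y (fer a q b) (-1) u"
    using a u by (simp add: Y_fermion Y_simps)
  show "Y (fer a q b) t u = 0" if "t \<ge> 0"
    using product_annihilates[OF F b that, of u q] u a by (simp add: Y_fermion)
qed

abbreviation product :: "nat list \<Rightarrow> (nat \<Rightarrow> 'a) \<Rightarrow> 'a"
  where "product js a \<equiv> foldr (\<lambda>j v. Y (a j) (-1) v) js vac"

abbreviation "tensor \<equiv> L_so_tensor sc vac Y psi K n"

lemma product_in_subalgebra: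
  "vertex_subalgebra sc vac Y U \<Longrightarrow> (\<And>j. j \<in> set js \<Longrightarrow> u j \<in> U) \<Longrightarrow> product js u \<in> U"
  by (induction js) (auto intro: vertex_subalgebraD)

lemma fer_product_zero:
  assumes "j \<in> {1..n}" "set js \<subseteq> {1..n}" "j \<notin> set js" "\<And>i. i \<in> set js \<Longrightarrow> u i \<in> factor i"
    "a \<in> column j" "p \<ge> 0"
  shows "fer a p (product js u) = 0"
proof -
  have L: "a \<in> Lab" using assms column_Lab by blast
  have "product js u \<in> {v \<in> V0. \<forall>u\<in>{fermion a}. \<forall>p\<ge>0. Y u p v = 0}"
  proof (rule product_in_subalgebra[OF vertex_subalgebra_right_annihilators])
    fix i assume i: "i \<in> set js"
    then have "i \<in> {1..n}" "i \<noteq> j" using assms by auto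
    then have "u i \<in> V0" "\<And>p. p \<ge> 0 \<Longrightarrow> fer a p (u i) = 0"
      using assms(4)[OF i] factor_V0 fer_factor_zero[OF assms(1) _ _ assms(5)] by auto
    then show "u i \<in> {v \<in> V0. \<forall>u\<in>{fermion a}. \<forall>p\<ge>0. Y u p v = 0}" using L by (simp add: Y_fermion)
  qed (use fermion_odd L in auto)
  then show ?thesis using assms L by (auto simp: Y_fermion)
qed

lemma pair_on_product:
  assumes js: "distinct js" "set js \<subseteq> {1..n}" "j \<in> set js" and u: "\<And>i. i \<in> set js \<Longrightarrow> u i \<in> factor i"
    and ab: "a \<in> column j" "b \<in> column j"
  shows "fer a p (fer b q (product js u)) = product js (u(j := fer a p (fer b q (u j))))"
  using js u
proof (induction js)
  case Nil
  then show ?case by simp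
next
  case (Cons i js)
  have jn: "j \<in> {1..n}" "i \<in> {1..n}" using Cons.prems by auto
  have L: "a \<in> Lab" "b \<in> Lab" using ab column_Lab jn by auto
  have ui: "u i \<in> factor i" "u i \<in> V0" using Cons.prems(4) factor_V0 jn by auto
  show ?case
  proof (cases "i = j")
    case True
    then have nj: "j \<notin> set js" using Cons.prems by auto
    define v where "v = product js u"
    have v: "fer c t v = 0" if "c \<in> column j" "t \<ge> 0" for c t
      unfolding v_def using that jn nj Cons.prems by (intro fer_product_zero[of j]) auto
    have uv: "Y (u j) t v = 0" if "t \<ge> 0" for t
      using factor_annihilates[OF jn(1) v] ui True that by auto
    have "fer b q (Y (u j) (-1) v) = Y (fer b q (u j)) (-1) v"
      by (rule fer_product(1)[OF L(2)]) (use ui True v uv ab in auto)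
    moreover have zero: "Y (fer b q (u j)) t v = 0" if "t \<ge> 0" for t
      by (rule fer_product(2)[OF L(2)]) (use that ui True v uv ab in auto)
    have "fer a p (Y (fer b q (u j)) (-1) v) = Y (fer a p (fer b q (u j))) (-1) v"
      by (rule fer_product(1)[OF L(1)]) (use zero L ui True v ab fer_V0 in auto)
    moreover have "fer a p (Y (fer b q (u j)) (-1) v) = Y (fer a p (fer b q (u j))) (-1) v" by fact
    moreover have "product js (u(j := fer a p (fer b q (u j)))) = v"
      unfolding v_def using nj by (intro foldr_cong) auto
    ultimately show ?thesis using True by (simp flip: v_def)
  next
    case False
    have comm: "fer c t (Y (u i) (-1) v) = Y (u i) (-1) (fer c t v)" if c: "c \<in> column j" for c t v
    proof -
      have Lc: "c \<in> Lab" using c column_Lab jn by auto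
      have "Y (fermion c) t (Y (u i) (-1) v) = sc (koszul (fermion c) (u i)) (Y (u i) (-1) (Y (fermion c) t v))"
        using Lc fermion_odd ui fer_factor_zero[OF jn False c ui(1)]
        by (intro commute_if_products_vanish) (auto simp: Y_fermion)
      then show ?thesis using Lc ui by (simp add: koszul_even_right Y_fermion)
    qed
    show ?thesis using Cons False by (simp add: comm[OF ab(1)] comm[OF ab(2)])
  qed
qed

lemma tensor_pair_closure:
  assumes "K \<ge> 3" "j \<in> {1..n}" "a \<in> column j" "b \<in> column j" "w \<in> tensor"
  shows "fer a p (fer b q w) \<in> tensor"
proof -
  have L: "a \<in> Lab" "b \<in> Lab" using assms column_Lab by auto
  have lin: "lin (\<lambda>w. fer a p (fer b q w))"
    by (rule linI) (simp_all add: fer_simps L)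
  show ?thesis
  proof (rule lin_span_into[OF lin])
    show "subspace tensor" by (simp add: L_so_tensor_def)
    show "w \<in> span {product [1..<Suc n] u |u. \<forall>j\<in>{1..n}. u j \<in> factor j}"
      using assms by (simp add: L_so_tensor_def)
    fix s assume "s \<in> {product [1..<Suc n] u |u. \<forall>j\<in>{1..n}. u j \<in> factor j}"
    then obtain u where u: "s = product [1..<Suc n] u" "\<forall>j\<in>{1..n}. u j \<in> factor j" by auto
    have "fer a p (fer b q s) = product [1..<Suc n] (u(j := fer a p (fer b q (u j))))"
      unfolding u(1) using assms u(2) by (intro pair_on_product) auto
    moreover have "\<forall>i\<in>{1..n}. (u(j := fer a p (fer b q (u j)))) i \<in> factor i"
      using u(2) assms factor_pair_closure by auto
    ultimately show "fer a p (fer b q s) \<in> tensor"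
      unfolding L_so_tensor_def by (intro span_base) blast
  qed
qed

lemma vac_in_tensor: "vac \<in> tensor"
proof -
  have "product js (\<lambda>_. vac) = vac" for js by (induction js) (simp_all add: vacuum)
  then have "vac = product [1..<Suc n] (\<lambda>_. vac)" by (simp only:)
  moreover have "\<forall>j\<in>{1..n}. vac \<in> factor j"
    using vertex_subalgebraD(2)[OF factor_subalgebra] by blast
  ultimately have "\<exists>u. vac = product [1..<Suc n] u \<and> (\<forall>j\<in>{1..n}. u j \<in> factor j)"
    by (rule_tac x = "\<lambda>_. vac" in exI) (rule conjI)
  then show ?thesis unfolding L_so_tensor_def by (intro span_base CollectI)
qed

definition column_count :: "nat \<Rightarrow> ((nat \<times> nat) \<times> nat) list \<Rightarrow> nat"
  where "column_count j xs = length (filter (\<lambda>x. snd (fst x) = j) xs)"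

lemma column_count_simps [simp]:
  "column_count j [] = 0"
  "column_count j ((a, s) # xs) = (if snd a = j then 1 else 0) + column_count j xs"
  "column_count j (xs @ ys) = column_count j xs + column_count j ys"
  by (simp_all add: column_count_def)

lemma move_letter_to_front:
  assumes "us @ (b, t) # vs \<in> letters"
  shows "\<exists>c. word fer (us @ (b, t) # vs) = sc c (fer b (- 1 - int t) (word fer (us @ vs)))"
  using assms
proof (induction us)
  case Nil
  then show ?case by (intro exI[of _ 1]) simp
next
  case (Cons x us)
  obtain a s where x: "x = (a, s)" by (cases x)
  obtain c where c: "word fer (us @ (b, t) # vs) = sc c (fer b (- 1 - int t) (word fer (us @ vs)))"
    using Cons by (auto simp: x)
  have "a \<in> Lab" "b \<in> Lab" using Cons.prems by (auto simp: x)
  then have "word fer ((x # us) @ (b, t) # vs) = sc (- c) (fer b (- 1 - int t) (word fer ((x # us) @ vs)))"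
    using fer_creation_anticommute[of a b "- 1 - int s" "- 1 - int t"]
    by (simp add: x c fer_simps)
  then show ?case by blast
qed

text \<open>The first letter is moved next to another one of the same column, and the pair is then
  applied to an element of the tensor product.\<close>

lemma even_columns_word_in_tensor:
  assumes "K \<ge> 3" "xs \<in> letters" "\<And>j. even (column_count j xs)"
  shows "word fer xs \<in> tensor"
  using assms(2,3)
proof (induction "length xs" arbitrary: xs rule: less_induct)
  case less
  show ?case
  proof (cases xs)
    case Nil
    then show ?thesis using vac_in_tensor by simp
  next
    case (Cons x ys)
    obtain a s where x: "x = (a, s)" by (cases x)
    have "odd (column_count (snd a) ys)" using less.prems(2)[of "snd a"] by (simp add: Cons x)
    then have "column_count (snd a) ys \<noteq> 0" by (metis even_zero)
    then obtain y where "y \<in> set ys" "snd (fst y) = snd a"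
      by (auto simp: column_count_def filter_empty_conv)
    then obtain us b t vs where ys: "ys = us @ (b, t) # vs" "snd b = snd a"
      by (metis split_list prod.collapse)
    have L: "a \<in> Lab" "b \<in> Lab" using less.prems(1) by (auto simp: Cons x ys)
    obtain c where c: "word fer ys = sc c (fer b (- 1 - int t) (word fer (us @ vs)))"
      using move_letter_to_front[of us b t vs] less.prems(1) by (auto simp: Cons x ys)
    have "even (column_count j (us @ vs))" for j
      using less.prems(2)[of j] ys(2) by (simp add: Cons x ys(1) split: if_splits)
    then have "word fer (us @ vs) \<in> tensor"
      using less.prems(1) by (intro less.hyps) (auto simp: Cons x ys)
    then have "fer a (- 1 - int s) (fer b (- 1 - int t) (word fer (us @ vs))) \<in> tensor"
      using L ys(2) by (intro tensor_pair_closure[OF assms(1), of "snd a"]) (auto simp: Lab_def mem_Times_iff)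
    then have "sc c (fer a (- 1 - int s) (fer b (- 1 - int t) (word fer (us @ vs)))) \<in> tensor"
      unfolding L_so_tensor_def by (rule span_scale)
    then show ?thesis using L by (simp add: Cons x c fer_simps)
  qed
qed

lemma fer_words_span: "v \<in> span (word fer ` letters)"
proof (rule words_span)
  show "fer a p v \<in> span {fer b p v |b. b \<in> Lab}" if "a \<in> Lab" for a p v
    using that by (intro span_base) blast
  show "\<exists>c. fer a p (fer b q v) + fer b q (fer a p v) = sc c v" if "a \<in> Lab" "b \<in> Lab" for a b p q v
    using fer_anticommute[OF that, of p q v]
    by (intro exI[of _ "if a = b \<and> p + q = -1 then 1 else 0"]) auto
qed (rule lin_fer)

lemma fer_even_words_span: "v \<in> V0 \<Longrightarrow> v \<in> span (word fer ` {xs \<in> letters. even (length xs)})"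
  by (rule even_words_span[OF fer_words_span]) (auto intro: fer_V0 fer_V1)

context
  fixes i :: nat and g :: "'a \<Rightarrow> 'a"
  assumes sigma: "is_sigma sc V0 vac Y psi K n i g"
begin

lemma sigma_simps:
  "u \<in> V0 \<Longrightarrow> g u \<in> V0" "u \<in> V0 \<Longrightarrow> v \<in> V0 \<Longrightarrow> g (u + v) = g u + g v"
  "v \<in> V0 \<Longrightarrow> g (sc c v) = sc c (g v)" "g vac = vac"
  "u \<in> V0 \<Longrightarrow> v \<in> V0 \<Longrightarrow> g (Y u p v) = Y (g u) p (g v)"
  using sigma Bij_imp_funcset[of g V0] unfolding is_sigma_def vertex_automorphisms_def by auto

lemma sigma_zero: "g 0 = 0"
  using sigma_simps(3)[of 0 0] subspace_0[OF subspace_V0] by simp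

lemma sigma_pair:
  assumes "a \<in> Lab" "b \<in> Lab"
  shows "g (pair a b) = (if (snd a = i) = (snd b = i) then pair a b else - pair a b)"
proof -
  have "g (bilin vac psi (fst a) (snd a) (fst b) (snd b)) =
     sc ((-1) ^ (of_bool (i = snd a) + of_bool (i = snd b))) (bilin vac psi (fst a) (snd a) (fst b) (snd b))"
    using assms sigma by (auto simp: is_sigma_def Lab_def)
  then show ?thesis by (auto simp: bilin_pair)
qed

lemma sigma_fixed_subalgebra: "vertex_subalgebra sc vac Y {v \<in> V0. g v = v}"
  by (auto simp: vertex_subalgebra_def subspace_def sigma_simps sigma_zero vac_even even_even
      subspace_0[OF subspace_V0] subspace_add[OF subspace_V0] subspace_scale[OF subspace_V0])

lemma tensor_sigma_fixed: "tensor \<subseteq> {v \<in> V0. g v = v}"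
  unfolding L_so_tensor_def
proof (rule span_minimal)
  have factor: "factor j \<subseteq> {v \<in> V0. g v = v}" if j: "j \<in> {1..n}" for j
  proof (rule factor_least[OF sigma_fixed_subalgebra])
    fix a b assume ab: "a \<in> column j" "b \<in> column j"
    then have "a \<in> Lab" "b \<in> Lab" using column_Lab[OF j] by auto
    then show "pair a b \<in> {v \<in> V0. g v = v}" using ab by (auto simp: pair_even sigma_pair)
  qed
  show "{product [1..<Suc n] u |u. \<forall>j\<in>{1..n}. u j \<in> factor j} \<subseteq> {v \<in> V0. g v = v}"
  proof safe
    fix u assume u: "\<forall>j\<in>{1..n}. u j \<in> factor j"
    have "product [1..<Suc n] u \<in> {v \<in> V0. g v = v}"
    proof (rule product_in_subalgebra[OF sigma_fixed_subalgebra])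
      fix j assume "j \<in> set [1..<Suc n]"
      then have "j \<in> {1..n}" by auto
      then show "u j \<in> {v \<in> V0. g v = v}" using u factor[of j] by blast
    qed
    then show "product [1..<Suc n] u \<in> V0" "g (product [1..<Suc n] u) = product [1..<Suc n] u" by auto
  qed
qed (rule vertex_subalgebraD[OF sigma_fixed_subalgebra])

text \<open>The automorphism is prescribed on quadratic states only. Its eigenspaces on \<open>V0\<close> form a graded
  family, along which \<open>graded_pair_closure\<close> carries the eigenvalue to all even words.\<close>

lemma sigma_word:
  assumes "card Lab \<ge> 3" "xs \<in> letters" "even (length xs)"
  shows "g (word fer xs) = (if even (column_count i xs) then word fer xs else - word fer xs)"
proof -
  define E where "E x = {v \<in> V0. g v = (if x then - v else v)}" for x
  have Eiff: "v \<in> E x \<longleftrightarrow> v \<in> V0 \<and> g v = (if x then - v else v)" for v x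
    by (simp add: E_def)
  have "word fer xs \<in> E (odd (column_count i xs))"
    using assms(2,3)
  proof (induction xs rule: induct_list012)
    case 1
    then show ?case by (simp add: Eiff vac_even sigma_simps)
  next
    case (2 x)
    then show ?case by simp
  next
    case (3 x y xs)
    obtain a s b t where xy: "x = (a, s)" "y = (b, t)" by (cases x, cases y)
    have "fer a (- 1 - int s) (fer b (- 1 - int t) (word fer xs)) \<in>
        E (odd (column_count i xs) \<noteq> ((snd a = i) \<noteq> (snd b = i)))"
    proof (rule graded_pair_closure[where I = Lab and e = "\<lambda>a. snd a = i"])
      show "subspace (E x)" for x
        using subspace_V0 by (auto simp: E_def subspace_def sigma_simps sigma_zero)
      show "vac \<in> E False" by (simp add: Eiff vac_even sigma_simps)
      show "Y u p v \<in> E (x \<noteq> y)" if "u \<in> E x" "v \<in> E y" for u v x y p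
        using that by (auto simp: Eiff even_even sigma_simps Y_simps Y_left_simps)
      show "pair a b \<in> E ((snd a = i) \<noteq> (snd b = i))" if "a \<in> Lab" "b \<in> Lab" for a b
        using that by (simp add: Eiff pair_even sigma_pair)
    qed (use 3 xy assms in auto)
    moreover have "(odd (column_count i xs) \<noteq> ((snd a = i) \<noteq> (snd b = i))) =
        odd (column_count i (x # y # xs))" by (auto simp: xy)
    ultimately show ?case by (simp add: xy)
  qed
  then show ?thesis by (simp add: Eiff split: if_splits)
qed

end

text \<open>A fixed vector equals its average under \<open>\<sigma>\<^sub>t\<close>. Averaging an expansion into even words removes the
  words with an odd number of letters in column \<open>t\<close>, for \<open>t = 1, \<dots>, n\<close> in turn.\<close>

theorem tensor_eq_sigma_fixed:
  assumes K: "K \<ge> 3" and sigma: "\<And>i. i \<in> {1..n} \<Longrightarrow> is_sigma sc V0 vac Y psi K n i (\<sigma> i)"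
    and n: "n \<ge> 1"
  shows "tensor = {v \<in> V0. \<forall>i\<in>{1..n}. \<sigma> i v = v}"
proof
  show "tensor \<subseteq> {v \<in> V0. \<forall>i\<in>{1..n}. \<sigma> i v = v}"
    using tensor_sigma_fixed[OF sigma] n by fastforce
next
  have card: "card Lab \<ge> 3" using mult_le_mono[OF K n] by (simp add: Lab_def)
  show "{v \<in> V0. \<forall>i\<in>{1..n}. \<sigma> i v = v} \<subseteq> tensor"
  proof
    fix v assume v: "v \<in> {v \<in> V0. \<forall>i\<in>{1..n}. \<sigma> i v = v}"
    define S where "S t = {xs \<in> letters. even (length xs) \<and> (\<forall>i\<in>{1..t}. even (column_count i xs))}" for t :: nat
    have "v \<in> span (word fer ` S t)" if "t \<le> n" for t
      using that
    proof (induction t)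
      case 0
      then show ?case using fer_even_words_span[of v] v by (simp add: S_def)
    next
      case (Suc t)
      let ?g = "\<sigma> (Suc t)"
      have g: "is_sigma sc V0 vac Y psi K n (Suc t) ?g" using sigma Suc.prems by auto
      note gs = sigma_simps[OF g] sigma_zero[OF g]
      have "v \<in> span (word fer ` S t)" using Suc by simp
      then have "v \<in> V0 \<and> v + ?g v \<in> span (word fer ` S (Suc t))"
      proof (induction rule: span_induct_alt)
        case base
        then show ?case by (simp add: gs subspace_0[OF subspace_V0] span_zero)
      next
        case (step c x y)
        then obtain xs where xs: "x = word fer xs" "xs \<in> S t" by auto
        have l: "xs \<in> letters" "even (length xs)" using xs by (auto simp: S_def)
        have par: "if even (length xs) then word fer xs \<in> V0 else word fer xs \<in> V1" if "xs \<in> letters" for xs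
          using that by (induction xs) (use fer_V0 fer_V1 vac_even in \<open>auto split: if_splits\<close>)
        then have x0: "x \<in> V0" using l xs by metis
        have "x + ?g x \<in> span (word fer ` S (Suc t))"
        proof (cases "even (column_count (Suc t) xs)")
          case True
          then have "xs \<in> S (Suc t)" using xs by (auto simp: S_def le_Suc_eq)
          then have "x \<in> span (word fer ` S (Suc t))" using xs(1) by (auto intro: span_base)
          then show ?thesis using sigma_word[OF g card l] True xs by (simp add: span_add)
        next
          case False
          then show ?thesis using sigma_word[OF g card l] xs by (simp add: span_zero)
        qed
        moreover have "y + ?g y \<in> span (word fer ` S (Suc t))" using step by blast
        ultimately have "sc c (x + ?g x) + (y + ?g y) \<in> span (word fer ` S (Suc t))"
          by (metis span_add span_scale)
        moreover have "sc c x + y + ?g (sc c x + y) = sc c (x + ?g x) + (y + ?g y)"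
          using x0 step by (simp add: gs subspace_scale[OF subspace_V0] scale_right_distrib)
        ultimately have "sc c x + y + ?g (sc c x + y) \<in> span (word fer ` S (Suc t))"
          by (simp only:)
        moreover have "sc c x + y \<in> V0"
          using x0 step by (simp add: subspace_add[OF subspace_V0] subspace_scale[OF subspace_V0])
        ultimately show ?case by blast
      qed
      moreover have "?g v = v" using v Suc.prems by auto
      ultimately have "sc (1 / 2) (v + v) \<in> span (word fer ` S (Suc t))" by (metis span_scale)
      moreover have "sc (1 / 2) (v + v) = v" by (simp flip: scale_left_distrib add: scale_right_distrib)
      ultimately show ?case by simp
    qed
    then have "v \<in> span (word fer ` S n)" by blast
    moreover have "word fer ` S n \<subseteq> tensor"
    proof safe
      fix xs assume xs: "xs \<in> S n"
      have "column_count j xs = 0" if "j \<notin> {1..n}" for j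
        using xs that by (auto simp: S_def letters_def column_count_def Lab_def filter_empty_conv)
      then have "even (column_count j xs)" for j
        using xs by (cases "j \<in> {1..n}") (auto simp: S_def)
      then show "word fer xs \<in> tensor"
        using xs by (intro even_columns_word_in_tensor[OF K]) (auto simp: S_def)
    qed
    ultimately show "v \<in> tensor"
      using span_minimal[of "word fer ` S n" tensor] by (auto simp: L_so_tensor_def)
  qed
qed

section \<open>The dual pair of current algebras\<close>

definition current :: "nat \<Rightarrow> nat \<Rightarrow> 'a"
  where "current i j = (\<Sum>k\<in>{1..K}. pair (k, i) (k, j))"

definition diag_current :: "nat \<Rightarrow> nat \<Rightarrow> 'a"
  where "diag_current k l = (\<Sum>i\<in>{1..n}. pair (k, i) (l, i))"

lemma in_Lab [simp]: "(k, i) \<in> Lab \<longleftrightarrow> k \<in> {1..K} \<and> i \<in> {1..n}"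
  by (auto simp: Lab_def)

lemma current_even: "i \<in> {1..n} \<Longrightarrow> j \<in> {1..n} \<Longrightarrow> current i j \<in> V0"
  unfolding current_def by (intro subspace_sum[OF subspace_V0] pair_even) auto

lemma diag_current_even: "k \<in> {1..K} \<Longrightarrow> l \<in> {1..K} \<Longrightarrow> diag_current k l \<in> V0"
  unfolding diag_current_def by (intro subspace_sum[OF subspace_V0] pair_even) auto

lemma current_skew: "i \<in> {1..n} \<Longrightarrow> j \<in> {1..n} \<Longrightarrow> current i j = - current j i"
  unfolding current_def sum_negf[symmetric] by (intro sum.cong refl pair_swap) auto

lemma current_mode_fer:
  assumes "i \<in> {1..n}" "j \<in> {1..n}" "k \<in> {1..K}" "l \<in> {1..n}"
  shows "Y (current i j) r (fer (k, l) p c) = fer (k, l) p (Y (current i j) r c)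
    - (if l = i then fer (k, j) (p + r) c else 0) + (if l = j then fer (k, i) (p + r) c else 0)"
proof -
  have "Y (current i j) r (fer (k, l) p c) = (\<Sum>k'\<in>{1..K}. fer (k, l) p (Y (pair (k', i) (k', j)) r c)
      - (if k = k' then if l = i then fer (k', j) (p + r) c else 0 else 0)
      + (if k = k' then if l = j then fer (k', i) (p + r) c else 0 else 0))"
    unfolding current_def Y_left_simps
    using assms by (intro sum.cong refl) (subst pair_mode_fer; force)
  also have "\<dots> = (\<Sum>k'\<in>{1..K}. fer (k, l) p (Y (pair (k', i) (k', j)) r c))
    - (if l = i then fer (k, j) (p + r) c else 0) + (if l = j then fer (k, i) (p + r) c else 0)"
    using assms by (simp add: sum.distrib sum_subtractf sum.delta)
  finally show ?thesis
    using assms by (simp add: current_def Y_left_simps fer_simps)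
qed

lemma diag_current_mode_fer:
  assumes "k \<in> {1..K}" "l \<in> {1..K}" "a \<in> {1..K}" "i \<in> {1..n}"
  shows "Y (diag_current k l) r (fer (a, i) p c) = fer (a, i) p (Y (diag_current k l) r c)
    - (if a = k then fer (l, i) (p + r) c else 0) + (if a = l then fer (k, i) (p + r) c else 0)"
proof -
  have "Y (diag_current k l) r (fer (a, i) p c) = (\<Sum>i'\<in>{1..n}. fer (a, i) p (Y (pair (k, i') (l, i')) r c)
      - (if i = i' then if a = k then fer (l, i') (p + r) c else 0 else 0)
      + (if i = i' then if a = l then fer (k, i') (p + r) c else 0 else 0))"
    unfolding diag_current_def Y_left_simps
    using assms by (intro sum.cong refl) (subst pair_mode_fer; force)
  also have "\<dots> = (\<Sum>i'\<in>{1..n}. fer (a, i) p (Y (pair (k, i') (l, i')) r c))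
    - (if a = k then fer (l, i) (p + r) c else 0) + (if a = l then fer (k, i) (p + r) c else 0)"
    using assms by (simp add: sum.distrib sum_subtractf sum.delta)
  finally show ?thesis
    using assms by (simp add: diag_current_def Y_left_simps fer_simps)
qed

lemma current_zero_mode_current:
  assumes "i \<in> {1..n}" "j \<in> {1..n}" "l \<in> {1..n}" "r \<in> {1..n}"
  shows "Y (current i j) 0 (current l r) =
    (if j = l then current i r else 0) - (if i = l then current j r else 0)
    + (if j = r then current l i else 0) - (if i = r then current l j else 0)"
proof -
  have "Y (current i j) 0 (current l r) = (\<Sum>k\<in>{1..K}. Y (current i j) 0 (pair (k, l) (k, r)))"
    by (simp add: current_def[of l r] Y_simps)
  also have "\<dots> = (\<Sum>k\<in>{1..K}. (if j = l then pair (k, i) (k, r) else 0) - (if i = l then pair (k, j) (k, r) else 0)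
    + (if j = r then pair (k, l) (k, i) else 0) - (if i = r then pair (k, l) (k, j) else 0))"
    using assms by (intro sum.cong refl) (simp add: current_mode_fer creation fer_simps)
  also have "\<dots> = (if j = l then current i r else 0) - (if i = l then current j r else 0)
    + (if j = r then current l i else 0) - (if i = r then current l j else 0)"
    by (simp add: current_def sum.distrib sum_subtractf)
  finally show ?thesis .
qed

text \<open>The two families commute: the simple contractions cancel in pairs, and so do the double ones.\<close>

lemma diag_current_current:
  assumes "k \<in> {1..K}" "l \<in> {1..K}" "i \<in> {1..n}" "j \<in> {1..n}" "p \<ge> 0"
  shows "Y (diag_current k l) p (current i j) = 0"
proof -
  have "Y (diag_current k l) p (current i j) = (\<Sum>a\<in>{1..K}. Y (diag_current k l) p (pair (a, i) (a, j)))"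
    by (simp add: current_def Y_simps)
  also have "\<dots> = (\<Sum>a\<in>{1..K}.
      ((if a = l then fer (a, i) (-1) (fer (k, j) (p - 1) vac) else 0)
      - (if a = k then fer (a, i) (-1) (fer (l, j) (p - 1) vac) else 0))
      + ((if a = l then fer (k, i) (p - 1) (fermion (a, j)) else 0)
      - (if a = k then fer (l, i) (p - 1) (fermion (a, j)) else 0)))"
    using assms by (intro sum.cong refl) (simp add: diag_current_mode_fer creation fer_simps)
  also have "\<dots> = (fer (l, i) (-1) (fer (k, j) (p - 1) vac) - fer (k, i) (-1) (fer (l, j) (p - 1) vac))
      + (fer (k, i) (p - 1) (fermion (l, j)) - fer (l, i) (p - 1) (fermion (k, j)))"
    using assms by (simp add: sum.distrib sum_subtractf sum.delta)
  also have "\<dots> = 0"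
  proof (cases "p = 0")
    case False
    then show ?thesis using assms by (auto simp: fer_vac fer_fermion fer_simps)
  qed simp
  finally show ?thesis .
qed

subsection \<open>The Sugawara identity\<close>

lemma current_product:
  assumes "i \<in> {1..n}" "j \<in> {1..n}" "i \<noteq> j"
  shows "Y (current i j) (-1) (current i j) =
    (\<Sum>k\<in>{1..K}. \<Sum>l\<in>{1..K}. fer (k, i) (-1) (fer (k, j) (-1) (pair (l, i) (l, j))))
    - (\<Sum>k\<in>{1..K}. conf (k, i) + conf (k, j))"
proof -
  have "Y (current i j) (-1) (current i j) = (\<Sum>k\<in>{1..K}. Y (current i j) (-1) (pair (k, i) (k, j)))"
    by (simp add: current_def[of i j] Y_simps)
  also have "\<dots> = (\<Sum>k\<in>{1..K}. fer (k, i) (-1) (fer (k, j) (-1) (current i j)) - (conf (k, i) + conf (k, j)))"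
    using assms by (intro sum.cong refl) (simp add: current_mode_fer creation fer_simps conf_flip)
  also have "\<dots> = (\<Sum>k\<in>{1..K}. \<Sum>l\<in>{1..K}. fer (k, i) (-1) (fer (k, j) (-1) (pair (l, i) (l, j))))
    - (\<Sum>k\<in>{1..K}. conf (k, i) + conf (k, j))"
    unfolding sum_subtractf using assms
    by (intro arg_cong2[where f = minus] sum.cong refl) (simp add: current_def fer_simps)
  finally show ?thesis .
qed

lemma diag_current_product:
  assumes "k \<in> {1..K}" "l \<in> {1..K}" "k \<noteq> l"
  shows "Y (diag_current k l) (-1) (diag_current k l) =
    (\<Sum>i\<in>{1..n}. \<Sum>j\<in>{1..n}. fer (k, i) (-1) (fer (l, i) (-1) (pair (k, j) (l, j))))
    - (\<Sum>i\<in>{1..n}. conf (k, i) + conf (l, i))"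
proof -
  have "Y (diag_current k l) (-1) (diag_current k l) = (\<Sum>i\<in>{1..n}. Y (diag_current k l) (-1) (pair (k, i) (l, i)))"
    by (simp add: diag_current_def[of k l] Y_simps)
  also have "\<dots> = (\<Sum>i\<in>{1..n}. fer (k, i) (-1) (fer (l, i) (-1) (diag_current k l)) - (conf (k, i) + conf (l, i)))"
    using assms by (intro sum.cong refl) (simp add: diag_current_mode_fer creation fer_simps conf_flip)
  also have "\<dots> = (\<Sum>i\<in>{1..n}. \<Sum>j\<in>{1..n}. fer (k, i) (-1) (fer (l, i) (-1) (pair (k, j) (l, j))))
    - (\<Sum>i\<in>{1..n}. conf (k, i) + conf (l, i))"
    unfolding sum_subtractf using assms
    by (intro arg_cong2[where f = minus] sum.cong refl) (simp add: diag_current_def fer_simps)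
  finally show ?thesis .
qed

lemma fer_pair_zero: "a \<in> Lab \<Longrightarrow> pair a a = 0"
  by (rule fer_square) simp_all

lemma current_diagonal: "i \<in> {1..n} \<Longrightarrow> current i i = 0"
  by (simp add: current_def fer_pair_zero)

lemma diag_current_diagonal: "k \<in> {1..K} \<Longrightarrow> diag_current k k = 0"
  by (simp add: diag_current_def fer_pair_zero)

lemma sum_off_diagonal:
  fixes f :: "nat \<Rightarrow> 'a"
  assumes "N \<ge> 1"
  shows "(\<Sum>i\<in>{1..N}. \<Sum>j\<in>{1..N}. if i = j then 0 else f i + f j) = sc (2 * of_nat (N - 1)) (\<Sum>i\<in>{1..N}. f i)"
proof -
  have "(\<Sum>i\<in>{1..N}. \<Sum>j\<in>{1..N}. if i = j then 0 else f i + f j) =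
      (\<Sum>i\<in>{1..N}. \<Sum>j\<in>{1..N}. (f i + f j) - (if i = j then f j + f j else 0))"
    by (intro sum.cong refl) auto
  also have "\<dots> = (\<Sum>i\<in>{1..N}. \<Sum>j\<in>{1..N}. f i) + (\<Sum>i\<in>{1..N}. \<Sum>j\<in>{1..N}. f j) - (\<Sum>i\<in>{1..N}. f i + f i)"
    by (simp add: sum_subtractf sum.distrib sum.delta)
  also have "(\<Sum>i\<in>{1..N}. \<Sum>j\<in>{1..N}. f i) = sc (of_nat N) (\<Sum>i\<in>{1..N}. f i)"
    by (simp add: sum_constant_scale scale_sum_right)
  also have "(\<Sum>i\<in>{1..N}. \<Sum>j\<in>{1..N}. f j) = sc (of_nat N) (\<Sum>i\<in>{1..N}. f i)"
    by (simp add: sum_constant_scale)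
  also have "sc (of_nat N) x + sc (of_nat N) x - (\<Sum>i\<in>{1..N}. f i + f i) = sc (2 * of_nat (N - 1)) x"
    if "x = (\<Sum>i\<in>{1..N}. f i)" for x
  proof -
    have "sc (2 * of_nat (N - 1)) x = sc (of_nat N + of_nat N - 1 - 1) x"
      using assms by (simp add: of_nat_diff)
    also have "\<dots> = sc (of_nat N) x + sc (of_nat N) x - x - x"
      by (simp only: scale_left_distrib scale_left_diff_distrib scale_one)
    finally show ?thesis by (simp add: that sum.distrib)
  qed
  finally show ?thesis by simp
qed

lemma sum_swap_pairs:
  "(\<Sum>k\<in>A. \<Sum>l\<in>B. \<Sum>i\<in>C. \<Sum>j\<in>D. f i j k l) = (\<Sum>i\<in>C. \<Sum>j\<in>D. \<Sum>k\<in>A. \<Sum>l\<in>B. f i j k l)"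
proof -
  have "(\<Sum>k\<in>A. \<Sum>l\<in>B. \<Sum>i\<in>C. \<Sum>j\<in>D. f i j k l) = (\<Sum>k\<in>A. \<Sum>i\<in>C. \<Sum>l\<in>B. \<Sum>j\<in>D. f i j k l)"
    by (intro sum.cong refl) (rule sum.swap)
  also have "\<dots> = (\<Sum>i\<in>C. \<Sum>k\<in>A. \<Sum>l\<in>B. \<Sum>j\<in>D. f i j k l)" by (rule sum.swap)
  also have "\<dots> = (\<Sum>i\<in>C. \<Sum>k\<in>A. \<Sum>j\<in>D. \<Sum>l\<in>B. f i j k l)"
    by (intro sum.cong refl) (rule sum.swap)
  also have "\<dots> = (\<Sum>i\<in>C. \<Sum>j\<in>D. \<Sum>k\<in>A. \<Sum>l\<in>B. f i j k l)"
    by (intro sum.cong refl) (rule sum.swap)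
  finally show ?thesis .
qed

text \<open>Both families of currents produce the same quartic states. Reordering
  \<open>\<psi>\<^sub>k\<^sub>i \<psi>\<^sub>k\<^sub>j \<psi>\<^sub>l\<^sub>i \<psi>\<^sub>l\<^sub>j\<close> into \<open>\<psi>\<^sub>k\<^sub>i \<psi>\<^sub>l\<^sub>i \<psi>\<^sub>k\<^sub>j \<psi>\<^sub>l\<^sub>j\<close> costs a sign, hence they cancel and only
  the contractions remain.\<close>

lemma sugawara_state:
  assumes "K \<ge> 1" "n \<ge> 1"
  shows "(\<Sum>i\<in>{1..n}. \<Sum>j\<in>{1..n}. Y (current i j) (-1) (current i j))
     + (\<Sum>k\<in>{1..K}. \<Sum>l\<in>{1..K}. Y (diag_current k l) (-1) (diag_current k l))
     = sc (- 2 * of_nat (n + K - 2)) (\<Sum>a\<in>Lab. conf a)"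
proof -
  let ?Q = "\<lambda>i j k l. fer (k, i) (-1) (fer (k, j) (-1) (pair (l, i) (l, j)))"
  let ?R = "\<lambda>k l i j. fer (k, i) (-1) (fer (l, i) (-1) (pair (k, j) (l, j)))"
  define C where "C = (\<Sum>a\<in>Lab. conf a)"
  have C2: "(\<Sum>k\<in>{1..K}. \<Sum>i\<in>{1..n}. conf (k, i)) = C"
    unfolding C_def Lab_def by (simp add: sum.cartesian_product case_prod_unfold)
  have C1: "(\<Sum>i\<in>{1..n}. \<Sum>k\<in>{1..K}. conf (k, i)) = C"
    unfolding C2[symmetric] by (rule sum.swap)
  note C = C1 C2
  have Q0: "?Q i i k l = 0" if "i \<in> {1..n}" "k \<in> {1..K}" "l \<in> {1..K}" for i k l
    using that by (simp add: fer_pair_zero fer_simps)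
  have R0: "?R k k i j = 0" if "i \<in> {1..n}" "j \<in> {1..n}" "k \<in> {1..K}" for k i j
    using that by (simp add: fer_pair_zero fer_simps)
  have RQ: "?R k l i j = - ?Q i j k l" if "i \<in> {1..n}" "j \<in> {1..n}" "k \<in> {1..K}" "l \<in> {1..K}" for i j k l
    using that fer_creation_anticommute[of "(l, i)" "(k, j)" "-1" "-1" "fermion (l, j)"]
    by (simp add: fer_simps)
  have "(\<Sum>i\<in>{1..n}. \<Sum>j\<in>{1..n}. Y (current i j) (-1) (current i j)) =
    (\<Sum>i\<in>{1..n}. \<Sum>j\<in>{1..n}. (\<Sum>k\<in>{1..K}. \<Sum>l\<in>{1..K}. ?Q i j k l)
      - (if i = j then 0 else (\<Sum>k\<in>{1..K}. conf (k, i)) + (\<Sum>k\<in>{1..K}. conf (k, j))))"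
    by (intro sum.cong refl) (auto simp: current_product current_diagonal Q0 Y_simps sum.distrib)
  also have "\<dots> = (\<Sum>i\<in>{1..n}. \<Sum>j\<in>{1..n}. \<Sum>k\<in>{1..K}. \<Sum>l\<in>{1..K}. ?Q i j k l) - sc (2 * of_nat (n - 1)) C"
    using assms by (simp only: sum_subtractf sum_off_diagonal C)
  finally have 1: "(\<Sum>i\<in>{1..n}. \<Sum>j\<in>{1..n}. Y (current i j) (-1) (current i j)) =
    (\<Sum>i\<in>{1..n}. \<Sum>j\<in>{1..n}. \<Sum>k\<in>{1..K}. \<Sum>l\<in>{1..K}. ?Q i j k l) - sc (2 * of_nat (n - 1)) C" .
  have "(\<Sum>k\<in>{1..K}. \<Sum>l\<in>{1..K}. Y (diag_current k l) (-1) (diag_current k l)) =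
    (\<Sum>k\<in>{1..K}. \<Sum>l\<in>{1..K}. (\<Sum>i\<in>{1..n}. \<Sum>j\<in>{1..n}. ?R k l i j)
      - (if k = l then 0 else (\<Sum>i\<in>{1..n}. conf (k, i)) + (\<Sum>i\<in>{1..n}. conf (l, i))))"
    by (intro sum.cong refl) (auto simp: diag_current_product diag_current_diagonal R0 Y_simps sum.distrib)
  also have "\<dots> = (\<Sum>k\<in>{1..K}. \<Sum>l\<in>{1..K}. \<Sum>i\<in>{1..n}. \<Sum>j\<in>{1..n}. ?R k l i j) - sc (2 * of_nat (K - 1)) C"
    using assms by (simp only: sum_subtractf sum_off_diagonal C)
  also have "(\<Sum>k\<in>{1..K}. \<Sum>l\<in>{1..K}. \<Sum>i\<in>{1..n}. \<Sum>j\<in>{1..n}. ?R k l i j) =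
     - (\<Sum>k\<in>{1..K}. \<Sum>l\<in>{1..K}. \<Sum>i\<in>{1..n}. \<Sum>j\<in>{1..n}. ?Q i j k l)"
    unfolding sum_negf[symmetric] by (intro sum.cong refl RQ)
  also have "(\<Sum>k\<in>{1..K}. \<Sum>l\<in>{1..K}. \<Sum>i\<in>{1..n}. \<Sum>j\<in>{1..n}. ?Q i j k l) =
     (\<Sum>i\<in>{1..n}. \<Sum>j\<in>{1..n}. \<Sum>k\<in>{1..K}. \<Sum>l\<in>{1..K}. ?Q i j k l)"
    by (rule sum_swap_pairs)
  finally have 2: "(\<Sum>k\<in>{1..K}. \<Sum>l\<in>{1..K}. Y (diag_current k l) (-1) (diag_current k l)) =
    - (\<Sum>i\<in>{1..n}. \<Sum>j\<in>{1..n}. \<Sum>k\<in>{1..K}. \<Sum>l\<in>{1..K}. ?Q i j k l) - sc (2 * of_nat (K - 1)) C" .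
  have coeff: "- 2 * of_nat (n + K - 2) = - (2 * of_nat (n - 1)) - (2 * of_nat (K - 1) :: complex)"
    using assms by (simp add: of_nat_diff algebra_simps)
  show ?thesis unfolding 1 2 C_def[symmetric] coeff
    by (simp only: scale_left_diff_distrib scale_minus_left) simp
qed

lemma sugawara_operator:
  assumes "K \<ge> 1" "n \<ge> 1"
  shows "(\<Sum>i\<in>{1..n}. \<Sum>j\<in>{1..n}. Y (Y (current i j) (-1) (current i j)) 1 v)
     + (\<Sum>k\<in>{1..K}. \<Sum>l\<in>{1..K}. Y (Y (diag_current k l) (-1) (diag_current k l)) 1 v)
     = sc (- 2 * of_nat (n + K - 2)) (energy_op v)"
  using arg_cong[OF sugawara_state[OF assms], of "\<lambda>u. Y u 1 v"]
  by (simp only: Y_left_simps energy_op_def)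

subsection \<open>Currents shift the energy\<close>

text \<open>The state \<open>pair a b\<close> is primary of weight one. The factor 2 is the normalization of the sum of
  the \<open>conf d\<close>, which is twice the conformal vector.\<close>

lemma pair_on_conformal_state:
  assumes ab: "a \<in> Lab" "b \<in> Lab" and s: "s \<ge> 0"
  shows "Y (pair a b) s (\<Sum>d\<in>Lab. conf d) = (if s = 1 then sc 2 (pair a b) else 0)"
proof -
  have "Y (pair a b) s (\<Sum>d\<in>Lab. conf d) = (\<Sum>d\<in>Lab. Y (pair a b) s (conf d))"
    by (simp add: Y_simps)
  also have "\<dots> = (\<Sum>d\<in>Lab.
      (if d = b then fer d (-2) (fer a (s - 1) vac) else 0) - (if d = a then fer d (-2) (fer b (s - 1) vac) else 0)
      + (if d = b then fer a (s - 2) (fermion d) else 0) - (if d = a then fer b (s - 2) (fermion d) else 0))"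
    using ab s by (intro sum.cong refl) (simp add: pair_mode_fer creation fer_simps)
  also have "\<dots> = fer b (-2) (fer a (s - 1) vac) - fer a (-2) (fer b (s - 1) vac)
      + fer a (s - 2) (fermion b) - fer b (s - 2) (fermion a)"
    using ab by (simp add: sum.distrib sum_subtractf sum.delta)
  also have "\<dots> = (if s = 1 then sc 2 (pair a b) else 0)"
  proof -
    consider "s = 0" | "s = 1" | "s \<ge> 2" using s by linarith
    then show ?thesis
    proof cases
      case 2
      then have "fer b (-2) (fer a (s - 1) vac) - fer a (-2) (fer b (s - 1) vac)
          + fer a (s - 2) (fermion b) - fer b (s - 2) (fermion a) = pair a b + pair a b"
        using ab pair_swap[OF ab] by (simp add: fer_vac fer_simps)
      then show ?thesis using 2 scale_left_distrib[of 1 1 "pair a b"] by simp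
    qed (use ab in \<open>auto simp: fer_vac fer_fermion fer_simps\<close>)
  qed
  finally show ?thesis .
qed

lemma energy_op_pair:
  assumes ab: "a \<in> Lab" "b \<in> Lab"
  shows "energy_op (Y (pair a b) s v) = Y (pair a b) s (energy_op v) - sc (of_int (2 * s)) (Y (pair a b) s v)"
proof -
  let ?C = "\<Sum>d\<in>Lab. conf d"
  have C: "energy_op w = Y ?C 1 w" for w by (simp add: energy_op_def Y_left_simps)
  have CV: "?C \<in> V0" by (intro subspace_sum[OF subspace_V0] pair_even)
  have "Y (pair a b) s (Y ?C 1 v) - sc (koszul (pair a b) ?C) (Y ?C 1 (Y (pair a b) s v)) =
    Y (Y (pair a b) 0 ?C) (s + 1) v + sc (of_int s) (Y (Y (pair a b) 1 ?C) (s + 1 - 1) v)"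
    by (rule commutator_two_terms) (use ab CV in \<open>auto simp: pair_even pair_on_conformal_state\<close>)
  then have "Y (pair a b) s (energy_op v) - energy_op (Y (pair a b) s v) = sc (of_int s) (sc 2 (Y (pair a b) s v))"
    using ab by (simp only: C koszul_even_right[OF CV])
      (simp add: pair_on_conformal_state Y_left_simps)
  then show ?thesis by (simp add: algebra_simps)
qed

lemma energy_op_current:
  assumes "i \<in> {1..n}" "j \<in> {1..n}"
  shows "energy_op (Y (current i j) s v) = Y (current i j) s (energy_op v) - sc (of_int (2 * s)) (Y (current i j) s v)"
  unfolding current_def Y_left_simps lin_sum[OF lin_energy_op] scale_sum_right sum_subtractf[symmetric]
  using assms by (intro sum.cong refl energy_op_pair) auto

lemma energy_op_diag_current:
  assumes "k \<in> {1..K}" "l \<in> {1..K}"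
  shows "energy_op (Y (diag_current k l) s v) =
    Y (diag_current k l) s (energy_op v) - sc (of_int (2 * s)) (Y (diag_current k l) s v)"
  unfolding diag_current_def Y_left_simps lin_sum[OF lin_energy_op] scale_sum_right sum_subtractf[symmetric]
  using assms by (intro sum.cong refl energy_op_pair) auto

sublocale so: so_action sc "\<lambda>i j. Y (current i j) 0" n
proof (rule so_action.intro[OF complex_vector_space_axioms], rule so_action_axioms.intro, goal_cases)
  case (1 i j)
  show ?case by (rule lin_Y)
next
  case (2 i j v)
  then show ?case
    by (subst current_skew) (simp_all add: Y_left_simps)
next
  case (3 i j l r v)
  note ij = 3(1,2) and lr = 3(3,4)
  have "Y (current i j) 0 (Y (current l r) 0 v) - Y (current l r) 0 (Y (current i j) 0 v) =
      Y (Y (current i j) 0 (current l r)) 0 v"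
    using zero_mode_commutator[of "current i j" "current l r" 0 v] ij lr
    by (simp add: current_even koszul_even_right)
  then show ?case
    using ij lr by (simp add: current_zero_mode_current Y_left_simps if_distrib[of "\<lambda>u. Y u 0 v"])
qed

end

section \<open>Weights of adapted words\<close>

lemma square_sum_le:
  fixes c :: "'b \<Rightarrow> int"
  assumes "finite A"
  shows "(\<Sum>k\<in>A. c k)\<^sup>2 \<le> int (card A) * (\<Sum>k\<in>A. (c k)\<^sup>2)"
  using assms
proof (induction A rule: finite_induct)
  case (insert x A)
  have "2 * c x * (\<Sum>k\<in>A. c k) = (\<Sum>k\<in>A. 2 * c x * c k)" by (simp add: sum_distrib_left)
  also have "\<dots> \<le> (\<Sum>k\<in>A. (c x)\<^sup>2 + (c k)\<^sup>2)" 
  proof (rule sum_mono)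
    show "2 * c x * c k \<le> (c x)\<^sup>2 + (c k)\<^sup>2" for k
      using zero_le_power2[of "c x - c k"] by (simp add: power2_diff)
  qed
  also have "\<dots> = int (card A) * (c x)\<^sup>2 + (\<Sum>k\<in>A. (c k)\<^sup>2)" by (simp add: sum.distrib)
  finally have "(c x + (\<Sum>k\<in>A. c k))\<^sup>2 \<le>
      (c x)\<^sup>2 + (int (card A) * (c x)\<^sup>2 + (\<Sum>k\<in>A. (c k)\<^sup>2)) + int (card A) * (\<Sum>k\<in>A. (c k)\<^sup>2)"
    using insert.IH by (simp add: power2_sum)
  also have "\<dots> = int (card (insert x A)) * (\<Sum>k\<in>insert x A. (c k)\<^sup>2)"
    using insert.hyps by (simp add: algebra_simps)
  finally show ?case using insert.hyps by simp
qed simp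

lemma card_square_le_sum_odd:
  assumes "finite T"
  shows "(card T)\<^sup>2 \<le> (\<Sum>s\<in>T. 2 * s + 1)"
  using assms
proof (induction T rule: finite_linorder_max_induct)
  case (insert m T)
  have "T \<subseteq> {..<m}" using insert.hyps by auto
  then have "card T \<le> m" using card_mono[of "{..<m}" T] by simp
  then show ?case using insert by (auto simp: power2_eq_square)
qed simp

text \<open>The eigenvalue of \<open>- \<i> X\<^sub>2\<^sub>b\<^sub>-\<^sub>1\<^sub>,\<^sub>2\<^sub>b\<close> on an adapted fermion of column \<open>c\<close>. The form \<open>c + 1 = 2 * b\<close> avoids
  truncated subtraction at \<open>b = 0\<close>.\<close>
definition weight_of :: "nat \<Rightarrow> nat \<Rightarrow> int"
  where "weight_of b c = (if c + 1 = 2 * b then 1 else if c = 2 * b then -1 else 0)"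

definition weight :: "nat \<Rightarrow> ((nat \<times> nat) \<times> nat) list \<Rightarrow> int"
  where "weight b xs = (\<Sum>(a, s)\<leftarrow>xs. weight_of b (snd a))"

lemma weight_simps [simp]: "weight b [] = 0" "weight b ((a, s) # xs) = weight_of b (snd a) + weight b xs"
  by (simp_all add: weight_def)

lemma sum_abs_weight_of_le: "finite B \<Longrightarrow> (\<Sum>b\<in>B. \<bar>weight_of b c\<bar>) \<le> 1"
proof -
  assume B: "finite B"
  have "\<bar>weight_of b c\<bar> = (if b = (c + 1) div 2 then \<bar>weight_of b c\<bar> else 0)" for b
    by (auto simp: weight_of_def)
  then have "(\<Sum>b\<in>B. \<bar>weight_of b c\<bar>) = (\<Sum>b\<in>B. if b = (c + 1) div 2 then \<bar>weight_of b c\<bar> else 0)"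
    by (intro sum.cong refl)
  also have "\<dots> \<le> 1" using B by (simp add: sum.delta weight_of_def)
  finally show ?thesis .
qed

context fermion_vertex_superalgebra
begin

lemma sum_abs_weight_le: "finite B \<Longrightarrow> (\<Sum>b\<in>B. \<bar>weight b xs\<bar>) \<le> int (energy xs)"
proof (induction xs)
  case Nil
  then show ?case by simp
next
  case (Cons x xs)
  obtain a s where x: "x = (a, s)" by (cases x)
  have "(\<Sum>b\<in>B. \<bar>weight b (x # xs)\<bar>) \<le> (\<Sum>b\<in>B. \<bar>weight_of b (snd a)\<bar> + \<bar>weight b xs\<bar>)"
    by (intro sum_mono) (simp add: x)
  also have "\<dots> \<le> 1 + int (energy xs)"
    unfolding sum.distrib using Cons sum_abs_weight_of_le[OF Cons.prems, of "snd a"] by (simp add: add_mono)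
  finally show ?case by (simp add: x)
qed

lemma weight_column_count:
  assumes "xs \<in> letters"
  shows "1 \<le> b \<Longrightarrow> weight b xs = int (column_count (2 * b - 1) xs) - int (column_count (2 * b) xs)"
  using assms by (induction xs) (auto simp: weight_of_def)

text \<open>For each label, the creation operators in a nonzero word carry distinct modes, so that \<open>t\<close> of
  them have energy at least \<open>1 + 3 + \<dots> + (2 t - 1) = t\<^sup>2\<close>. The factor \<open>K\<close> comes from the
  Cauchy-Schwarz inequality over the \<open>K\<close> labels of a column.\<close>

lemma sum_square_weight_le:
  assumes xs: "xs \<in> letters" "distinct xs"
  shows "(\<Sum>b | 0 < 2 * b \<and> 2 * b \<le> n. (weight b xs)\<^sup>2) \<le> int K * int (energy xs)"
proof -
  define T where "T a = {s. (a, s) \<in> set xs}" for a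
  have fT: "finite (T a)" for a
    by (rule finite_subset[of _ "snd ` set xs"]) (auto simp: T_def intro: rev_image_eqI)
  have col: "int (column_count c xs) = (\<Sum>k\<in>{1..K}. int (card (T (k, c))))" for c
  proof -
    have "column_count c xs = card {x \<in> set xs. snd (fst x) = c}"
      unfolding column_count_def using xs(2) by (metis distinct_card distinct_filter set_filter)
    also have "{x \<in> set xs. snd (fst x) = c} = (\<Union>k\<in>{1..K}. (\<lambda>s. ((k, c), s)) ` T (k, c))"
      using xs(1) by (auto simp: T_def letters_def Lab_def image_iff)
    also have "card \<dots> = (\<Sum>k\<in>{1..K}. card ((\<lambda>s. ((k, c), s)) ` T (k, c)))"
      by (rule card_UN_disjoint) (auto simp: fT)
    also have "\<dots> = (\<Sum>k\<in>{1..K}. card (T (k, c)))"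
      by (intro sum.cong refl card_image) (auto simp: inj_on_def)
    finally show ?thesis by simp
  qed
  have energy: "int (energy xs) = (\<Sum>a\<in>Lab. \<Sum>s\<in>T a. 2 * int s + 1)"
  proof -
    have "energy xs = (\<Sum>(a, s)\<in>set xs. 2 * s + 1)"
      using xs(2) by (simp add: energy_def sum_list_distinct_conv_sum_set)
    also have "set xs = Sigma Lab T"
      using xs(1) by (auto simp: T_def letters_def)
    also have "(\<Sum>(a, s)\<in>Sigma Lab T. 2 * s + 1) = (\<Sum>a\<in>Lab. \<Sum>s\<in>T a. 2 * s + 1)"
      by (rule sum.Sigma[symmetric]) (auto simp: fT)
    finally show ?thesis by (simp only: of_nat_sum of_nat_add of_nat_mult of_nat_1 of_nat_numeral)
  qed
  let ?B = "{b. 0 < 2 * b \<and> 2 * b \<le> n}"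
  let ?c = "\<lambda>c. (int (column_count c xs))\<^sup>2"
  have fB: "finite ?B" by (rule finite_subset[of _ "{..n}"]) auto
  have "(\<Sum>b\<in>?B. (weight b xs)\<^sup>2) \<le> (\<Sum>b\<in>?B. ?c (2 * b - 1) + ?c (2 * b))"
  proof (rule sum_mono)
    fix b assume "b \<in> ?B"
    then have w: "weight b xs = int (column_count (2 * b - 1) xs) - int (column_count (2 * b) xs)"
      using weight_column_count[OF xs(1)] by auto
    have "(x - y)\<^sup>2 \<le> x\<^sup>2 + y\<^sup>2" if "x \<ge> 0" "y \<ge> 0" for x y :: int
      using that by (simp add: power2_diff)
    then show "(weight b xs)\<^sup>2 \<le> ?c (2 * b - 1) + ?c (2 * b)" unfolding w by simp
  qed
  also have "\<dots> = (\<Sum>c\<in>(\<lambda>b. 2 * b - 1) ` ?B. ?c c) + (\<Sum>c\<in>(\<lambda>b. 2 * b) ` ?B. ?c c)"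
    unfolding sum.distrib by (subst (1 2) sum.reindex) (auto simp: inj_on_def)
  also have "\<dots> = (\<Sum>c\<in>(\<lambda>b. 2 * b - 1) ` ?B \<union> (\<lambda>b. 2 * b) ` ?B. ?c c)"
    using fB by (intro sum.union_disjoint[symmetric]) (auto, presburger)
  also have "\<dots> \<le> (\<Sum>c\<in>{1..n}. ?c c)"
    by (rule sum_mono2) auto
  also have "\<dots> \<le> (\<Sum>c\<in>{1..n}. int K * (\<Sum>k\<in>{1..K}. (int (card (T (k, c))))\<^sup>2))"
    unfolding col using square_sum_le[of "{1..K}"] by (intro sum_mono) simp
  also have "\<dots> = int K * (\<Sum>c\<in>{1..n}. \<Sum>k\<in>{1..K}. (int (card (T (k, c))))\<^sup>2)"
    by (simp add: sum_distrib_left)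
  also have "(\<Sum>c\<in>{1..n}. \<Sum>k\<in>{1..K}. (int (card (T (k, c))))\<^sup>2) = (\<Sum>a\<in>Lab. (int (card (T a)))\<^sup>2)"
    unfolding Lab_def by (subst sum.swap) (simp add: sum.cartesian_product case_prod_unfold)
  also have "int K * \<dots> \<le> int K * (\<Sum>a\<in>Lab. \<Sum>s\<in>T a. 2 * int s + 1)"
  proof (intro mult_left_mono sum_mono)
    fix a
    have "int ((card (T a))\<^sup>2) \<le> int (\<Sum>s\<in>T a. 2 * s + 1)"
      using card_square_le_sum_odd[OF fT[of a]] by (simp only: of_nat_le_iff)
    then show "(int (card (T a)))\<^sup>2 \<le> (\<Sum>s\<in>T a. 2 * int s + 1)"
      by (simp only: of_nat_sum of_nat_add of_nat_mult of_nat_1 of_nat_numeral of_nat_power)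
  qed simp
  finally show ?thesis by (simp add: energy)
qed

text \<open>The combinations \<open>\<psi>\<^sub>k\<^sub>,\<^sub>2\<^sub>b\<^sub>-\<^sub>1 \<plusminus> \<i> \<psi>\<^sub>k\<^sub>,\<^sub>2\<^sub>b\<close>, on which the Cartan subalgebra of \<open>so\<^sub>n\<close> acts
  diagonally. They stand in place of \<open>\<psi>\<^sub>k\<^sub>,\<^sub>2\<^sub>b\<^sub>-\<^sub>1\<close> and \<open>\<psi>\<^sub>k\<^sub>,\<^sub>2\<^sub>b\<close>. For odd \<open>n\<close> the last column is
  kept.\<close>
definition chi :: "nat \<times> nat \<Rightarrow> int \<Rightarrow> 'a \<Rightarrow> 'a"
  where "chi a p v = (case a of (k, c) \<Rightarrow>
     if even c then fer (k, c - 1) p v + sc (- \<i>) (fer (k, c) p v)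
     else if c < n then fer (k, c) p v + sc \<i> (fer (k, c + 1) p v) else fer (k, c) p v)"

lemma chi_form:
  assumes "a \<in> Lab"
  obtains a1 a2 z where "a1 \<in> Lab" "a2 \<in> Lab" "\<And>p v. chi a p v = fer a1 p v + sc z (fer a2 p v)"
proof -
  obtain k c where a: "a = (k, c)" by (cases a)
  consider "even c" | "odd c" "c < n" | "odd c" "\<not> c < n" by auto
  then show thesis
  proof cases
    case 1
    then have "c \<noteq> 0" "c \<noteq> 1" using assms a by auto
    then show thesis using 1 assms a
      by (intro that[of "(k, c - 1)" "(k, c)" "- \<i>"]) (auto simp: chi_def)
  next
    case 2
    then show thesis using assms a
      by (intro that[of "(k, c)" "(k, c + 1)" "\<i>"]) (auto simp: chi_def)
  next
    case 3
    then show thesis using assms a by (intro that[of "(k, c)" "(k, c)" 0]) (auto simp: chi_def)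
  qed
qed

lemma lin_chi:
  assumes "a \<in> Lab"
  shows "lin (chi a p)"
proof -
  obtain a1 a2 z where a: "a1 \<in> Lab" "a2 \<in> Lab" and chi: "\<And>p v. chi a p v = fer a1 p v + sc z (fer a2 p v)"
    using chi_form[OF assms] by metis
  show ?thesis by (rule linI) (simp_all add: chi a fer_simps algebra_simps)
qed

lemma chi_in_subspace:
  assumes "a \<in> Lab" "subspace U" "\<And>b. b \<in> Lab \<Longrightarrow> fer b p v \<in> U"
  shows "chi a p v \<in> U"
proof -
  obtain a1 a2 z where a: "a1 \<in> Lab" "a2 \<in> Lab" and chi: "\<And>p v. chi a p v = fer a1 p v + sc z (fer a2 p v)"
    using chi_form[OF assms(1)] by metis
  show ?thesis unfolding chi
    by (intro subspace_add[OF assms(2)] subspace_scale[OF assms(2)] assms(3) a)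
qed

lemma fer_in_chi_span:
  assumes "a \<in> Lab"
  shows "fer a p v \<in> span {chi b p v |b. b \<in> Lab}"
proof -
  let ?S = "span {chi b p v |b. b \<in> Lab}"
  have chi: "chi b p v \<in> ?S" if "b \<in> Lab" for b using that by (intro span_base) blast
  obtain k c where a: "a = (k, c)" by (cases a)
  have two: "x + x = sc 2 x" for x :: 'a by (metis one_add_one scale_left_distrib scale_one)
  consider "even c" | "odd c" "c < n" | "odd c" "c = n" using assms a by force
  then show ?thesis
  proof cases
    case 1
    then have c: "c \<noteq> 0" "odd (c - 1)" "c - 1 < n" "(k, c - 1) \<in> Lab" "Suc (c - 1) = c" using assms a by auto
    have "chi (k, c - 1) p v - chi a p v = sc 2 (sc \<i> (fer a p v))"
      using 1 c a by (simp add: chi_def two)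
    then have "sc (- \<i> / 2) (chi (k, c - 1) p v - chi a p v) = fer a p v"
      by simp
    moreover have "sc (- \<i> / 2) (chi (k, c - 1) p v - chi a p v) \<in> ?S"
      by (intro span_scale span_diff chi c assms)
    ultimately show ?thesis by metis
  next
    case 2
    then have c: "even (c + 1)" "(k, c + 1) \<in> Lab" using assms a by auto
    have "chi (k, c + 1) p v + chi a p v = fer a p v + fer a p v"
      using 2 c a by (simp add: chi_def)
    then have "sc (1 / 2) (chi (k, c + 1) p v + chi a p v) = fer a p v"
      by (simp add: two)
    moreover have "sc (1 / 2) (chi (k, c + 1) p v + chi a p v) \<in> ?S"
      by (intro span_scale span_add chi c assms)
    ultimately show ?thesis by metis
  next
    case 3
    then show ?thesis using chi[OF assms] a by (simp add: chi_def)
  qed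
qed

lemma fer_chi_relation:
  assumes "a \<in> Lab" "b \<in> Lab"
  shows "\<exists>c. fer a p (chi b q v) + chi b q (fer a p v) = sc c v"
proof -
  define \<delta> where "\<delta> a b = (if a = b \<and> p + q = -1 then 1 else 0 :: complex)" for a b :: "nat \<times> nat"
  have fer: "fer a p (fer b q v) = sc (\<delta> a b) v - fer b q (fer a p v)" if "b \<in> Lab" for b
    using fer_anticommute[OF assms(1) that, of p q v] by (simp add: \<delta>_def)
  obtain b1 b2 z where b: "b1 \<in> Lab" "b2 \<in> Lab" and chi: "\<And>p v. chi b p v = fer b1 p v + sc z (fer b2 p v)"
    using chi_form[OF assms(2)] by metis
  have "fer a p (chi b q v) + chi b q (fer a p v) = sc (\<delta> a b1 + z * \<delta> a b2) v"
    by (simp add: chi fer_simps assms(1) fer[OF b(1)] fer[OF b(2)] algebra_simps)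
  then show ?thesis by blast
qed

lemma chi_creation_anticommute:
  assumes "a \<in> Lab" "b \<in> Lab" "p < 0" "q < 0"
  shows "chi a p (chi b q v) = - chi b q (chi a p v)"
proof -
  obtain a1 a2 y where a: "a1 \<in> Lab" "a2 \<in> Lab" and chi_a: "\<And>p v. chi a p v = fer a1 p v + sc y (fer a2 p v)"
    using chi_form[OF assms(1)] by metis
  obtain b1 b2 z where b: "b1 \<in> Lab" "b2 \<in> Lab" and chi_b: "\<And>p v. chi b p v = fer b1 p v + sc z (fer b2 p v)"
    using chi_form[OF assms(2)] by metis
  have anti: "fer d p (fer d' q w) = - fer d' q (fer d p w)" if "d \<in> Lab" "d' \<in> Lab" for d d' w
    by (rule fer_creation_anticommute) (use that assms in auto)
  note ba = anti[OF a(1) b(1)] anti[OF a(1) b(2)] anti[OF a(2) b(1)] anti[OF a(2) b(2)]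
  have "chi a p (chi b q v) = fer a1 p (fer b1 q v) + sc z (fer a1 p (fer b2 q v))
     + sc y (fer a2 p (fer b1 q v)) + sc (y * z) (fer a2 p (fer b2 q v))"
    by (simp add: chi_a chi_b fer_simps a b scale_right_distrib add.assoc)
  also have "\<dots> = - (fer b1 q (fer a1 p v) + sc z (fer b2 q (fer a1 p v))
     + sc y (fer b1 q (fer a2 p v)) + sc (y * z) (fer b2 q (fer a2 p v)))"
    unfolding ba by (simp add: algebra_simps)
  also have "\<dots> = - chi b q (chi a p v)"
    by (simp add: chi_a chi_b fer_simps a b scale_right_distrib algebra_simps)
  finally show ?thesis .
qed

lemma energy_op_chi:
  assumes "a \<in> Lab"
  shows "energy_op (chi a p v) = chi a p (energy_op v) - sc (of_int (2 * p + 1)) (chi a p v)"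
proof -
  obtain a1 a2 z where a: "a1 \<in> Lab" "a2 \<in> Lab" and chi: "\<And>p v. chi a p v = fer a1 p v + sc z (fer a2 p v)"
    using chi_form[OF assms] by metis
  define d where "d = (of_int (2 * p + 1) :: complex)"
  have fer: "energy_op (fer a p v) = fer a p (energy_op v) - sc d (fer a p v)" if "a \<in> Lab" for a
    unfolding d_def by (rule energy_op_fer[OF that])
  show ?thesis unfolding d_def[symmetric]
    by (simp add: chi lin_add[OF lin_energy_op] lin_scale[OF lin_energy_op] fer[OF a(1)] fer[OF a(2)]
        scale_right_distrib scale_right_diff_distrib algebra_simps)
qed

lemma cartan_chi:
  assumes a: "a \<in> Lab" and b: "0 < 2 * b" "2 * b \<le> n"
  shows "Y (current (2 * b - 1) (2 * b)) 0 (chi a p v) =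
    chi a p (Y (current (2 * b - 1) (2 * b)) 0 v) + sc (\<i> * of_int (weight_of b (snd a))) (chi a p v)"
proof -
  define X where "X = Y (current (2 * b - 1) (2 * b)) 0"
  have fer: "X (fer (k, l) p v) = fer (k, l) p (X v) - (if l + 1 = 2 * b then fer (k, 2 * b) p v else 0)
     + (if l = 2 * b then fer (k, 2 * b - 1) p v else 0)" if "(k, l) \<in> Lab" for k l
  proof -
    have "l = 2 * b - 1 \<longleftrightarrow> l + 1 = 2 * b" using b by auto
    then show ?thesis unfolding X_def using that b by (subst current_mode_fer) auto
  qed
  have X: "X (x + y) = X x + X y" "X (x - y) = X x - X y" "X (sc c x) = sc c (X x)" for x y c
    by (simp_all add: X_def Y_simps)
  have "X (chi a p v) = chi a p (X v) + sc (\<i> * of_int (weight_of b (snd a))) (chi a p v)"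
  proof -
    obtain k c where kc: "a = (k, c)" by (cases a)
    consider "even c" | "odd c" "c < n" | "odd c" "c = n" using a kc by force
    then show ?thesis
    proof cases
      case 1
      have c: "c \<ge> 2" using 1 a kc by auto
      have L: "(k, c - 1) \<in> Lab" "(k, c) \<in> Lab" using a kc c by auto
      have chi: "chi a p v = fer (k, c - 1) p v + sc (- \<i>) (fer (k, c) p v)" for v
        using 1 kc by (simp add: chi_def)
      have ne: "c + 1 \<noteq> 2 * b" "c - 1 \<noteq> 2 * b" using 1 c by presburger+
      show ?thesis
      proof (cases "c = 2 * b")
        case True
        then have c1: "c - 1 + 1 = 2 * b" using c by simp
        have "X (chi a p v) = chi a p (X v) + (- fer (k, 2 * b) p v + sc (- \<i>) (fer (k, 2 * b - 1) p v))"
          unfolding chi X fer[OF L(1)] fer[OF L(2)] using True c1 ne by (simp add: algebra_simps)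
        moreover have "weight_of b (snd a) = - 1" using ne True kc by (simp add: weight_of_def)
        moreover have "sc (\<i> * of_int (- 1)) (chi a p v) =
            - fer (k, 2 * b) p v + sc (- \<i>) (fer (k, 2 * b - 1) p v)"
          unfolding chi using True by (simp add: scale_right_diff_distrib)
        ultimately show ?thesis by (simp only:)
      next
        case False
        moreover have "c - 1 + 1 \<noteq> 2 * b" using False c by simp
        moreover have "weight_of b (snd a) = 0" using False ne kc by (simp add: weight_of_def)
        ultimately show ?thesis unfolding chi X fer[OF L(1)] fer[OF L(2)] using ne by simp
      qed
    next
      case 2
      have L: "(k, c) \<in> Lab" "(k, c + 1) \<in> Lab" using a kc 2 by auto
      have chi: "chi a p v = fer (k, c) p v + sc \<i> (fer (k, c + 1) p v)" for v
        using 2 kc by (simp add: chi_def)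
      have ne: "c \<noteq> 2 * b" "c + 1 + 1 \<noteq> 2 * b" using 2(1) by presburger+
      show ?thesis
      proof (cases "c + 1 = 2 * b")
        case True
        then have c: "2 * b - 1 = c" by simp
        have "X (chi a p v) = chi a p (X v) + (- fer (k, c + 1) p v + sc \<i> (fer (k, c) p v))"
          unfolding chi X fer[OF L(1)] fer[OF L(2)] using True c ne by (simp add: algebra_simps)
        moreover have "weight_of b (snd a) = 1" using ne True kc by (simp add: weight_of_def)
        ultimately show ?thesis by (simp add: chi scale_right_distrib)
      next
        case False
        moreover have "weight_of b (snd a) = 0" using False ne kc by (simp add: weight_of_def)
        ultimately show ?thesis unfolding chi X fer[OF L(1)] fer[OF L(2)] using ne by simp
      qed
    next
      case 3
      have L: "(k, c) \<in> Lab" using a kc by simp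
      have chi: "chi a p v = fer (k, c) p v" for v using 3 kc by (simp add: chi_def)
      have ne: "c \<noteq> 2 * b" "c + 1 \<noteq> 2 * b" using 3 b by auto
      moreover have "weight_of b (snd a) = 0" using ne kc by (simp add: weight_of_def)
      ultimately show ?thesis unfolding chi fer[OF L] by simp
    qed
  qed
  then show ?thesis by (simp add: X_def)
qed

lemma chi_words_span: "v \<in> span (word chi ` letters)"
  by (rule words_span[OF lin_chi fer_in_chi_span fer_chi_relation])

lemma chi_even_words_span: "v \<in> V0 \<Longrightarrow> v \<in> span (word chi ` {xs \<in> letters. even (length xs)})"
  by (rule even_words_span[OF chi_words_span])
    (auto intro: chi_in_subspace subspace_V0 subspace_V1 fer_V0 fer_V1)

lemma energy_op_chi_word: "xs \<in> letters \<Longrightarrow> energy_op (word chi xs) = sc (of_nat (energy xs)) (word chi xs)"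
  by (rule energy_op_word[OF lin_chi energy_op_chi])

lemma cartan_word:
  assumes "xs \<in> letters" "0 < 2 * b" "2 * b \<le> n"
  shows "Y (current (2 * b - 1) (2 * b)) 0 (word chi xs) = sc (\<i> * of_int (weight b xs)) (word chi xs)"
  using assms(1)
proof (induction xs)
  case Nil
  then show ?case by (simp add: creation)
next
  case (Cons x xs)
  obtain a s where x: "x = (a, s)" by (cases x)
  then have L: "a \<in> Lab" "xs \<in> letters" using Cons by auto
  then have "Y (current (2 * b - 1) (2 * b)) 0 (word chi (x # xs)) =
      sc (\<i> * of_int (weight b xs)) (word chi (x # xs)) + sc (\<i> * of_int (weight_of b (snd a))) (word chi (x # xs))"
    using Cons.IH assms by (simp only: x word_simps cartan_chi lin_scale[OF lin_chi])
  also have "\<dots> = sc (\<i> * of_int (weight b (x # xs))) (word chi (x # xs))"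
    by (simp add: x scale_left_distrib[symmetric] distrib_left add.commute)
  finally show ?case .
qed

lemma even_energy: "even (energy xs) \<longleftrightarrow> even (length xs)"
  by (induction xs) (auto simp: energy_def)

text \<open>Expand the vector into adapted words. These are simultaneous eigenvectors, so those with other
  eigenvalues drop out, and one that remains is nonzero.\<close>

lemma eigenvector_has_word:
  assumes v: "v \<in> V0" "v \<noteq> 0" and e: "energy_op v = sc (of_int e) v"
    and w: "\<And>b. 0 < 2 * b \<Longrightarrow> 2 * b \<le> n \<Longrightarrow> Y (current (2 * b - 1) (2 * b)) 0 v = sc (\<i> * of_int (\<mu> b)) v"
  shows "\<exists>xs\<in>letters. even (length xs) \<and> distinct xs \<and> int (energy xs) = e \<and>
    (\<forall>b. 0 < 2 * b \<and> 2 * b \<le> n \<longrightarrow> weight b xs = \<mu> b)"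
proof -
  define A where "A N = {xs \<in> letters. even (length xs) \<and> int (energy xs) = e \<and>
    (\<forall>b. 0 < 2 * b \<and> 2 * b \<le> N \<and> 2 * b \<le> n \<longrightarrow> weight b xs = \<mu> b)}" for N
  have "v \<in> span (word chi ` A N)" for N
  proof (induction N)
    case 0
    have "v \<in> span (word chi ` {xs \<in> {xs \<in> letters. even (length xs)}. of_nat (energy xs) = (of_int e :: complex)})"
      by (rule eigenvector_in_span[OF lin_energy_op _ chi_even_words_span[OF v(1)] e]) (simp add: energy_op_chi_word)
    moreover have "of_nat (energy xs) = (of_int e :: complex) \<longleftrightarrow> int (energy xs) = e" for xs
      by (metis of_int_eq_iff of_int_of_nat_eq)
    ultimately show ?case by (simp add: A_def conj_commute conj_left_commute)
  next
    case (Suc N)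
    show ?case
    proof (cases "even (Suc N) \<and> Suc N \<le> n")
      case False
      have "A (Suc N) = A N" unfolding A_def using False
        by (intro Collect_cong conj_cong refl) (auto simp: le_Suc_eq)
      then show ?thesis using Suc by simp
    next
      case True
      then obtain b where b: "Suc N = 2 * b" by (metis dvdE)
      have "v \<in> span (word chi ` {xs \<in> A N. \<i> * of_int (weight b xs) = \<i> * of_int (\<mu> b)})"
      proof (rule eigenvector_in_span[OF lin_Y _ Suc w])
        fix xs assume "xs \<in> A N"
        then show "Y (current (2 * b - 1) (2 * b)) 0 (word chi xs) = sc (\<i> * of_int (weight b xs)) (word chi xs)"
          using b True by (intro cartan_word) (auto simp: A_def)
      qed (use b True in auto)
      moreover have "{xs \<in> A N. \<i> * of_int (weight b xs) = \<i> * of_int (\<mu> b)} \<subseteq> A (Suc N)"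
      proof -
        have "2 * b' \<le> Suc N \<longleftrightarrow> b' = b \<or> 2 * b' \<le> N" for b' using b by auto
        then show ?thesis by (auto simp: A_def)
      qed
      ultimately show ?thesis using span_mono[OF image_mono] by blast
    qed
  qed
  then have "v \<in> span (word chi ` A n)" .
  have "\<exists>xs\<in>A n. word chi xs \<noteq> 0"
  proof (rule ccontr)
    assume "\<not> ?thesis"
    then have "word chi ` A n \<subseteq> {0}" by auto
    then have "span (word chi ` A n) \<subseteq> span {0}" by (rule span_mono)
    then show False using \<open>v \<in> span (word chi ` A n)\<close> v(2) by auto
  qed
  then obtain xs where xs: "xs \<in> A n" "word chi xs \<noteq> 0" by auto
  then have "distinct xs"
    by (intro nonzero_word_distinct[of chi] lin_chi chi_creation_anticommute) (auto simp: A_def)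
  then show ?thesis using xs by (intro bexI[of _ xs]) (auto simp: A_def)
qed

end

section \<open>The commutant of the diagonal subalgebra\<close>

text \<open>Because \<open>n - 2 b \<le> n - 2\<close>, the bounds 1 and 2 add up to at most the right hand side of 3, so that
  both are sharp. Equality in the weighted sum forces \<open>\<mu> b = 0\<close> for \<open>b \<ge> 2\<close>, whence \<open>e = \<bar>\<mu> 1\<bar>\<close> and \<open>e\<^sup>2 = K e\<close>.\<close>

lemma extremal_weight:
  fixes \<mu> :: "nat \<Rightarrow> int"
  assumes n: "n \<ge> 3" and e: "e \<ge> 1"
    and B: "B = {b. 0 < 2 * b \<and> 2 * b \<le> n}"
    and 1: "(\<Sum>b\<in>B. \<bar>\<mu> b\<bar>) \<le> e" and 2: "(\<Sum>b\<in>B. (\<mu> b)\<^sup>2) \<le> K * e"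
    and 3: "(\<Sum>b\<in>B. \<mu> b * (\<mu> b + int n - 2 * int b)) = (int n + K - 2) * e"
  shows "e = K"
proof -
  have fB: "finite B" unfolding B by (rule finite_subset[of _ "{..n}"]) auto
  define g where "g b = (int n - 2) * \<bar>\<mu> b\<bar> - (int n - 2 * int b) * \<mu> b" for b
  have g: "g b \<ge> (2 * int b - 2) * \<bar>\<mu> b\<bar>" if "b \<in> B" for b
  proof -
    have "(int n - 2 * int b) * \<mu> b \<le> (int n - 2 * int b) * \<bar>\<mu> b\<bar>"
      using that B by (intro mult_left_mono) auto
    then show ?thesis by (simp add: g_def algebra_simps)
  qed
  have g0: "g b \<ge> 0" if "b \<in> B" for b
  proof -
    have "0 \<le> (2 * int b - 2) * \<bar>\<mu> b\<bar>" using that B by auto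
    then show ?thesis using g[OF that] by linarith
  qed
  have "(\<Sum>b\<in>B. \<mu> b * (\<mu> b + int n - 2 * int b)) = (\<Sum>b\<in>B. (\<mu> b)\<^sup>2 + ((int n - 2) * \<bar>\<mu> b\<bar> - g b))"
    by (intro sum.cong refl) (simp add: g_def algebra_simps power2_eq_square)
  also have "\<dots> = (\<Sum>b\<in>B. (\<mu> b)\<^sup>2) + (int n - 2) * (\<Sum>b\<in>B. \<bar>\<mu> b\<bar>) - (\<Sum>b\<in>B. g b)"
    by (simp add: sum.distrib sum_subtractf sum_distrib_left)
  finally have eq: "(\<Sum>b\<in>B. (\<mu> b)\<^sup>2) + (int n - 2) * (\<Sum>b\<in>B. \<bar>\<mu> b\<bar>) - (\<Sum>b\<in>B. g b)
      = K * e + (int n - 2) * e" using 3 by (simp add: algebra_simps)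
  have gs: "(\<Sum>b\<in>B. g b) \<ge> 0" using g0 by (intro sum_nonneg) auto
  have le: "(int n - 2) * (\<Sum>b\<in>B. \<bar>\<mu> b\<bar>) \<le> (int n - 2) * e" using 1 n by (intro mult_left_mono) auto
  have sq: "(\<Sum>b\<in>B. (\<mu> b)\<^sup>2) = K * e" and "(int n - 2) * (\<Sum>b\<in>B. \<bar>\<mu> b\<bar>) = (int n - 2) * e"
    and g_sum: "(\<Sum>b\<in>B. g b) = 0"
    using eq gs le 2 by linarith+
  then have abs: "(\<Sum>b\<in>B. \<bar>\<mu> b\<bar>) = e" using n by simp
  have zero: "\<mu> b = 0" if b: "b \<in> B" "b \<noteq> 1" for b
  proof -
    have "g b = 0" using g_sum sum_nonneg_eq_0_iff[OF fB] g0 b by auto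
    then have "(2 * int b - 2) * \<bar>\<mu> b\<bar> \<le> 0" using g[OF b(1)] by simp
    moreover have "2 * int b - 2 > 0" using b B by auto
    ultimately show ?thesis by (simp add: mult_le_0_iff)
  qed
  have "1 \<in> B" using n B by auto
  then have "(\<Sum>b\<in>B. \<bar>\<mu> b\<bar>) = \<bar>\<mu> 1\<bar>" "(\<Sum>b\<in>B. (\<mu> b)\<^sup>2) = (\<mu> 1)\<^sup>2"
    using sum.remove[OF fB, of 1 "\<lambda>b. \<bar>\<mu> b\<bar>"] sum.remove[OF fB, of 1 "\<lambda>b. (\<mu> b)\<^sup>2"] zero by simp_all
  then have "e\<^sup>2 = K * e" using abs sq by (metis power2_abs)
  then show ?thesis using e by (simp add: power2_eq_square)
qed

context fermion_vertex_superalgebra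
begin

abbreviation "dual \<equiv> L_so_dual sc vac Y psi K n"

abbreviation "diag \<equiv> L_so_diag sc vac Y psi K n"

text \<open>The commutant of the diagonal subalgebra in \<open>V0\<close>, tested on generators only.\<close>
definition diag_commutant :: "'a set"
  where "diag_commutant = {v \<in> V0. \<forall>u\<in>{diag_current k l |k l. k \<in> {1..K} \<and> l \<in> {1..K}}. \<forall>p\<ge>0. Y u p v = 0}"

lemma dual_generated: "dual = generated_subalgebra sc vac Y {current i j |i j. i \<in> {1..n} \<and> j \<in> {1..n}}"
  by (simp add: L_so_dual_def bilin_pair current_def)

lemma diag_generated: "diag = generated_subalgebra sc vac Y {diag_current k l |k l. k \<in> {1..K} \<and> l \<in> {1..K}}"
  by (simp add: L_so_diag_def bilin_pair diag_current_def)

lemma dual_subalgebra: "vertex_subalgebra sc vac Y dual"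
  by (simp add: dual_generated vertex_subalgebra_generated)

lemma current_in_dual: "i \<in> {1..n} \<Longrightarrow> j \<in> {1..n} \<Longrightarrow> current i j \<in> dual"
  unfolding dual_generated by (rule subsetD[OF generators_in_generated]) blast

lemma diag_commutant_subalgebra: "vertex_subalgebra sc vac Y diag_commutant"
  unfolding diag_commutant_def
  by (rule vertex_subalgebra_right_annihilators) (use diag_current_even in auto)

lemma diag_commutant_V0: "v \<in> diag_commutant \<Longrightarrow> v \<in> V0"
  by (simp add: diag_commutant_def)

lemma diag_commutantD:
  "v \<in> diag_commutant \<Longrightarrow> k \<in> {1..K} \<Longrightarrow> l \<in> {1..K} \<Longrightarrow> p \<ge> 0 \<Longrightarrow> Y (diag_current k l) p v = 0"
  unfolding diag_commutant_def by blast

lemma diag_commutantI: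
  "v \<in> V0 \<Longrightarrow> (\<And>k l p. k \<in> {1..K} \<Longrightarrow> l \<in> {1..K} \<Longrightarrow> p \<ge> 0 \<Longrightarrow> Y (diag_current k l) p v = 0)
    \<Longrightarrow> v \<in> diag_commutant"
  unfolding diag_commutant_def by blast

lemma current_in_diag_commutant: "i \<in> {1..n} \<Longrightarrow> j \<in> {1..n} \<Longrightarrow> current i j \<in> diag_commutant"
  by (intro diag_commutantI current_even diag_current_current)

lemma dual_subset_diag_commutant: "dual \<subseteq> diag_commutant"
  unfolding dual_generated
  by (rule generated_subalgebra_least[OF diag_commutant_subalgebra]) (use current_in_diag_commutant in blast)

lemma commutant_diag_eq:
  assumes "U \<subseteq> V0"
  shows "commutant Y U diag = U \<inter> diag_commutant"
proof
  show "commutant Y U diag \<subseteq> U \<inter> diag_commutant"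
  proof
    fix v assume v: "v \<in> commutant Y U diag"
    have "diag_current k l \<in> diag" if "k \<in> {1..K}" "l \<in> {1..K}" for k l
      unfolding diag_generated by (rule subsetD[OF generators_in_generated]) (use that in blast)
    then show "v \<in> U \<inter> diag_commutant"
      using v assms by (auto simp: commutant_def intro!: diag_commutantI)
  qed
  show "U \<inter> diag_commutant \<subseteq> commutant Y U diag"
  proof
    fix v assume v: "v \<in> U \<inter> diag_commutant"
    have "diag \<subseteq> {u \<in> V0. \<forall>p\<ge>0. Y u p v = 0}"
      unfolding diag_generated
      by (rule generated_subalgebra_least[OF vertex_subalgebra_left_annihilators])
        (use v diag_commutantD[of v] diag_current_even in blast)
    then show "v \<in> commutant Y U diag" using v by (auto simp: commutant_def)
  qed
qed

lemma energy_eigenvector_span: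
  assumes "energy_op v = sc (of_int e) v"
  shows "v \<in> span (word chi ` {xs \<in> letters. int (energy xs) = e})"
proof -
  have "v \<in> span (word chi ` {xs \<in> letters. of_nat (energy xs) = (of_int e :: complex)})"
    by (rule eigenvector_in_span[OF lin_energy_op energy_op_chi_word chi_words_span assms])
  moreover have "of_nat (energy xs) = (of_int e :: complex) \<longleftrightarrow> int (energy xs) = e" for xs
    by (metis of_int_eq_iff of_int_of_nat_eq)
  ultimately show ?thesis by simp
qed

lemma negative_energy_zero:
  assumes "energy_op v = sc (of_int e) v" "e < 0"
  shows "v = 0"
proof -
  have "{xs \<in> letters. int (energy xs) = e} = {}" using assms(2) by auto
  then have "v \<in> span (word chi ` {})" using energy_eigenvector_span[OF assms(1)] by (simp only:)
  then show ?thesis by simp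
qed

lemma casimir_energy_op: "energy_op (so.casimir v) = so.casimir (energy_op v)"
  unfolding so.casimir_def lin_sum[OF lin_energy_op]
  by (intro sum.cong refl) (simp add: energy_op_current)

text \<open>The eigenvectors in question form a module for \<open>so\<^sub>n\<close>. The weight of a highest weight vector in it is
  the weight of an even word of energy \<open>e\<close>, and \<open>extremal_weight\<close> makes \<open>e\<close> equal to the odd number \<open>K\<close>.\<close>

lemma casimir_extremal_zero:
  assumes n: "n \<ge> 3" and K: "odd K" and e: "e \<ge> 1"
    and u: "u \<in> V0" "energy_op u = sc (of_nat e) u"
      "so.casimir u = sc (- 2 * of_nat (n + K - 2) * of_nat e) u"
  shows "u = 0"
proof (rule ccontr)
  assume "u \<noteq> 0"
  define C :: complex where "C = - 2 * of_nat (n + K - 2) * of_nat e"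
  define Z where "Z = {u \<in> V0. energy_op u = sc (of_nat e) u \<and> so.casimir u = sc C u}"
  have Z: "subspace Z"
    using subspace_V0 unfolding Z_def subspace_def
    by (auto simp: lin_zero[OF lin_energy_op] lin_add[OF lin_energy_op] lin_scale[OF lin_energy_op]
        lin_zero[OF so.lin_casimir] lin_add[OF so.lin_casimir] lin_scale[OF so.lin_casimir]
        scale_right_distrib mult.commute)
  have "Z \<noteq> {0}" using u \<open>u \<noteq> 0\<close> by (auto simp: Z_def C_def)
  have inv: "Y (current i j) 0 v \<in> Z" if "i \<in> {0<..n}" "j \<in> {0<..n}" "v \<in> Z" for i j v
  proof -
    have ij: "i \<in> {1..n}" "j \<in> {1..n}" using that by auto
    then show ?thesis using that(3)
      by (simp add: Z_def even_even current_even energy_op_current Y_simps so.casimir_commute)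
  qed
  have eig: "Z \<subseteq> span (eigenvectors (Y (current (2 * b - 1) (2 * b)) 0) ((\<lambda>k. \<i> * of_int k) ` {- int e..int e}))"
    if b: "0 < 2 * b" "2 * b \<le> n" for b
  proof
    fix v assume "v \<in> Z"
    then have "v \<in> span (word chi ` {xs \<in> letters. int (energy xs) = int e})"
      by (intro energy_eigenvector_span) (simp add: Z_def)
    moreover have "word chi xs \<in> eigenvectors (Y (current (2 * b - 1) (2 * b)) 0) ((\<lambda>k. \<i> * of_int k) ` {- int e..int e})"
      if "xs \<in> letters" "int (energy xs) = int e" for xs
    proof -
      have "\<bar>weight b xs\<bar> \<le> int e" using sum_abs_weight_le[of "{b}" xs] that by simp
      then have "weight b xs \<in> {- int e..int e}" by auto
      then show ?thesis
        using cartan_word[OF that(1) b] unfolding eigenvectors_def by blast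
    qed
    ultimately show "v \<in> span (eigenvectors (Y (current (2 * b - 1) (2 * b)) 0) ((\<lambda>k. \<i> * of_int k) ` {- int e..int e}))"
      using span_mono[of "word chi ` {xs \<in> letters. int (energy xs) = int e}"] by blast
  qed
  obtain v \<mu> where v: "v \<in> Z" "v \<noteq> 0"
    and \<mu>: "\<And>b. 0 < 2 * b \<Longrightarrow> 2 * b \<le> n \<Longrightarrow> Y (current (2 * b - 1) (2 * b)) 0 v = sc (\<i> * of_int (\<mu> b)) v"
    and cas: "(\<Sum>i\<in>{0<..n}. \<Sum>j\<in>{0<..n}. Y (current i j) 0 (Y (current i j) 0 v)) =
      sc (of_int (- 2 * (\<Sum>b | 0 < 2 * b \<and> 2 * b \<le> n. \<mu> b * (\<mu> b + int n - 2 * int b)))) v"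
    using so.highest_weight_vector[OF Z \<open>Z \<noteq> {0}\<close> inv finite_atLeastAtMost_int eig even_zero] by blast
  have v': "v \<in> V0" "energy_op v = sc (of_int (int e)) v" "so.casimir v = sc C v" using v by (auto simp: Z_def)
  obtain xs where xs: "xs \<in> letters" "even (length xs)" "distinct xs" "int (energy xs) = int e"
    and w: "\<And>b. 0 < 2 * b \<Longrightarrow> 2 * b \<le> n \<Longrightarrow> weight b xs = \<mu> b"
    using eigenvector_has_word[OF v'(1) v(2) v'(2) \<mu>] by blast
  define M where "M = (\<Sum>b | 0 < 2 * b \<and> 2 * b \<le> n. \<mu> b * (\<mu> b + int n - 2 * int b))"
  have "{0<..n} = {1..n}" by auto
  then have "sc C v = sc (of_int (- 2 * M)) v"
    using cas v'(3) by (simp only: so.casimir_def M_def)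
  then have "C = of_int (- 2 * M)"
    using v(2) by (simp only: scale_cancel_right) simp
  moreover have "C = of_int (- 2 * ((int n + int K - 2) * int e))"
    using n by (simp add: C_def of_nat_diff algebra_simps)
  ultimately have "of_int (- 2 * M) = (of_int (- 2 * ((int n + int K - 2) * int e)) :: complex)" by simp
  then have "- 2 * M = - 2 * ((int n + int K - 2) * int e)" by (simp only: of_int_eq_iff)
  then have 3: "(\<Sum>b | 0 < 2 * b \<and> 2 * b \<le> n. \<mu> b * (\<mu> b + int n - 2 * int b)) = (int n + int K - 2) * int e"
    by (simp add: M_def)
  have 1: "(\<Sum>b | 0 < 2 * b \<and> 2 * b \<le> n. \<bar>\<mu> b\<bar>) \<le> int e"
  proof -
    have "(\<Sum>b | 0 < 2 * b \<and> 2 * b \<le> n. \<bar>\<mu> b\<bar>) = (\<Sum>b | 0 < 2 * b \<and> 2 * b \<le> n. \<bar>weight b xs\<bar>)"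
      by (intro sum.cong refl) (simp add: w)
    also have "\<dots> \<le> int (energy xs)"
      by (rule sum_abs_weight_le, rule finite_subset[of _ "{..n}"]) auto
    finally show ?thesis using xs by simp
  qed
  have 2: "(\<Sum>b | 0 < 2 * b \<and> 2 * b \<le> n. (\<mu> b)\<^sup>2) \<le> int K * int e"
  proof -
    have "(\<Sum>b | 0 < 2 * b \<and> 2 * b \<le> n. (\<mu> b)\<^sup>2) = (\<Sum>b | 0 < 2 * b \<and> 2 * b \<le> n. (weight b xs)\<^sup>2)"
      by (intro sum.cong refl) (simp add: w)
    then show ?thesis using sum_square_weight_le[OF xs(1,3)] xs(4) by simp
  qed
  have "int e = int K"
    by (rule extremal_weight[OF n _ refl 1 2 3]) (use e in simp)
  moreover have "even e" using xs even_energy[of xs] by simp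
  ultimately show False using K by simp
qed

text \<open>The Sugawara identity expresses \<open>T v\<close> by vectors of lower energy in the commutant, which lie in
  \<open>dual\<close> by induction. The eigenspace \<open>U\<close> of \<open>dual\<close> is mapped onto itself by \<open>T\<close>, so \<open>T v = T u\<close> for some \<open>u\<close>
  in \<open>U\<close>, and injectivity gives \<open>v = u\<close>.\<close>

lemma energy_eigenvector_in_dual:
  assumes n: "n \<ge> 3" and K: "odd K"
    and v: "v \<in> diag_commutant" "energy_op v = sc (of_nat e) v"
  shows "v \<in> dual"
  using v
proof (induction e arbitrary: v rule: less_induct)
  case (less e)
  note D = vertex_subalgebraD[OF dual_subalgebra] and W = vertex_subalgebraD[OF diag_commutant_subalgebra]
  have dualV0: "dual \<subseteq> V0" using dual_subset_diag_commutant diag_commutant_V0 by blast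
  show ?case
  proof (cases "e = 0")
    case True
    then have "v \<in> span (word chi ` {xs \<in> letters. int (energy xs) = 0})"
      using less.prems by (intro energy_eigenvector_span) simp
    moreover have nil: "xs = []" if "energy xs = 0" for xs
      using that by (cases xs) (auto simp: energy_def)
    have "word chi ` {xs \<in> letters. int (energy xs) = 0} \<subseteq> {vac}"
    proof (intro image_subsetI)
      fix xs assume "xs \<in> {xs \<in> letters. int (energy xs) = 0}"
      then have "xs = []" by (intro nil) simp
      then show "word chi xs \<in> {vac}" by simp
    qed
    then have "word chi ` {xs \<in> letters. int (energy xs) = 0} \<subseteq> dual" using D(2) by auto
    with calculation show ?thesis using span_minimal[OF _ D(1)] by blast
  next
    case False
    define T where "T u = so.casimir u - sc (- 2 * of_nat (n + K - 2) * of_nat e) u" for u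
    have T: "lin T" unfolding T_def
      by (rule linI) (simp_all add: lin_add[OF so.lin_casimir] lin_scale[OF so.lin_casimir] algebra_simps)
    have lower: "Y (current i j) s v \<in> dual" if ij: "i \<in> {1..n}" "j \<in> {1..n}" and s: "s \<ge> 1" for i j s
    proof -
      have w: "Y (current i j) s v \<in> diag_commutant"
        using W(3) current_in_diag_commutant[OF ij] less.prems by blast
      have en: "energy_op (Y (current i j) s v) = sc (of_int (int e - 2 * s)) (Y (current i j) s v)"
        using less.prems(2) by (simp add: energy_op_current[OF ij] Y_simps scale_left_diff_distrib)
      show ?thesis
      proof (cases "int e - 2 * s < 0")
        case True
        then show ?thesis using negative_energy_zero[OF en] D(1) subspace_0 by simp
      next
        case False
        then have "energy_op (Y (current i j) s v) = sc (of_nat (nat (int e - 2 * s))) (Y (current i j) s v)"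
          using en by (metis linorder_not_less of_int_of_nat_eq nat_0_le)
        then show ?thesis using s False w by (intro less.IH[of "nat (int e - 2 * s)"]) auto
      qed
    qed
    have mode: "Y (Y (current i j) (-1) (current i j)) 1 v - Y (current i j) 0 (Y (current i j) 0 v) \<in> dual"
      if ij: "i \<in> {1..n}" "j \<in> {1..n}" for i j
    proof -
      let ?x = "current i j"
      define f where "f t = Y ?x (- 1 - int t) (Y ?x (1 + int t) v) + Y ?x (- int t) (Y ?x (int t) v)" for t
      have x: "?x \<in> dual" by (rule current_in_dual[OF ij])
      have eq: "Y (Y ?x (-1) ?x) 1 v = Sum_any f"
        using ij by (subst normal_ordered_product) (auto simp: f_def current_even koszul_even_left)
      have d1: "Sum_any f - f 0 \<in> dual"
      proof (rule Sum_any_diff_first_in_subspace[OF D(1)])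
        show "f t \<in> dual" if "t \<noteq> 0" for t
        proof -
          have "Y ?x (1 + int t) v \<in> dual" "Y ?x (int t) v \<in> dual"
            using that by (auto intro!: lower[OF ij])
          then show ?thesis
            unfolding f_def by (intro subspace_add[OF D(1) D(3)[OF x] D(3)[OF x]])
        qed
        have "{t. f t \<noteq> 0} \<subseteq> {t. Y ?x (- 1 - int t) (Y ?x (1 + int t) v) \<noteq> 0}
            \<union> {t. Y ?x (0 - int t) (Y ?x (0 + int t) v) \<noteq> 0}"
          by (auto simp: f_def)
        then show "finite {t. f t \<noteq> 0}"
          by (rule finite_subset) (intro finite_UnI finite_product_support)
      qed
      have d2: "f 0 - Y ?x 0 (Y ?x 0 v) \<in> dual"
        using D(3)[OF x lower[OF ij, of 1], of "-1"] by (simp add: f_def)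
      show ?thesis
        using subspace_add[OF D(1) d1 d2] by (simp add: eq)
    qed
    have "(\<Sum>k\<in>{1..K}. \<Sum>l\<in>{1..K}. Y (Y (diag_current k l) (-1) (diag_current k l)) 1 v) = 0"
      using less.prems(1) diag_current_even diag_commutantD
      by (intro sum.neutral ballI product_annihilates) auto
    then have "(\<Sum>i\<in>{1..n}. \<Sum>j\<in>{1..n}. Y (Y (current i j) (-1) (current i j)) 1 v)
        = sc (- 2 * of_nat (n + K - 2) * of_nat e) v"
      using sugawara_operator[of v] less.prems(2) n K odd_pos[OF K] by simp
    moreover have "(\<Sum>i\<in>{1..n}. \<Sum>j\<in>{1..n}. Y (Y (current i j) (-1) (current i j)) 1 v
        - Y (current i j) 0 (Y (current i j) 0 v)) \<in> dual"
      by (intro subspace_sum[OF D(1)] mode)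
    ultimately have "sc (- 2 * of_nat (n + K - 2) * of_nat e) v - so.casimir v \<in> dual"
      by (simp only: sum_subtractf so.casimir_def)
    then have Tv: "T v \<in> dual" unfolding T_def using subspace_neg[OF D(1)] by fastforce
    define U where "U = {u \<in> dual. energy_op u = sc (of_nat e) u}"
    have TE: "energy_op (T u) = sc (of_nat e) (T u)" if "energy_op u = sc (of_nat e) u" for u
      unfolding T_def lin_diff[OF lin_energy_op] lin_scale[OF lin_energy_op] casimir_energy_op that
      by (simp add: lin_scale[OF so.lin_casimir] scale_right_distrib scale_right_diff_distrib mult.commute)
    have TD: "T u \<in> dual" if "u \<in> dual" for u
      unfolding T_def so.casimir_def using that current_in_dual
      by (intro subspace_diff[OF D(1)] subspace_sum[OF D(1)] subspace_scale[OF D(1)] D(3)) auto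
    have inj: "u = 0" if "u \<in> V0" "energy_op u = sc (of_nat e) u" "T u = 0" for u
    proof (rule casimir_extremal_zero[OF n K _ that(1,2)])
      show "so.casimir u = sc (- 2 * of_nat (n + K - 2) * of_nat e) u"
        using that(3) unfolding T_def by (simp only: right_minus_eq)
    qed (use False in simp)
    have "T ` U = U"
    proof (rule injective_imp_onto_finite_dimensional[OF T])
      show "subspace U"
        using D(1) unfolding U_def subspace_def
        by (auto simp: lin_zero[OF lin_energy_op] lin_add[OF lin_energy_op] lin_scale[OF lin_energy_op]
            scale_right_distrib mult.commute)
      show "U \<subseteq> span (word chi ` {xs \<in> letters. energy xs = e})"
        using energy_eigenvector_span[of _ "int e"] by (auto simp: U_def)
      show "finite (word chi ` {xs \<in> letters. energy xs = e})" using word_energy_finite by simp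
      show "T u \<in> U" if "u \<in> U" for u using that TD TE by (simp add: U_def)
      show "u = 0" if "u \<in> U" "T u = 0" for u using that inj dualV0 by (auto simp: U_def)
    qed
    moreover have "T v \<in> U" using Tv TE less.prems by (simp add: U_def)
    ultimately obtain u where u: "u \<in> U" "T u = T v" by (metis imageE)
    have "v - u = 0"
    proof (rule inj)
      show "v - u \<in> V0"
        using u less.prems dualV0 diag_commutant_V0 by (intro subspace_diff[OF subspace_V0]) (auto simp: U_def)
      show "energy_op (v - u) = sc (of_nat e) (v - u)"
        using u less.prems by (simp add: U_def lin_diff[OF lin_energy_op] scale_right_diff_distrib)
      show "T (v - u) = 0" using u by (simp add: lin_diff[OF T])
    qed
    then show ?thesis using u by (simp add: U_def)
  qed
qed

text \<open>The commutant is stable under the energy operator, so it contains the energy components of each of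
  its vectors.\<close>

theorem diag_commutant_eq_dual:
  assumes n: "n \<ge> 3" and K: "odd K"
  shows "diag_commutant = dual"
proof
  show "dual \<subseteq> diag_commutant" by (rule dual_subset_diag_commutant)
  show "diag_commutant \<subseteq> dual"
  proof
    fix v assume v: "v \<in> diag_commutant"
    obtain t r where t: "finite t" "t \<subseteq> word chi ` letters" "v = (\<Sum>x\<in>t. sc (r x) x)"
      using chi_words_span[of v] unfolding span_explicit by auto
    obtain B where B: "finite B" "B \<subseteq> letters" "t = word chi ` B"
      using finite_subset_image[OF t(1,2)] by auto
    define \<Lambda> :: "complex set" where "\<Lambda> = (\<lambda>xs. of_nat (energy xs)) ` B"
    have "t \<subseteq> eigenvectors energy_op \<Lambda>"
      using B energy_op_chi_word by (auto simp: eigenvectors_def \<Lambda>_def)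
    then have "v \<in> span (eigenvectors energy_op \<Lambda>)"
      unfolding t(3) by (intro span_sum span_scale span_base) auto
    moreover have "energy_op u \<in> diag_commutant" if u: "u \<in> diag_commutant" for u
    proof (rule diag_commutantI)
      show "energy_op u \<in> V0" using u by (intro energy_op_V0 diag_commutant_V0)
      fix k l p assume kl: "k \<in> {1..K}" "l \<in> {1..K}" and p: "(p::int) \<ge> 0"
      then show "Y (diag_current k l) p (energy_op u) = 0"
        using energy_op_diag_current[OF kl, of p u] diag_commutantD[OF u kl p] by (simp add: lin_zero[OF lin_energy_op])
    qed
    ultimately have "v \<in> span (diag_commutant \<inter> eigenvectors energy_op \<Lambda>)"
      using B(1) v vertex_subalgebraD(1)[OF diag_commutant_subalgebra]
      by (intro invariant_subspace_eigenvectors lin_energy_op) (auto simp: \<Lambda>_def)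
    moreover have "diag_commutant \<inter> eigenvectors energy_op \<Lambda> \<subseteq> dual"
      using energy_eigenvector_in_dual[OF n K] by (auto simp: eigenvectors_def \<Lambda>_def)
    ultimately show "v \<in> dual"
      using span_minimal[OF _ vertex_subalgebraD(1)[OF dual_subalgebra]] by blast
  qed
qed

end

lemma generate_fixed_iff:
  assumes S: "S \<subseteq> Bij A" and v: "v \<in> A"
  shows "(\<forall>g\<in>generate (BijGroup A) S. g v = v) \<longleftrightarrow> (\<forall>g\<in>S. g v = v)"
proof
  assume "\<forall>g\<in>generate (BijGroup A) S. g v = v"
  then show "\<forall>g\<in>S. g v = v" using generate.incl by fast
next
  assume fixed: "\<forall>g\<in>S. g v = v"
  interpret group "BijGroup A" by (rule group_BijGroup)
  show "\<forall>g\<in>generate (BijGroup A) S. g v = v"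
  proof
    fix g assume "g \<in> generate (BijGroup A) S"
    then have "g \<in> Bij A \<and> g v = v"
    proof (induction rule: generate.induct)
      case one
      then show ?case using v id_Bij[of A] by (simp add: BijGroup_def restrict_def)
    next
      case (incl h)
      then show ?case using S fixed by auto
    next
      case (inv h)
      then have h: "h \<in> Bij A" "h v = v" using S fixed by auto
      then have "inj_on h A" by (simp add: Bij_def bij_betw_def)
      then have "inv_into A h v = v" using h(2) v by (metis inv_into_f_f)
      then show ?case using h v restrict_inv_into_Bij[OF h(1)] by (simp add: inv_BijGroup restrict_def)
    next
      case (eng g h)
      then show ?case using v by (simp add: BijGroup_def compose_Bij compose_eq)
    qed
    then show "g v = v" by simp
  qed
qed

context fermion_vertex_superalgebra
begin

theorem commutant_tensor_diag:
  assumes n: "n \<ge> 3" and K: "K \<ge> 3" "odd K"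
    and sigma: "\<And>i. i \<in> {1..n} \<Longrightarrow> is_sigma sc V0 vac Y psi K n i (\<sigma> i)"
  shows "commutant Y tensor diag = fixed_points (generate (BijGroup V0) (\<sigma> ` {1..n})) dual"
proof -
  have tensor: "tensor = {v \<in> V0. \<forall>i\<in>{1..n}. \<sigma> i v = v}"
    using n by (intro tensor_eq_sigma_fixed K sigma) auto
  have dual: "diag_commutant = dual" by (rule diag_commutant_eq_dual[OF n K(2)])
  have Bij: "\<sigma> ` {1..n} \<subseteq> Bij V0"
    using sigma by (auto simp: is_sigma_def vertex_automorphisms_def)
  have V0: "dual \<subseteq> V0" using dual diag_commutant_V0 by blast
  have "commutant Y tensor diag = {v \<in> V0. \<forall>i\<in>{1..n}. \<sigma> i v = v} \<inter> dual"
    by (subst commutant_diag_eq) (auto simp: tensor dual)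
  also have "\<dots> = fixed_points (generate (BijGroup V0) (\<sigma> ` {1..n})) dual"
    using V0 generate_fixed_iff[OF Bij] by (auto simp: fixed_points_def subset_iff)
  finally show ?thesis .
qed

end

theorem theorem4p17:
  fixes sc :: "complex \<Rightarrow> 'a::ab_group_add \<Rightarrow> 'a"
    and V0 V1 :: "'a set" and vac :: 'a and Y :: "'a \<Rightarrow> int \<Rightarrow> 'a \<Rightarrow> 'a"
    and psi :: "nat \<Rightarrow> nat \<Rightarrow> int \<Rightarrow> 'a \<Rightarrow> 'a"
    and \<sigma> :: "nat \<Rightarrow> 'a \<Rightarrow> 'a" and m n :: nat
  defines "G \<equiv> generate (BijGroup V0) (\<sigma> ` {1..n})"
  assumes "m \<ge> 2"
    and "fermion_vertex_superalgebra sc V0 V1 vac Y psi (2 * m + 1) n"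
    and "\<And>i. i \<in> {1..n} \<Longrightarrow> is_sigma sc V0 vac Y psi (2 * m + 1) n i (\<sigma> i)"
  shows "(n = 3 \<longrightarrow>
           commutant Y (L_so_tensor sc vac Y psi (2 * m + 1) 3)
             (L_so_diag sc vac Y psi (2 * m + 1) 3)
           = fixed_points G (L_sl2 sc vac Y psi (2 * m + 1)))
       \<and> (n \<ge> 4 \<longrightarrow>
           commutant Y (L_so_tensor sc vac Y psi (2 * m + 1) n)
             (L_so_diag sc vac Y psi (2 * m + 1) n)
           = fixed_points G (L_so_dual sc vac Y psi (2 * m + 1) n))"
proof -
  interpret fermion_vertex_superalgebra sc V0 V1 vac Y psi "2 * m + 1" n
    by (rule assms(3))
  have "commutant Y (L_so_tensor sc vac Y psi (2 * m + 1) n) (L_so_diag sc vac Y psi (2 * m + 1) n)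
      = fixed_points G (L_so_dual sc vac Y psi (2 * m + 1) n)" if "n \<ge> 3"
    unfolding G_def by (rule commutant_tensor_diag) (use that assms(2,4) in auto)
  then show ?thesis by (auto simp: L_sl2_def)
qed

end
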